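(* Assume that $\Omega$ is convex, that the family of meshes $\{\mathcal{T}_h\}_{h>0}$ is quasi-uniform, and that $h$ is small enough (i.e. there is $h_0>0$ such that the following holds for every $h\le h_0$). Then there exists $(H_h,u_h)\in W_{h,\mathbb{C}}\times V_h$ such that $\tilde H_h:=H_h-H_\circ\in V_{h,\mathbb{C}}$ and $$(\nabla\tilde H_h,\nabla Q_h)_{\Omega,\mathbb{C}}+(i\omega\mu(u_h)\tilde H_h,Q_h)_{\Omega,\mathbb{C}}=(i\omega\mu(u_h)H_\circ,Q_h)_{\Omega,\mathbb{C}},$$ $$(\nabla u_h,\nabla v_h)_\Omega=(|\nabla H_h|^2,v_h)_\Omega,$$ for all $(Q_h,v_h)\in V_{h,\mathbb{C}}\times V_h$.
   Context: $\Omega\subset\mathbb{R}^2$ is an open, bounded, polygonal, Lipschitz domain. $\omega>0$ is a constant and $H_\circ\in\mathbb{C}$ is a constant (also viewed as a constant function). $\mu:\mathbb{R}\to\mathbb{R}$ is Lipschitz continuous and there are constants $\mu_\circ,\mu^\circ$ with $0<\mu_\circ\le\mu(s)\le\mu^\circ$ for all $s\in\mathbb{R}$. $(f,g)_\Omega=\int_\Omega f\cdot g\,d\boldsymbol{x}$ for real functions and $(f,g)_{\Omega,\mathbb{C}}=\int_\Omega f\cdot\bar g\,d\boldsymbol{x}$ for complex functions. $\{\mathcal{T}_h\}_{h>0}$ is a shape-regular family of simplicial triangulations of $\Omega$, $h$ being the mesh size. $W_h$ (resp. $W_{h,\mathbb{C}}$) is the space of continuous real-valued (resp. complex-valued) functions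 on $\overline\Omega$ whose restriction to each $K\in\mathcal{T}_h$ is a polynomial of degree at most $1$ with real (resp. complex) coefficients; $V_h=W_h\cap H^1_0(\Omega)$ and $V_{h,\mathbb{C}}=W_{h,\mathbb{C}}\cap H^1_0(\Omega;\mathbb{C})$. *)

theory Defs
  imports "HOL-Analysis.Analysis"
begin

section \<open>Domains\<close>

text \<open>
  The boundary is locally, in suitable Cartesian coordinates (orthonormal axes \<^term>\<open>e1\<close>,
  \<^term>\<open>e2\<close> centred at the boundary point), the graph of a Lipschitz function, with the set lying
  on one side of it.
\<close>

definition lipschitz_boundary :: "(real^2) set \<Rightarrow> bool" where
  "lipschitz_boundary \<Omega> \<longleftrightarrow>
     (\<forall>p\<in>frontier \<Omega>. \<exists>r>0. \<exists>e1 e2. \<exists>\<gamma> :: real \<Rightarrow> real.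
        norm e1 = 1 \<and> norm e2 = 1 \<and> e1 \<bullet> e2 = 0 \<and> (\<exists>L. L-lipschitz_on UNIV \<gamma>) \<and>
        \<Omega> \<inter> ball p r = {x \<in> ball p r. \<gamma> ((x - p) \<bullet> e1) < (x - p) \<bullet> e2})"

definition polygonal :: "(real^2) set \<Rightarrow> bool" where
  "polygonal \<Omega> \<longleftrightarrow>
     (\<exists>S. finite S \<and> frontier \<Omega> = (\<Union>(a, b)\<in>S. closed_segment a b))"

definition polygonal_lipschitz_domain :: "(real^2) set \<Rightarrow> bool" where
  "polygonal_lipschitz_domain \<Omega> \<longleftrightarrow>
     open \<Omega> \<and> connected \<Omega> \<and> \<Omega> \<noteq> {} \<and> bounded \<Omega> \<and> polygonal \<Omega> \<and> lipschitz_boundary \<Omega>"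


section \<open>Test functions, weak gradients and Sobolev spaces\<close>

definition partial_deriv :: "2 \<Rightarrow> (real^2 \<Rightarrow> 'a::real_normed_vector) \<Rightarrow> real^2 \<Rightarrow> 'a" where
  "partial_deriv i f x = frechet_derivative f (at x) (axis i 1)"

text \<open>
  Being a coinductive predicate, \<open>smooth\<close> says that all iterated partial derivatives exist and are
  differentiable, that is, the function is of class $C^\infty$ on the plane.
\<close>

coinductive smooth :: "(real^2 \<Rightarrow> 'a::real_normed_vector) \<Rightarrow> bool" where
  "(\<forall>x. f differentiable (at x)) \<Longrightarrow> (\<forall>i. smooth (partial_deriv i f)) \<Longrightarrow> smooth f"

text \<open>The elements of $C_c^\infty(\Omega)$, extended by zero to the whole plane.\<close>

definition test_functions :: "(real^2) set \<Rightarrow> (real^2 \<Rightarrow> 'a::real_normed_vector) set" where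
  "test_functions \<Omega> =
     {\<phi>. smooth \<phi> \<and> compact (closure {x. \<phi> x \<noteq> 0}) \<and> closure {x. \<phi> x \<noteq> 0} \<subseteq> \<Omega>}"

definition locally_integrable :: "(real^2) set \<Rightarrow> (real^2 \<Rightarrow> 'b::euclidean_space) \<Rightarrow> bool" where
  "locally_integrable \<Omega> f \<longleftrightarrow> (\<forall>K. compact K \<and> K \<subseteq> \<Omega> \<longrightarrow> set_integrable lebesgue K f)"

definition square_integrable :: "(real^2) set \<Rightarrow> (real^2 \<Rightarrow> 'b::euclidean_space) \<Rightarrow> bool" where
  "square_integrable \<Omega> f \<longleftrightarrow>
     set_borel_measurable lebesgue \<Omega> f \<and> set_integrable lebesgue \<Omega> (\<lambda>x. (norm (f x))\<^sup>2)"

text \<open>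
  Below, \<^typ>\<open>'a\<close> is \<^typ>\<open>real\<close> or \<^typ>\<open>complex\<close>. Functions are total on the plane, but only
  their values on \<open>\<Omega>\<close> (on its closure, for finite element functions) matter.
\<close>

definition has_weak_gradient ::
  "(real^2) set \<Rightarrow> (real^2 \<Rightarrow> 'a::{real_normed_field,euclidean_space}) \<Rightarrow> (real^2 \<Rightarrow> 'a^2) \<Rightarrow> bool"
  where
  "has_weak_gradient \<Omega> u G \<longleftrightarrow>
     locally_integrable \<Omega> u \<and> locally_integrable \<Omega> G \<and>
     (\<forall>\<phi> \<in> (test_functions \<Omega> :: (real^2 \<Rightarrow> real) set). \<forall>i.
        (LINT x:\<Omega>|lebesgue. partial_deriv i \<phi> x *\<^sub>R u x) = - (LINT x:\<Omega>|lebesgue. \<phi> x *\<^sub>R (G x $ i)))"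

text \<open>A representative of the weak gradient, which is unique up to null sets if it exists.\<close>

definition weak_gradient ::
  "(real^2) set \<Rightarrow> (real^2 \<Rightarrow> 'a::{real_normed_field,euclidean_space}) \<Rightarrow> real^2 \<Rightarrow> 'a^2" where
  "weak_gradient \<Omega> u = (SOME G. has_weak_gradient \<Omega> u G)"

definition H1 :: "(real^2) set \<Rightarrow> (real^2 \<Rightarrow> 'a::{real_normed_field,euclidean_space}) set" where
  "H1 \<Omega> = {u. square_integrable \<Omega> u \<and> (\<exists>G. has_weak_gradient \<Omega> u G \<and> square_integrable \<Omega> G)}"

definition H1_norm ::
  "(real^2) set \<Rightarrow> (real^2 \<Rightarrow> 'a::{real_normed_field,euclidean_space}) \<Rightarrow> real" where
  "H1_norm \<Omega> u = sqrt ((LINT x:\<Omega>|lebesgue. (norm (u x))\<^sup>2) +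
                      (LINT x:\<Omega>|lebesgue. (norm (weak_gradient \<Omega> u x))\<^sup>2))"

text \<open>The closure of $C_c^\infty(\Omega)$ in $H^1(\Omega)$.\<close>

definition H10 :: "(real^2) set \<Rightarrow> (real^2 \<Rightarrow> 'a::{real_normed_field,euclidean_space}) set" where
  "H10 \<Omega> = {u \<in> H1 \<Omega>. \<forall>\<epsilon>>0. \<exists>\<phi>\<in>test_functions \<Omega>. H1_norm \<Omega> (\<lambda>x. u x - \<phi> x) < \<epsilon>}"

text \<open>
  The products $(f,g)_\Omega$ and $(f,g)_{\Omega,\mathbb{C}}$. The first covers scalar and
  vector-valued real functions; the inner product of \<^typ>\<open>complex\<close> is only the real part of the
  Hermitian one, so the complex versions are written out, for scalars and for vectors.
\<close>

definition ip_real ::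
  "(real^2) set \<Rightarrow> (real^2 \<Rightarrow> 'v::real_inner) \<Rightarrow> (real^2 \<Rightarrow> 'v) \<Rightarrow> real" where
  "ip_real \<Omega> f g = (LINT x:\<Omega>|lebesgue. f x \<bullet> g x)"

definition ip_complex ::
  "(real^2) set \<Rightarrow> (real^2 \<Rightarrow> complex) \<Rightarrow> (real^2 \<Rightarrow> complex) \<Rightarrow> complex" where
  "ip_complex \<Omega> f g = (LINT x:\<Omega>|lebesgue. f x * cnj (g x))"

definition ip_complex_vec ::
  "(real^2) set \<Rightarrow> (real^2 \<Rightarrow> complex^2) \<Rightarrow> (real^2 \<Rightarrow> complex^2) \<Rightarrow> complex" where
  "ip_complex_vec \<Omega> f g = (LINT x:\<Omega>|lebesgue. (\<Sum>i\<in>UNIV. f x $ i * cnj (g x $ i)))"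


section \<open>Meshes and finite element spaces\<close>

text \<open>By \<^const>\<open>triangulation\<close>, two triangles meet in a common (possibly empty) face.\<close>

definition mesh :: "(real^2) set \<Rightarrow> (real^2) set set \<Rightarrow> bool" where
  "mesh \<Omega> \<T> \<longleftrightarrow> triangulation \<T> \<and> (\<forall>K\<in>\<T>. 2 simplex K) \<and> \<Union>\<T> = closure \<Omega>"

definition mesh_size :: "(real^2) set set \<Rightarrow> real" where
  "mesh_size \<T> = Max (diameter ` \<T>)"

text \<open>The diameter of the largest disc contained in \<^term>\<open>K\<close>.\<close>

definition inball_diameter :: "(real^2) set \<Rightarrow> real" where
  "inball_diameter K = Sup {2 * r | r x. 0 \<le> r \<and> cball x r \<subseteq> K}"

text \<open>
  A family of meshes is indexed by the set \<^term>\<open>I\<close> of its mesh sizes, since for a given domain not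
  every positive number is the size of a mesh.
\<close>

definition mesh_family :: "(real^2) set \<Rightarrow> real set \<Rightarrow> (real \<Rightarrow> (real^2) set set) \<Rightarrow> bool" where
  "mesh_family \<Omega> I \<T> \<longleftrightarrow> I \<subseteq> {0<..} \<and> (\<forall>h\<in>I. mesh \<Omega> (\<T> h) \<and> mesh_size (\<T> h) = h)"

definition shape_regular :: "real set \<Rightarrow> (real \<Rightarrow> (real^2) set set) \<Rightarrow> bool" where
  "shape_regular I \<T> \<longleftrightarrow> (\<exists>\<sigma>>0. \<forall>h\<in>I. \<forall>K\<in>\<T> h. diameter K \<le> \<sigma> * inball_diameter K)"

definition quasi_uniform :: "real set \<Rightarrow> (real \<Rightarrow> (real^2) set set) \<Rightarrow> bool" where
  "quasi_uniform I \<T> \<longleftrightarrow> (\<exists>c>0. \<forall>h\<in>I. \<forall>K\<in>\<T> h. c * h \<le> diameter K)"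

definition P1_space ::
  "(real^2) set \<Rightarrow> (real^2) set set \<Rightarrow> (real^2 \<Rightarrow> 'a::{real_normed_field,euclidean_space}) set" where
  "P1_space \<Omega> \<T> =
     {w. continuous_on (closure \<Omega>) w \<and>
         (\<forall>K\<in>\<T>. \<exists>c0 c1 c2. \<forall>x\<in>K. w x = c0 + c1 * of_real (x $ 1) + c2 * of_real (x $ 2))}"

definition P1_space0 ::
  "(real^2) set \<Rightarrow> (real^2) set set \<Rightarrow> (real^2 \<Rightarrow> 'a::{real_normed_field,euclidean_space}) set" where
  "P1_space0 \<Omega> \<T> = P1_space \<Omega> \<T> \<inter> H10 \<Omega>"

end

theory Submission
  imports Defs
begin

text \<open>
  For one fixed mesh the problem is a system of equations in finitely many real unknowns, and the
  proof finds a zero of a continuous vector field by a topological argument.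

  Both finite element spaces, the complex one regarded as a real vector space, carry the Dirichlet form
  $(u,v) \mapsto \int_\Omega \nabla u \cdot \nabla v$. It is positive definite on them: if the gradient
  of an element of $H^1_0(\Omega)$ vanishes, then so does the element, by the Poincare inequality for test
  functions (\<open>Poincare_inequality\<close>, \<open>H10_eq_zero_if_gradient_zero\<close>).
  So there are finite orthonormal bases (\<open>P1_space0_orthonormal_basis\<close>). In the coordinates
  $y$ of $\tilde H_h$ and $x$ of $u_h$ the two equations become $y_i = g_i(y,x)$ and $x_k = q_k(y)$:
  the Dirichlet form contributes the identity matrix, $g$ the terms with $\mu(u_h)$, and
  $q_k(y) = \int_\Omega |\nabla \tilde H_h|^2 b_k$ is a quadratic form in $y$.

  Two facts make this system solvable (\<open>coupled_system_solvable\<close>). The function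
  $i \omega \mu(u_h) \tilde H_h$ is pointwise orthogonal to $\tilde H_h$ in the real inner product of the
  complex plane, so testing the first equation with $\tilde H_h$ leaves only the term with $H_\circ$,
  which bounds $|y|$ independently of $x$. Once $|y|$ is bounded, $q(y)$ is bounded too, because
  all norms on a finite-dimensional space are comparable; the constant depends on the mesh. The zero
  itself is provided by Brouwer's theorem in the form \<open>zero_of_vector_field_on_cube\<close>: a
  continuous field on a cube that points outward on the boundary, in the sense of $z \cdot P(z) \ge 0$,
  has a zero. This form is derived from Kuhn's combinatorial lemma because the number of coordinates is
  a natural number that depends on the mesh, and not the dimension of a type.

  Weak gradients are only determined up to null sets, and the Dirichlet form is built from a chosen
  representative. Bilinearity therefore rests on their uniqueness (\<open>has_weak_gradient_unique\<close>),
  that is, on the fundamental lemma of the calculus of variations (\<open>AE_zero_of_test_functions\<close>),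
  for which test functions are built from $e^{-1/t}$. Gradients of
  piecewise affine functions never have to be computed.
\<close>

section \<open>Zeros of continuous vector fields in finitely many coordinates\<close>

text \<open>
  The Bolzano-Weierstrass theorem, one coordinate after the other. Points are functions on the
  naturals of which only the first \<open>n\<close> values matter.
\<close>

lemma bounded_coordinates_convergent_subseq:
  fixes X :: "nat \<Rightarrow> nat \<Rightarrow> real"
  assumes "\<And>k i. i < n \<Longrightarrow> \<bar>X k i\<bar> \<le> R"
  shows "\<exists>r x. strict_mono (r :: nat \<Rightarrow> nat) \<and> (\<forall>i<n. (\<lambda>k. X (r k) i) \<longlonglongrightarrow> x i)"
  using assms
proof (induction n)
  case 0
  show ?case by (auto intro: exI[of _ id] simp: strict_mono_def)
next
  case (Suc n)
  then obtain r x where r: "strict_mono r" "\<And>i. i < n \<Longrightarrow> (\<lambda>k. X (r k) i) \<longlonglongrightarrow> x i"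
    by (metis less_SucI)
  have "bounded (range (\<lambda>k. X (r k) n))"
    using Suc.prems by (auto simp: bounded_iff)
  then obtain y s where s: "strict_mono s" "((\<lambda>k. X (r k) n) \<circ> s) \<longlonglongrightarrow> y"
    using bounded_imp_convergent_subsequence by blast
  have "(\<lambda>k. X ((r \<circ> s) k) i) \<longlonglongrightarrow> (x(n := y)) i" if "i < Suc n" for i
  proof (cases "i = n")
    case True
    then show ?thesis using s by (simp add: o_def)
  next
    case False
    then show ?thesis
      using that LIMSEQ_subseq_LIMSEQ[OF r(2) s(1), of i] by (simp add: o_def)
  qed
  then show ?case
    using strict_mono_o[OF r(1) s(1)] by blast
qed

text \<open>
  Label a node of a fine grid, in direction \<open>i\<close>, by the sign of the
  \<open>i\<close>-th component of \<open>P\<close>, the labels on the two faces being those that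
  Kuhn's lemma prescribes. The lemma yields, for every grid, a small cell in which each direction
  sees both labels. At a limit point of these cells every component satisfies \<open>P z i \<le>
  0\<close> or \<open>z i = - R\<close>, and \<open>P z i \<ge> 0\<close> or \<open>z i =
  R\<close>. A nonzero component would thus put the point on the boundary and make $z \cdot P(z)$
  negative. Continuity is sequential continuity in the coordinates.
\<close>

lemma zero_of_vector_field_on_cube:
  fixes P :: "(nat \<Rightarrow> real) \<Rightarrow> nat \<Rightarrow> real"
  assumes R: "R > 0"
    and cont: "\<And>X x i. \<lbrakk>i < n; \<And>j. j < n \<Longrightarrow> (\<lambda>k. X k j) \<longlonglongrightarrow> x j\<rbrakk>
        \<Longrightarrow> (\<lambda>k. P (X k) i) \<longlonglongrightarrow> P x i"
    and outward: "\<And>z i. \<lbrakk>\<And>j. j < n \<Longrightarrow> \<bar>z j\<bar> \<le> R; i < n; \<bar>z i\<bar> = R\<rbrakk>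
        \<Longrightarrow> 0 \<le> (\<Sum>j<n. z j * P z j)"
  shows "\<exists>z. \<forall>i<n. P z i = 0"
proof -
  define node where "node p q = (\<lambda>j. 2 * R * real (q j) / real (Suc p) - R)" for p and q :: "nat \<Rightarrow> nat"
  \<comment> \<open>The second disjunct excludes the face \<open>z i = R\<close>, where Kuhn's lemma requires the other label.\<close>
  define low where "low z i \<longleftrightarrow> z i = - R \<or> (P z i \<le> 0 \<and> z i < R)" for z i
  define label where "label p q i = (if low (node p q) i then 0 else (1::nat))" for p q i
  have low_end: "node p q i = - R \<longleftrightarrow> q i = 0" for p q i
    using R by (auto simp: node_def)
  have high_end: "node p q i = R \<longleftrightarrow> q i = Suc p" for p q i
  proof
    assume "node p q i = R"
    then have "real (q i) = real (Suc p)"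
      using R by (simp add: node_def field_simps del: of_nat_Suc)
    then show "q i = Suc p" by linarith
  qed (use R in \<open>simp add: node_def field_simps\<close>)
  define adj where "adj q r \<longleftrightarrow> (\<forall>j<n. q j \<le> r j \<and> r j \<le> q j + 1)" for q r :: "nat \<Rightarrow> nat"
  have "\<exists>q. (\<forall>i<n. q i < Suc p) \<and>
      (\<forall>i<n. \<exists>r s. adj q r \<and> adj q s \<and> label p r i \<noteq> label p s i)" for p
  proof -
    have 1: "\<forall>x. (\<forall>i<n. x i \<le> Suc p) \<longrightarrow> (\<forall>i<n. label p x i = (0::nat) \<or> label p x i = 1)"
      by (simp add: label_def)
    have 2: "\<forall>x. (\<forall>i<n. x i \<le> Suc p) \<longrightarrow> (\<forall>i<n. x i = 0 \<longrightarrow> label p x i = 0)"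
      by (simp add: label_def low_def low_end)
    have "label p x i = 1" if "x i = Suc p" for x i
      using high_end[of p x i, THEN iffD2, OF that] R by (simp add: label_def low_def)
    then have 3: "\<forall>x. (\<forall>i<n. x i \<le> Suc p) \<longrightarrow> (\<forall>i<n. x i = Suc p \<longrightarrow> label p x i = 1)"
      by blast
    show ?thesis
      using kuhn_lemma[OF zero_less_Suc 1 2 3] unfolding adj_def by metis
  qed
  then obtain q where q: "\<And>p i. i < n \<Longrightarrow> q p i < Suc p"
    and near: "\<And>p i. i < n \<Longrightarrow> \<exists>r s. adj (q p) r \<and> adj (q p) s \<and> label p r i \<noteq> label p s i"
    by metis
  have "\<forall>pi::nat \<times> nat. snd pi < n \<longrightarrow> (\<exists>rs. adj (q (fst pi)) (fst rs) \<and> adj (q (fst pi)) (snd rs) \<and>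
      low (node (fst pi) (fst rs)) (snd pi) \<and> \<not> low (node (fst pi) (snd rs)) (snd pi))"
  proof (intro allI impI)
    fix pi :: "nat \<times> nat" assume "snd pi < n"
    from near[OF this, of "fst pi"] obtain r s where "adj (q (fst pi)) r" "adj (q (fst pi)) s"
      "label (fst pi) r (snd pi) \<noteq> label (fst pi) s (snd pi)" by blast
    then show "\<exists>rs. adj (q (fst pi)) (fst rs) \<and> adj (q (fst pi)) (snd rs) \<and>
      low (node (fst pi) (fst rs)) (snd pi) \<and> \<not> low (node (fst pi) (snd rs)) (snd pi)"
      by (auto simp: label_def split: if_splits intro: exI[of _ "(r, s)"] exI[of _ "(s, r)"])
  qed
  then obtain rs' where rs': "\<forall>pi. snd pi < n \<longrightarrow>
      adj (q (fst pi)) (fst (rs' pi)) \<and> adj (q (fst pi)) (snd (rs' pi)) \<and>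
      low (node (fst pi) (fst (rs' pi))) (snd pi) \<and> \<not> low (node (fst pi) (snd (rs' pi))) (snd pi)"
    unfolding choice_iff' by blast
  define r s where "r p i = fst (rs' (p, i))" and "s p i = snd (rs' (p, i))" for p i
  have rs: "adj (q p) (r p i)" "adj (q p) (s p i)" "low (node p (r p i)) i" "\<not> low (node p (s p i)) i"
    if "i < n" for p i
    using rs'[rule_format, of "(p, i)"] that by (auto simp: r_def s_def)
  have node_le: "\<bar>node p q' j\<bar> \<le> R" if "q' j \<le> Suc p" for p q' j
  proof -
    have "0 \<le> 2 * R * real (q' j) / real (Suc p)" "2 * R * real (q' j) / real (Suc p) \<le> 2 * R"
      using R that by (auto simp: field_simps simp del: of_nat_Suc)
    then show ?thesis by (auto simp: node_def)
  qed
  have "\<bar>node p (q p) i\<bar> \<le> R" if "i < n" for p i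
    using node_le[of "q p" i p] q[OF that, of p] by simp
  then obtain t z where t: "strict_mono t"
    and z: "\<And>i. i < n \<Longrightarrow> (\<lambda>k. node (t k) (q (t k)) i) \<longlonglongrightarrow> z i"
    using bounded_coordinates_convergent_subseq[of n "\<lambda>p. node p (q p)" R] by blast
  have close: "(\<lambda>k. node (t k) (w (t k)) j) \<longlonglongrightarrow> z j"
    if "j < n" "\<And>p. adj (q p) (w p)" for w j
  proof -
    have "(\<lambda>p. node p (w p) j - node p (q p) j) \<longlonglongrightarrow> 0"
    proof (rule Lim_null_comparison)
      have "\<bar>node p (w p) j - node p (q p) j\<bar> \<le> 2 * R / real (Suc p)" for p
      proof -
        have "node p (w p) j - node p (q p) j = 2 * R * (real (w p j) - real (q p j)) / real (Suc p)"
          by (simp add: node_def right_diff_distrib diff_divide_distrib)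
        moreover have "0 \<le> real (w p j) - real (q p j)" "real (w p j) - real (q p j) \<le> 1"
          using that(2)[of p] that(1) by (force simp: adj_def)+
        ultimately show ?thesis
          using R by (simp add: abs_mult divide_right_mono mult_left_le)
      qed
      then show "eventually (\<lambda>p. norm (node p (w p) j - node p (q p) j) \<le> 2 * R * inverse (real (Suc p))) sequentially"
        by (simp add: divide_inverse)
      show "(\<lambda>p. 2 * R * inverse (real (Suc p))) \<longlonglongrightarrow> 0"
        by (rule tendsto_mult_right_zero[OF LIMSEQ_inverse_real_of_nat])
    qed
    then have "(\<lambda>k. node (t k) (w (t k)) j - node (t k) (q (t k)) j) \<longlonglongrightarrow> 0"
      by (rule LIMSEQ_subseq_LIMSEQ[OF _ t, unfolded o_def])
    from tendsto_add[OF this z[OF that(1)]] show ?thesis by simp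
  qed
  have z_le: "\<bar>z j\<bar> \<le> R" if "j < n" for j
    by (rule LIMSEQ_le_const2[OF tendsto_rabs[OF z[OF that]]])
      (use node_le q[OF that] in \<open>auto simp: less_imp_le\<close>)
  have rl: "P z i \<le> 0 \<or> z i = - R" if i: "i < n" for i
  proof (rule ccontr)
    assume neg: "\<not> ?thesis"
    have 1: "(\<lambda>k. node (t k) (r (t k) i) i) \<longlonglongrightarrow> z i" "(\<lambda>k. P (node (t k) (r (t k) i)) i) \<longlonglongrightarrow> P z i"
      using rs(1)[OF i] i by (auto intro!: cont close)
    have "eventually (\<lambda>k. P (node (t k) (r (t k) i)) i > 0) sequentially"
      "eventually (\<lambda>k. node (t k) (r (t k) i) i > - R) sequentially"
      using neg z_le[OF i] by (auto intro!: order_tendstoD(1)[OF 1(1)] order_tendstoD(1)[OF 1(2)])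
    then have "eventually (\<lambda>k. False) sequentially"
    proof eventually_elim
      case (elim k)
      then show ?case using rs(3)[OF i, of "t k"] by (auto simp: low_def)
    qed
    then show False by simp
  qed
  have sl: "P z i \<ge> 0 \<or> z i = R" if i: "i < n" for i
  proof (rule ccontr)
    assume neg: "\<not> ?thesis"
    have 1: "(\<lambda>k. node (t k) (s (t k) i) i) \<longlonglongrightarrow> z i" "(\<lambda>k. P (node (t k) (s (t k) i)) i) \<longlonglongrightarrow> P z i"
      using rs(2)[OF i] i by (auto intro!: cont close)
    have "eventually (\<lambda>k. P (node (t k) (s (t k) i)) i < 0) sequentially"
      "eventually (\<lambda>k. node (t k) (s (t k) i) i < R) sequentially"
      using neg z_le[OF i] by (auto intro!: order_tendstoD(2)[OF 1(1)] order_tendstoD(2)[OF 1(2)])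
    then have "eventually (\<lambda>k. False) sequentially"
    proof eventually_elim
      case (elim k)
      then show ?case using rs(4)[OF i, of "t k"] by (auto simp: low_def)
    qed
    then show False by simp
  qed
  have "z i * P z i \<le> 0" if "i < n" for i
    using rl[OF that] sl[OF that] R by (auto simp: mult_le_0_iff)
  have "P z i = 0" if i: "i < n" for i
  proof (rule ccontr)
    assume nz: "P z i \<noteq> 0"
    then have zi: "\<bar>z i\<bar> = R" and neg: "z i * P z i < 0"
      using rl[OF i] sl[OF i] R by (auto simp: mult_less_0_iff)
    have "(\<Sum>j<n. z j * P z j) < 0"
      using sum_strict_mono_ex1[of "{..<n}" "\<lambda>j. z j * P z j" "\<lambda>_. 0"]
        \<open>\<And>i. i < n \<Longrightarrow> z i * P z i \<le> 0\<close> neg i by auto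
    then show False
      using outward[of z i, OF z_le i zi] by simp
  qed
  then show ?thesis by blast
qed

text \<open>
  The unknowns form one vector, \<open>z i\<close> for \<open>i < m\<close> and \<open>z (m +
  i)\<close> for \<open>i < n\<close>. Since \<open>q\<close> grows quadratically, the field $z -
  (g(z), q(z))$ need not point outward on any large cube. Therefore \<open>q\<close> is first
  damped by a factor that equals 1 as long as $|y|^2 \le C$, where $y$ collects the first
  \<open>m\<close> coordinates. The damped \<open>q\<close> is bounded, so the field does point
  outward. At a zero the bound on $y \cdot g$ forces $|y|^2 \le C$, so the damping is not active
  there.
\<close>

lemma coupled_system_solvable:
  fixes g q :: "(nat \<Rightarrow> real) \<Rightarrow> nat \<Rightarrow> real" and F M :: "nat \<Rightarrow> real"
  assumes g_cont: "\<And>X x i. \<lbrakk>i < m; \<And>j. j < m + n \<Longrightarrow> (\<lambda>k. X k j) \<longlonglongrightarrow> x j\<rbrakk>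
        \<Longrightarrow> (\<lambda>k. g (X k) i) \<longlonglongrightarrow> g x i"
    and q_cont: "\<And>X x i. \<lbrakk>i < n; \<And>j. j < m + n \<Longrightarrow> (\<lambda>k. X k j) \<longlonglongrightarrow> x j\<rbrakk>
        \<Longrightarrow> (\<lambda>k. q (X k) i) \<longlonglongrightarrow> q x i"
    and g_le: "\<And>z. (\<Sum>i<m. z i * g z i) \<le> (\<Sum>i<m. \<bar>z i\<bar> * F i)"
    and q_le: "\<And>z i. i < n \<Longrightarrow> \<bar>q z i\<bar> \<le> M i * (\<Sum>j<m. (z j)\<^sup>2)"
    and F: "\<And>i. i < m \<Longrightarrow> 0 \<le> F i" and M: "\<And>i. i < n \<Longrightarrow> 0 \<le> M i"
  shows "\<exists>z. (\<forall>i<m. z i = g z i) \<and> (\<forall>i<n. z (m + i) = q z i)"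
proof -
  define s where "s z = (\<Sum>j<m. (z j)\<^sup>2)" for z :: "nat \<Rightarrow> real"
  \<comment> \<open>At a solution $|y|^2 = y \cdot g \le |y| \sum_i F_i$, so $|y|^2$ cannot exceed \<open>C\<close>; the 1 keeps \<open>C\<close> positive.\<close>
  define C where "C = 1 + (\<Sum>i<m. F i)\<^sup>2"
  \<comment> \<open>On the cube $z \cdot (g, q) \le R (R - 1)$ after damping, while $|z|^2 \ge R^2$ on its boundary.\<close>
  define R where "R = 1 + (\<Sum>i<m. F i) + C * (\<Sum>i<n. M i)"
  define P where "P z i = (if i < m then z i - g z i else z i - C / max C (s z) * q z (i - m))" for z i
  have C: "C > 0" by (auto simp: C_def add_pos_nonneg)
  have s0: "0 \<le> s z" for z by (auto simp: s_def sum_nonneg)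
  have F0: "0 \<le> (\<Sum>i<m. F i)" and M0: "0 \<le> (\<Sum>i<n. M i)"
    using F M by (auto intro: sum_nonneg)
  have R: "R > 0" using C F0 M0 by (auto simp: R_def add_pos_nonneg)
  have split: "(\<Sum>i<m+n. w i) = (\<Sum>i<m. w i) + (\<Sum>i<n. w (m + i))" for w :: "nat \<Rightarrow> real"
    by (induction n) auto
  have "\<exists>z. \<forall>i<m+n. P z i = 0"
  proof (rule zero_of_vector_field_on_cube[OF R])
    fix X :: "nat \<Rightarrow> nat \<Rightarrow> real" and x i assume i: "i < m + n" and X: "\<And>j. j < m + n \<Longrightarrow> (\<lambda>k. X k j) \<longlonglongrightarrow> x j"
    have "(\<lambda>k. s (X k)) \<longlonglongrightarrow> s x"
      unfolding s_def by (intro tendsto_intros X) auto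
    moreover have "max C (s x) \<noteq> 0" using C by linarith
    ultimately show "(\<lambda>k. P (X k) i) \<longlonglongrightarrow> P x i"
      using i X g_cont[OF _ X] q_cont[of "i - m", OF _ X]
      by (cases "i < m") (auto simp: P_def intro!: tendsto_intros)
  next
    fix z i assume z: "\<And>j. j < m + n \<Longrightarrow> \<bar>z j\<bar> \<le> R" and i: "i < m + n" and zi: "\<bar>z i\<bar> = R"
    have q': "\<bar>C / max C (s z) * q z j\<bar> \<le> C * M j" if j: "j < n" for j
    proof -
      have "\<bar>C / max C (s z) * q z j\<bar> \<le> C / max C (s z) * (M j * s z)"
        using q_le[OF j, of z] C unfolding abs_mult s_def[symmetric]
        by (intro mult_mono) auto
      also have "\<dots> = (C * M j) * (s z / max C (s z))" by simp
      also have "\<dots> \<le> (C * M j) * 1"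
        using C M[OF j] s0[of z] by (intro mult_left_mono) (auto simp: divide_le_eq)
      finally show ?thesis by simp
    qed
    have "(\<Sum>j<m. z j * g z j) \<le> (\<Sum>j<m. \<bar>z j\<bar> * F j)" by (rule g_le)
    also have "\<dots> \<le> (\<Sum>j<m. R * F j)"
      using z F by (intro sum_mono mult_right_mono) auto
    finally have 1: "(\<Sum>j<m. z j * g z j) \<le> R * (\<Sum>j<m. F j)" by (simp add: sum_distrib_left)
    have "(\<Sum>j<n. z (m + j) * (C / max C (s z) * q z j)) \<le> (\<Sum>j<n. R * (C * M j))"
    proof (rule sum_mono)
      fix j assume j: "j \<in> {..<n}"
      have "z (m + j) * (C / max C (s z) * q z j) \<le> \<bar>z (m + j)\<bar> * \<bar>C / max C (s z) * q z j\<bar>"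
        by (metis abs_ge_self abs_mult)
      also have "\<dots> \<le> R * (C * M j)"
        using z j q' R C M by (intro mult_mono) auto
      finally show "z (m + j) * (C / max C (s z) * q z j) \<le> R * (C * M j)" .
    qed
    then have 2: "(\<Sum>j<n. z (m + j) * (C / max C (s z) * q z j)) \<le> R * (C * (\<Sum>j<n. M j))"
      by (simp add: sum_distrib_left)
    have "R\<^sup>2 = (z i)\<^sup>2" using zi by (metis power2_abs)
    also have "\<dots> \<le> (\<Sum>j<m+n. (z j)\<^sup>2)"
      using i by (intro member_le_sum) auto
    finally have 3: "R\<^sup>2 \<le> (\<Sum>j<m+n. (z j)\<^sup>2)" .
    have "(\<Sum>j<m+n. z j * P z j) = (\<Sum>j<m+n. (z j)\<^sup>2) - (\<Sum>j<m. z j * g z j)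
        - (\<Sum>j<n. z (m + j) * (C / max C (s z) * q z j))"
      by (simp add: split P_def right_diff_distrib sum_subtractf power2_eq_square)
    moreover have "R * (\<Sum>j<m. F j) + R * (C * (\<Sum>j<n. M j)) \<le> R\<^sup>2"
    proof -
      have "R * ((\<Sum>j<m. F j) + C * (\<Sum>j<n. M j)) \<le> R * R"
        using R by (intro mult_left_mono) (auto simp: R_def)
      then show ?thesis by (simp add: power2_eq_square distrib_left)
    qed
    ultimately show "0 \<le> (\<Sum>j<m+n. z j * P z j)" using 1 2 3 by linarith
  qed
  then obtain z where z: "\<And>i. i < m + n \<Longrightarrow> P z i = 0" by blast
  have zg: "z i = g z i" if "i < m" for i
    using z[of i] that by (simp add: P_def)
  have le: "\<bar>z i\<bar> \<le> sqrt (s z)" if "i < m" for i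
    unfolding s_def using that by (intro real_le_rsqrt) (auto intro!: member_le_sum[of i "{..<m}" "\<lambda>j. (z j)\<^sup>2"])
  have "s z = (\<Sum>i<m. z i * g z i)"
    using zg by (simp add: s_def power2_eq_square)
  also have "\<dots> \<le> (\<Sum>i<m. \<bar>z i\<bar> * F i)" by (rule g_le)
  also have "\<dots> \<le> (\<Sum>i<m. sqrt (s z) * F i)"
    using le F by (intro sum_mono mult_right_mono) auto
  finally have "sqrt (s z) * sqrt (s z) \<le> sqrt (s z) * (\<Sum>i<m. F i)"
    using s0[of z] by (simp add: sum_distrib_left)
  then have "sqrt (s z) \<le> (\<Sum>i<m. F i)"
    using F0 s0[of z] by (cases "s z = 0") (auto simp: mult_le_cancel_left simp del: real_sqrt_mult_self)
  then have "s z \<le> C"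
    using power_mono[of "sqrt (s z)" _ 2] s0[of z] by (force simp: C_def)
  then have "z (m + i) = q z i" if "i < n" for i
    using z[of "m + i"] that C by (simp add: P_def max_def)
  then show ?thesis using zg by blast
qed

section \<open>Orthonormal bases of finitely generated function spaces\<close>

text \<open>
  The Gram-Schmidt process, as an induction on the number of functions that span \<open>V\<close>:
  the members of \<open>V\<close> that do without the last spanning function form a subspace of
  codimension at most one, and any further member, made orthogonal to that subspace and
  normalised, completes the basis. The spanning functions themselves need not lie in
  \<open>V\<close>.
\<close>

lemma orthonormal_basis_of_function_space:
  fixes V :: "('x \<Rightarrow> 'a::real_vector) set" and a :: "('x \<Rightarrow> 'a) \<Rightarrow> ('x \<Rightarrow> 'a) \<Rightarrow> real"
    and e :: "'s \<Rightarrow> 'x \<Rightarrow> 'a"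
  assumes "finite S"
    and span: "\<And>v. v \<in> V \<Longrightarrow> \<exists>c. \<forall>x. v x = (\<Sum>s\<in>S. c s *\<^sub>R e s x)"
    and zero: "(\<lambda>x. 0) \<in> V"
    and add: "\<And>u v. u \<in> V \<Longrightarrow> v \<in> V \<Longrightarrow> (\<lambda>x. u x + v x) \<in> V"
    and scale: "\<And>c v. v \<in> V \<Longrightarrow> (\<lambda>x. c *\<^sub>R v x) \<in> V"
    and a_sym: "\<And>u v. a u v = a v u"
    and a_add: "\<And>u v w. \<lbrakk>u \<in> V; v \<in> V; w \<in> V\<rbrakk> \<Longrightarrow> a (\<lambda>x. u x + v x) w = a u w + a v w"
    and a_scale: "\<And>c u w. \<lbrakk>u \<in> V; w \<in> V\<rbrakk> \<Longrightarrow> a (\<lambda>x. c *\<^sub>R u x) w = c * a u w"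
    and a_pos: "\<And>v. v \<in> V \<Longrightarrow> v \<noteq> (\<lambda>x. 0) \<Longrightarrow> 0 < a v v"
  shows "\<exists>n b. (\<forall>i<n. b i \<in> V) \<and> (\<forall>i<n. \<forall>j<n. a (b i) (b j) = (if i = j then 1 else 0)) \<and>
      (\<forall>v\<in>V. \<exists>c. v = (\<lambda>x. \<Sum>i<(n::nat). c i *\<^sub>R b i x))"
  using assms
proof (induction S arbitrary: V)
  case empty
  have "v = (\<lambda>x. 0)" if "v \<in> V" for v
    using empty.prems(1)[OF that] by auto
  then show ?case by (intro exI[of _ 0]) auto
next
  case (insert s S)
  note span = insert.prems(1) and zero = insert.prems(2) and add = insert.prems(3)
    and scale = insert.prems(4) and a_sym = insert.prems(5) and a_add = insert.prems(6)
    and a_scale = insert.prems(7) and a_pos = insert.prems(8)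
  define V0 where "V0 = {v \<in> V. \<exists>c. \<forall>x. v x = (\<Sum>s\<in>S. c s *\<^sub>R e s x)}"
  have V0V: "V0 \<subseteq> V" by (auto simp: V0_def)
  have "\<exists>n b. (\<forall>i<n. b i \<in> V0) \<and> (\<forall>i<n. \<forall>j<n. a (b i) (b j) = (if i = j then 1 else 0)) \<and>
      (\<forall>v\<in>V0. \<exists>c. v = (\<lambda>x. \<Sum>i<(n::nat). c i *\<^sub>R b i x))"
  proof (rule insert.IH)
    show "(\<lambda>x. 0) \<in> V0"
      using zero by (auto simp: V0_def intro!: exI[of _ "\<lambda>_. 0"])
    show "(\<lambda>x. u x + v x) \<in> V0" if uv: "u \<in> V0" "v \<in> V0" for u v
    proof -
      obtain c d where "\<forall>x. u x = (\<Sum>s\<in>S. c s *\<^sub>R e s x)" "\<forall>x. v x = (\<Sum>s\<in>S. d s *\<^sub>R e s x)"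
        using uv by (auto simp: V0_def)
      then have "\<forall>x. u x + v x = (\<Sum>s\<in>S. (c s + d s) *\<^sub>R e s x)"
        by (simp add: scaleR_left_distrib sum.distrib)
      then show ?thesis using uv add[of u v] by (auto simp: V0_def intro!: exI[of _ "\<lambda>s. c s + d s"])
    qed
    show "(\<lambda>x. t *\<^sub>R v x) \<in> V0" if v: "v \<in> V0" for t v
    proof -
      obtain c where "\<forall>x. v x = (\<Sum>s\<in>S. c s *\<^sub>R e s x)" using v by (auto simp: V0_def)
      then have "\<forall>x. t *\<^sub>R v x = (\<Sum>s\<in>S. (t * c s) *\<^sub>R e s x)"
        by (simp add: scaleR_sum_right)
      then show ?thesis using v scale[of v t] by (auto simp: V0_def intro!: exI[of _ "\<lambda>s. t * c s"])
    qed
  qed (use V0V a_sym a_add a_scale a_pos in \<open>auto simp: V0_def\<close>)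
  then obtain n b where "(\<forall>i<n. b i \<in> V0) \<and> (\<forall>i<n. \<forall>j<n. a (b i) (b j) = (if i = j then 1 else 0)) \<and>
      (\<forall>v\<in>V0. \<exists>c. v = (\<lambda>x. \<Sum>i<(n::nat). c i *\<^sub>R b i x))"
    by (elim exE) (rule that)
  then have b: "\<And>i. i < n \<Longrightarrow> b i \<in> V0"
    and orth: "\<And>i j. i < n \<Longrightarrow> j < n \<Longrightarrow> a (b i) (b j) = (if i = j then 1 else 0)"
    and basis: "\<And>v. v \<in> V0 \<Longrightarrow> \<exists>c. v = (\<lambda>x. \<Sum>i<n. c i *\<^sub>R b i x)"
    by auto
  show ?case
  proof (cases "V \<subseteq> V0")
    case True
    then show ?thesis using b orth basis V0V by blast
  next
    case False
    then obtain v1 where v1: "v1 \<in> V" "v1 \<notin> V0" by blast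
    have comb: "(\<lambda>x. \<Sum>i<k. c i *\<^sub>R b i x) \<in> V \<and>
        (\<forall>w\<in>V. a (\<lambda>x. \<Sum>i<k. c i *\<^sub>R b i x) w = (\<Sum>i<k. c i * a (b i) w))" if "k \<le> n" for k c
      using that
    proof (induction k)
      case 0
      have "a (\<lambda>x. 0) w = 0" if "w \<in> V" for w
        using a_scale[OF zero that, of 0] by simp
      then show ?case using zero by simp
    next
      case (Suc k)
      then have "b k \<in> V" using b V0V by auto
      then show ?case using Suc add scale a_add a_scale by simp
    qed
    have V0_comb: "(\<lambda>x. \<Sum>i<n. c i *\<^sub>R b i x) \<in> V0" for c
    proof -
      have "\<forall>i<n. \<exists>d. \<forall>x. b i x = (\<Sum>s\<in>S. d s *\<^sub>R e s x)"
        using b by (auto simp: V0_def)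
      then obtain d where d: "\<And>i x. i < n \<Longrightarrow> b i x = (\<Sum>s\<in>S. d i s *\<^sub>R e s x)" by metis
      have "(\<Sum>i<n. c i *\<^sub>R b i x) = (\<Sum>s\<in>S. (\<Sum>i<n. c i * d i s) *\<^sub>R e s x)" for x
      proof -
        have "(\<Sum>i<n. c i *\<^sub>R b i x) = (\<Sum>i<n. \<Sum>s\<in>S. (c i * d i s) *\<^sub>R e s x)"
          by (intro sum.cong) (auto simp: d scaleR_sum_right)
        also have "\<dots> = (\<Sum>s\<in>S. \<Sum>i<n. (c i * d i s) *\<^sub>R e s x)" by (rule sum.swap)
        finally show ?thesis by (simp add: scaleR_sum_left)
      qed
      then show ?thesis using comb[of n c] by (auto simp: V0_def intro!: exI)
    qed
    define p where "p = (\<lambda>x. \<Sum>i<n. a v1 (b i) *\<^sub>R b i x)"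
      \<comment> \<open>The component of \<open>v1\<close> orthogonal to the subspace.\<close>
  define w where "w = (\<lambda>x. v1 x + (-1) *\<^sub>R p x)"
    have p: "p \<in> V0" "p \<in> V" "\<And>u. u \<in> V \<Longrightarrow> a p u = (\<Sum>i<n. a v1 (b i) * a (b i) u)"
      using V0_comb[of "\<lambda>i. a v1 (b i)"] comb[of n "\<lambda>i. a v1 (b i)"] by (auto simp: p_def)
    have wV: "w \<in> V" unfolding w_def by (intro add scale v1 p)
    have aw: "a w u = a v1 u - a p u" if "u \<in> V" for u
      using a_add[OF v1(1) scale[OF p(2)] that, of "-1"] a_scale[OF p(2) that, of "-1"]
      by (simp add: w_def)
    have wb: "a w (b j) = 0" if "j < n" for j
    proof -
      have "a p (b j) = (\<Sum>i<n. a v1 (b i) * (if i = j then 1 else 0))"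
        using p(3)[of "b j"] b[OF that] V0V orth that by (auto intro!: sum.cong)
      then show ?thesis using aw[of "b j"] b[OF that] V0V that by (auto simp: if_distrib cong: if_cong)
    qed
    have "w \<noteq> (\<lambda>x. 0)"
    proof
      assume "w = (\<lambda>x. 0)"
      then have "w x = 0" for x by (rule fun_cong)
      then have "v1 x = p x" for x by (simp add: w_def)
      then have "v1 = p" by blast
      then show False using v1 p by simp
    qed
    then have ww: "0 < a w w" using a_pos wV by blast
    define b' where "b' = b(n := \<lambda>x. (1 / sqrt (a w w)) *\<^sub>R w x)"
    have b'V: "b' i \<in> V" if "i < Suc n" for i
      using that b V0V wV scale by (auto simp: b'_def)
    have a_n: "a (b' n) u = a w u / sqrt (a w w)" if "u \<in> V" for u
      using a_scale[OF wV that] by (simp add: b'_def)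
    have orth': "a (b' i) (b' j) = (if i = j then 1 else 0)" if "i < Suc n" "j < Suc n" for i j
    proof -
      have nb: "a (b' n) (b j) = 0" if "j < n" for j
        using a_n[of "b j"] b[OF that] V0V wb[OF that] by auto
      have "a (b' n) (b' n) = a w (b' n) / sqrt (a w w)" using a_n b'V by simp
      also have "a w (b' n) = a w w / sqrt (a w w)" using a_n[OF wV] a_sym by simp
      finally have "a (b' n) (b' n) = 1" using ww by simp
      then show ?thesis
        using that nb[of i] nb[of j] orth[of i j] a_sym[of "b i" "b' n"]
        by (cases "i = n"; cases "j = n") (auto simp: b'_def)
    qed
    have "\<exists>c. v = (\<lambda>x. \<Sum>i<Suc n. c i *\<^sub>R b' i x)" if v: "v \<in> V" for v
    proof -
      obtain c c1 where c: "\<And>x. v x = (\<Sum>s\<in>insert s S. c s *\<^sub>R e s x)"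
        and c1: "\<And>x. v1 x = (\<Sum>s\<in>insert s S. c1 s *\<^sub>R e s x)"
        using span v v1(1) by metis
      have "c1 s \<noteq> 0"
      proof
        assume "c1 s = 0"
        then have "\<forall>x. v1 x = (\<Sum>s\<in>S. c1 s *\<^sub>R e s x)" using c1 insert.hyps by simp
        then show False using v1 by (auto simp: V0_def)
      qed
      define r where "r = c s / c1 s"
      have "v x + (- r) *\<^sub>R v1 x = (\<Sum>s\<in>S. (c s - r * c1 s) *\<^sub>R e s x)" for x
        using \<open>c1 s \<noteq> 0\<close> insert.hyps
        by (simp add: c c1 r_def scaleR_sum_right algebra_simps sum_subtractf sum_negf)
      then have "(\<lambda>x. v x + (- r) *\<^sub>R v1 x) \<in> V0"
        using add[OF v scale[OF v1(1), of "- r"]] by (auto simp: V0_def intro!: exI)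
      then obtain d where "(\<lambda>x. v x + (- r) *\<^sub>R v1 x) = (\<lambda>x. \<Sum>i<n. d i *\<^sub>R b i x)"
        using basis by blast
      then have d: "v x = r *\<^sub>R v1 x + (\<Sum>i<n. d i *\<^sub>R b i x)" for x
        using fun_cong[of "\<lambda>x. v x + (- r) *\<^sub>R v1 x" _ x] by (simp add: algebra_simps)
      define c' where "c' i = (if i < n then d i + r * a v1 (b i) else r * sqrt (a w w))" for i
      have "v x = (\<Sum>i<Suc n. c' i *\<^sub>R b' i x)" for x
      proof -
        have "(\<Sum>i<n. c' i *\<^sub>R b' i x) = (\<Sum>i<n. d i *\<^sub>R b i x) + r *\<^sub>R p x"
          by (simp add: c'_def b'_def p_def scaleR_sum_right algebra_simps sum.distrib)
        moreover have "c' n *\<^sub>R b' n x = r *\<^sub>R (v1 x - p x)"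
          using ww by (simp add: c'_def b'_def w_def)
        ultimately show ?thesis by (simp add: d algebra_simps)
      qed
      then show ?thesis by blast
    qed
    then show ?thesis using b'V orth' by (intro exI[of _ "Suc n"] exI[of _ b']) blast
  qed
qed

section \<open>Smooth functions with compact support\<close>

lemma partial_deriv_eqI: "(f has_derivative f') (at x) \<Longrightarrow> partial_deriv i f x = f' (axis i 1)"
  unfolding partial_deriv_def by (metis frechet_derivative_at)

lemma smoothD:
  assumes "smooth f"
  shows "f differentiable (at x)" "smooth (partial_deriv i f)"
  using assms by (auto elim: smooth.cases)

lemma smooth_has_derivative: "smooth f \<Longrightarrow> (f has_derivative frechet_derivative f (at x)) (at x)"
  using smoothD(1) frechet_derivative_works by blast

lemma smooth_continuous: "smooth f \<Longrightarrow> continuous_on A f"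
  by (meson continuous_at_imp_continuous_on differentiable_imp_continuous_within smoothD(1))

lemma partial_deriv_bounded_linear:
  assumes "bounded_linear L" "f differentiable (at x)"
  shows "partial_deriv i (\<lambda>x. L (f x)) x = L (partial_deriv i f x)"
  using bounded_linear.has_derivative[OF assms(1)] assms(2) unfolding frechet_derivative_works
  by (subst partial_deriv_eqI) (auto simp: partial_deriv_def)

lemma partial_deriv_add:
  assumes "f differentiable (at x)" "g differentiable (at x)"
  shows "partial_deriv i (\<lambda>x. f x + g x) x = partial_deriv i f x + partial_deriv i g x"
  using has_derivative_add[OF assms[unfolded frechet_derivative_works]]
  by (subst partial_deriv_eqI) (auto simp: partial_deriv_def)

text \<open>
  By coinduction: the functions of the form \<open>L \<circ> f\<close> with \<open>f\<close>
  smooth are closed under partial derivatives.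
\<close>

lemma smooth_bounded_linear:
  assumes L: "bounded_linear L" and "smooth f"
  shows "smooth (\<lambda>x. L (f x))"
proof (rule smooth.coinduct[of "\<lambda>g. \<exists>f. smooth f \<and> g = (\<lambda>x. L (f x))"])
  show "\<exists>f'. smooth f' \<and> (\<lambda>x. L (f x)) = (\<lambda>x. L (f' x))" using assms by blast
next
  fix g assume "\<exists>f. smooth f \<and> g = (\<lambda>x. L (f x))"
  then obtain f where f: "smooth f" "g = (\<lambda>x. L (f x))" by blast
  have "partial_deriv i g = (\<lambda>x. L (partial_deriv i f x))" for i
    using partial_deriv_bounded_linear[OF L] smoothD(1)[OF f(1)] f(2) by auto
  moreover have "g differentiable (at x)" for x
    using bounded_linear.has_derivative[OF L smooth_has_derivative[OF f(1)]] f(2)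
    by (auto simp: differentiable_def)
  ultimately show "\<exists>f. g = f \<and> (\<forall>x. f differentiable (at x)) \<and>
      (\<forall>i. (\<exists>fa. smooth fa \<and> partial_deriv i f = (\<lambda>x. L (fa x))) \<or> smooth (partial_deriv i f))"
    using smoothD(2)[OF f(1)] by blast
qed

lemma smooth_add:
  assumes "smooth f" "smooth g"
  shows "smooth (\<lambda>x. f x + g x)"
proof (rule smooth.coinduct[of "\<lambda>h. \<exists>f g. smooth f \<and> smooth g \<and> h = (\<lambda>x. f x + g x)"])
  show "\<exists>f' g'. smooth f' \<and> smooth g' \<and> (\<lambda>x. f x + g x) = (\<lambda>x. f' x + g' x)" using assms by blast
next
  fix h :: "real^2 \<Rightarrow> 'a" assume "\<exists>f g. smooth f \<and> smooth g \<and> h = (\<lambda>x. f x + g x)"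
  then obtain f g where fg: "smooth f" "smooth g" "h = (\<lambda>x. f x + g x)" by blast
  have "partial_deriv i h = (\<lambda>x. partial_deriv i f x + partial_deriv i g x)" for i
    unfolding fg(3) by (rule ext) (rule partial_deriv_add[OF smoothD(1)[OF fg(1)] smoothD(1)[OF fg(2)]])
  moreover have "h differentiable (at x)" for x
    using fg smoothD(1) by (auto intro!: differentiable_add)
  ultimately show "\<exists>f. h = f \<and> (\<forall>x. f differentiable (at x)) \<and>
      (\<forall>i. (\<exists>fa g. smooth fa \<and> smooth g \<and> partial_deriv i f = (\<lambda>x. fa x + g x)) \<or> smooth (partial_deriv i f))"
    using smoothD(2)[OF fg(1)] smoothD(2)[OF fg(2)] by blast
qed

text \<open>
  The derivatives of $e^{-1/t}$, extended by 0 to the left half line, are combinations of these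
  functions. The exponent \<open>k\<close> makes the family closed under differentiation.
\<close>

definition flat_exp :: "nat \<Rightarrow> real \<Rightarrow> real" where
  "flat_exp k t = (if t > 0 then exp (- 1 / t) / t ^ k else 0)"

text \<open>
  With $s = 1/t$ this is the decay of $s^k e^{-s}$ as $s$ tends to infinity.
\<close>

lemma flat_exp_tendsto_0: "(flat_exp k \<longlongrightarrow> 0) (at 0)"
proof -
  have "((\<lambda>t. inverse t ^ k / exp (inverse t)) \<longlongrightarrow> (0::real)) (at_right 0)"
    by (rule filterlim_compose[OF tendsto_power_div_exp_0 filterlim_inverse_at_top_right])
  then have "(flat_exp k \<longlongrightarrow> 0) (at_right 0)"
    by (rule Lim_transform_eventually)
      (auto simp: eventually_at_right_less flat_exp_def exp_minus field_simps intro!: eventually_at_rightI[of 0 1])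
  moreover have "(flat_exp k \<longlongrightarrow> 0) (at_left 0)"
    by (rule Lim_transform_eventually[OF tendsto_const])
      (auto simp: flat_exp_def intro!: eventually_at_leftI[of "-1" 0])
  ultimately show ?thesis by (simp add: filterlim_at_split)
qed

text \<open>
  The difference quotient of \<open>flat_exp k\<close> at 0 is \<open>flat_exp (k + 1)\<close>,
  which tends to 0.
\<close>

lemma DERIV_flat_exp: "DERIV (flat_exp k) t :> flat_exp (k + 2) t - real k * flat_exp (k + 1) t"
proof -
  consider "t > 0" | "t < 0" | "t = 0" by linarith
  then show ?thesis
  proof cases
    case 1
    have "DERIV (\<lambda>t. exp (- inverse t) * inverse t ^ k) t :>
        exp (- inverse t) * (inverse t * inverse t) * inverse t ^ k
        + real k * inverse t ^ (k - 1) * (- (inverse t * inverse t)) * exp (- inverse t)"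
      using 1 by (auto intro!: derivative_eq_intros)
    moreover have "exp (- inverse t) * (inverse t * inverse t) * inverse t ^ k
        + real k * inverse t ^ (k - 1) * (- (inverse t * inverse t)) * exp (- inverse t)
        = flat_exp (k + 2) t - real k * flat_exp (k + 1) t"
      using 1 by (cases k) (simp_all add: flat_exp_def divide_inverse power_inverse)
    ultimately have "DERIV (\<lambda>t. exp (- inverse t) * inverse t ^ k) t :> flat_exp (k + 2) t - real k * flat_exp (k + 1) t"
      by simp
    then show ?thesis
      by (rule DERIV_cong_ev[THEN iffD1, rotated -1])
        (use 1 in \<open>auto simp: flat_exp_def eventually_nhds divide_inverse power_inverse intro!: exI[of _ "{0<..}"]\<close>)
  next
    case 2
    have "DERIV (\<lambda>t. 0) t :> (0::real)" by simp
    then have "DERIV (flat_exp k) t :> 0"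
      by (rule DERIV_cong_ev[THEN iffD1, rotated -1])
        (use 2 in \<open>auto simp: flat_exp_def eventually_nhds intro!: exI[of _ "{..<0}"]\<close>)
    then show ?thesis using 2 by (simp add: flat_exp_def)
  next
    case 3
    have "(\<lambda>h. (flat_exp k (0 + h) - flat_exp k 0) / h) = flat_exp (k + 1)"
      by (auto simp: flat_exp_def fun_eq_iff)
    then have "DERIV (flat_exp k) 0 :> 0"
      using flat_exp_tendsto_0[of "k + 1"] by (simp add: DERIV_def)
    then show ?thesis using 3 by (simp add: flat_exp_def)
  qed
qed

text \<open>
  A class of functions that is visibly closed under partial derivatives and rich enough to contain
  the bump functions needed below.
\<close>

inductive elementary :: "(real^2 \<Rightarrow> real) \<Rightarrow> bool" where
  const: "elementary (\<lambda>x. c)"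
| coord: "elementary (\<lambda>x. x $ i)"
| add: "elementary f \<Longrightarrow> elementary g \<Longrightarrow> elementary (\<lambda>x. f x + g x)"
| mult: "elementary f \<Longrightarrow> elementary g \<Longrightarrow> elementary (\<lambda>x. f x * g x)"
| flat_exp: "elementary f \<Longrightarrow> elementary (\<lambda>x. flat_exp k (f x))"

lemma elementary_partial_derivs:
  assumes "elementary f"
  shows "(\<forall>x. f differentiable (at x)) \<and> (\<forall>i. elementary (partial_deriv i f))"
  using assms
proof induction
  case (const c)
  have "partial_deriv i (\<lambda>x. c) = (\<lambda>x. 0)" for i
    by (rule ext) (subst partial_deriv_eqI, auto)
  then show ?case by (auto intro: elementary.intros)
next
  case (coord j)
  have d: "((\<lambda>x. x $ j) has_derivative (\<lambda>h. h $ j)) (at x)" for x :: "real^2"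
    by (rule bounded_linear.has_derivative[OF bounded_linear_vec_nth has_derivative_ident])
  have "partial_deriv i (\<lambda>x. x $ j) = (\<lambda>x. axis i 1 $ j)" for i
    by (rule ext) (subst partial_deriv_eqI[OF d], auto)
  then show ?case using d by (auto intro: elementary.intros simp: differentiable_def)
next
  case (add f g)
  then have "partial_deriv i (\<lambda>x. f x + g x) = (\<lambda>x. partial_deriv i f x + partial_deriv i g x)" for i
    by (intro ext partial_deriv_add) auto
  then show ?case using add by (auto intro: elementary.intros)
next
  case (mult f g)
  have "partial_deriv i (\<lambda>x. f x * g x) = (\<lambda>x. f x * partial_deriv i g x + partial_deriv i f x * g x)" for i
    using mult.IH unfolding frechet_derivative_works
    by (intro ext) (subst partial_deriv_eqI[OF has_derivative_mult], auto simp: partial_deriv_def)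
  then show ?case using mult by (auto intro!: elementary.intros)
next
  case (flat_exp f k)
  have d: "((\<lambda>x. flat_exp k (f x)) has_derivative
      (\<lambda>h. frechet_derivative f (at x) h * (flat_exp (k + 2) (f x) + (- real k) * flat_exp (k + 1) (f x)))) (at x)" for x
    using DERIV_compose_FDERIV[OF DERIV_flat_exp flat_exp.IH[THEN conjunct1, rule_format, of x,
      unfolded frechet_derivative_works]] by simp
  have "partial_deriv i (\<lambda>x. flat_exp k (f x)) =
      (\<lambda>x. partial_deriv i f x * (flat_exp (k + 2) (f x) + (- real k) * flat_exp (k + 1) (f x)))" for i
    by (rule ext) (subst partial_deriv_eqI[OF d], simp add: partial_deriv_def)
  moreover have "elementary (\<lambda>x. partial_deriv i f x *
      (flat_exp (k + 2) (f x) + (- real k) * flat_exp (k + 1) (f x)))" for i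
    by (intro elementary.intros flat_exp.hyps flat_exp.IH[THEN conjunct2, rule_format])
  ultimately show ?case using d by (auto simp: differentiable_def)
qed

text \<open>
  Closure of a class of differentiable functions under partial derivatives is exactly what
  coinduction asks for.
\<close>

lemma elementary_smooth: "elementary f \<Longrightarrow> smooth f"
  by (erule smooth.coinduct) (use elementary_partial_derivs in blast)

lemma smooth_const: "smooth (\<lambda>x. c)"
  using smooth_bounded_linear[OF bounded_linear_scaleR_left elementary_smooth[OF elementary.const[of 1]]] by simp

lemma elementary_sum: "(\<And>k. elementary (f k)) \<Longrightarrow> elementary (\<lambda>x. \<Sum>k<(n::nat). f k x)"
  by (induction n) (auto intro: elementary.intros)

lemma flat_exp_at_top: "(flat_exp 0 \<longlongrightarrow> 1) at_top"
proof -
  have "((\<lambda>t::real. exp (- 1 / t)) \<longlongrightarrow> exp 0) at_top"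
    by (intro tendsto_intros real_tendsto_divide_at_top[OF tendsto_const]) (rule filterlim_ident)
  then show ?thesis
    by (simp, elim Lim_transform_eventually)
      (use eventually_gt_at_top[of 0] in \<open>eventually_elim, simp add: flat_exp_def\<close>)
qed

text \<open>
  By Lindelof's theorem \<open>U\<close> is a union of countably many balls. Every ball is the set
  where a nonnegative elementary function is positive; with \<open>\<sigma>\<close> the sum of the
  first \<open>n\<close> of these functions, \<open>flat_exp 0 (n * \<sigma>)\<close> vanishes off
  \<open>U\<close> and tends to 1 at every point of \<open>U\<close> because its argument tends to
  infinity there.
\<close>

lemma indicator_of_open_set_limit_of_test_functions:
  assumes "open U" "compact (closure U)" "closure U \<subseteq> \<Omega>"
  obtains \<phi> :: "nat \<Rightarrow> real^2 \<Rightarrow> real"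
  where "\<And>n. \<phi> n \<in> test_functions \<Omega>" "\<And>n x. \<bar>\<phi> n x\<bar> \<le> indicator U x"
    "\<And>x. (\<lambda>n. \<phi> n x) \<longlonglongrightarrow> indicator U x"
proof -
  define \<B> where "\<B> = {ball c r | c r. r > 0 \<and> ball c r \<subseteq> U}"
  have "x \<in> \<Union>\<B>" if "x \<in> U" for x
  proof -
    obtain r where r: "r > 0" "ball x r \<subseteq> U"
      using openE[OF \<open>open U\<close> \<open>x \<in> U\<close>] by blast
    then have "ball x r \<in> \<B>" unfolding \<B>_def by blast
    then show ?thesis using r(1) by (meson UnionI centre_in_ball)
  qed
  moreover have "\<Union>\<B> \<subseteq> U" unfolding \<B>_def by blast
  ultimately have "\<Union>\<B> = U" by blast
  moreover obtain \<B>' where \<B>': "\<B>' \<subseteq> \<B>" "countable \<B>'" "\<Union>\<B>' = \<Union>\<B>"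
    using Lindelof[of \<B>] by (auto simp: \<B>_def)
  ultimately have U: "U = \<Union>\<B>'" by simp
  have "\<exists>c r. (\<forall>k::nat. ball (c k) (r k) \<subseteq> U) \<and> (\<forall>x\<in>U. \<exists>k. x \<in> ball (c k) (r k))"
  proof (cases "\<B>' = {}")
    case True
    then show ?thesis using U by (intro exI[of _ "\<lambda>_. 0"]) auto
  next
    case False
    have "\<forall>k. \<exists>c r. from_nat_into \<B>' k = ball c r \<and> ball c r \<subseteq> U"
    proof
      fix k
      have "from_nat_into \<B>' k \<in> \<B>" using from_nat_into[OF False] \<B>'(1) by blast
      then show "\<exists>c r. from_nat_into \<B>' k = ball c r \<and> ball c r \<subseteq> U"
        unfolding \<B>_def by blast
    qed
    then obtain c r where cr: "\<And>k. from_nat_into \<B>' k = ball (c k) (r k)" "\<And>k. ball (c k) (r k) \<subseteq> U"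
      by metis
    have "U = (\<Union>k. ball (c k) (r k))"
      using range_from_nat_into[OF False \<B>'(2)] cr(1) U by auto
    then show ?thesis using cr(2) by (intro exI[of _ c] exI[of _ r]) auto
  qed
  then obtain c r where "(\<forall>k::nat. ball (c k) (r k) \<subseteq> U) \<and> (\<forall>x\<in>U. \<exists>k. x \<in> ball (c k) (r k))"
    by (elim exE) (rule that)
  then have cr: "\<And>k. ball (c k) (r k) \<subseteq> U" "\<And>x. x \<in> U \<Longrightarrow> \<exists>k. x \<in> ball (c k) (r k)"
    by blast+
  define \<beta> where "\<beta> k x = (if r k > 0 then flat_exp 0 ((r k)\<^sup>2 - (dist (c k) x)\<^sup>2) else 0)" for k x
  define \<phi> where "\<phi> n x = flat_exp 0 (real n * (\<Sum>k<n. \<beta> k x))" for n x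
  have \<beta>_pos: "\<beta> k x > 0 \<longleftrightarrow> x \<in> ball (c k) (r k)" for k x
  proof (cases "r k > 0")
    case True
    then have "(dist (c k) x)\<^sup>2 < (r k)\<^sup>2 \<longleftrightarrow> dist (c k) x < r k"
      by (auto intro: power_strict_mono dest: power2_less_imp_less)
    then show ?thesis using True by (auto simp: \<beta>_def flat_exp_def)
  qed (auto simp: \<beta>_def dest: le_less_trans[OF zero_le_dist])
  have \<beta>_nonneg: "0 \<le> \<beta> k x" for k x by (auto simp: \<beta>_def flat_exp_def)
  have "elementary (\<beta> k)" for k
  proof -
    have "(dist (c k) x)\<^sup>2 = (\<Sum>i\<in>UNIV. (x $ i + - c k $ i) * (x $ i + - c k $ i))" for x
    proof -
      have "(dist (c k) x)\<^sup>2 = (\<Sum>i\<in>UNIV. (dist (c k $ i) (x $ i))\<^sup>2)"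
        by (simp add: dist_vec_def L2_set_def sum_nonneg)
      then show ?thesis by (simp add: dist_real_def power2_eq_square algebra_simps)
    qed
    then have "\<beta> k = (if r k > 0 then (\<lambda>x. flat_exp 0 ((r k)\<^sup>2 + (-1) *
        ((x $ 1 + - c k $ 1) * (x $ 1 + - c k $ 1) + (x $ 2 + - c k $ 2) * (x $ 2 + - c k $ 2)))) else (\<lambda>x. 0))"
      by (auto simp: \<beta>_def fun_eq_iff sum_2 intro!: arg_cong[of _ _ "flat_exp 0"])
    then show ?thesis
      by (cases "0 < r k") (simp_all only: if_True if_False, (intro elementary.intros)+)
  qed
  then have "elementary (\<phi> n)" for n
    unfolding \<phi>_def by (intro elementary.intros elementary_sum)
  moreover have out: "\<phi> n x = 0" if "x \<notin> U" for n x
  proof -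
    have "\<beta> k x = 0" for k
    proof -
      have "x \<notin> ball (c k) (r k)" using cr(1) that by blast
      then show ?thesis using \<beta>_pos[of k x] \<beta>_nonneg[of k x] by linarith
    qed
    then show ?thesis by (simp add: \<phi>_def flat_exp_def)
  qed
  moreover have sub: "{x. \<phi> n x \<noteq> 0} \<subseteq> U" for n
    using out by auto
  moreover have "bounded U" using assms(2) by (simp add: compact_closure)
  ultimately have 1: "\<phi> n \<in> test_functions \<Omega>" for n
    using closure_mono[OF sub[of n]] bounded_subset[OF \<open>bounded U\<close> sub[of n]] assms(3) elementary_smooth
    by (simp add: test_functions_def compact_closure)
  have "0 \<le> flat_exp 0 t" "flat_exp 0 t \<le> 1" for t by (auto simp: flat_exp_def)
  then have 2: "\<bar>\<phi> n x\<bar> \<le> indicator U x" for n x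
    using out by (cases "x \<in> U") (auto simp: \<phi>_def)
  have 3: "(\<lambda>n. \<phi> n x) \<longlonglongrightarrow> indicator U x" for x
  proof (cases "x \<in> U")
    case True
    then obtain k where k: "\<beta> k x > 0" using cr(2) \<beta>_pos by blast
    have "filterlim (\<lambda>n. real n * \<beta> k x) at_top sequentially"
      by (rule filterlim_at_top_mult_tendsto_pos[OF tendsto_const k filterlim_real_sequentially])
    then have "filterlim (\<lambda>n. real n * (\<Sum>k<n. \<beta> k x)) at_top sequentially"
    proof (rule filterlim_at_top_mono)
      show "\<forall>\<^sub>F n in sequentially. real n * \<beta> k x \<le> real n * (\<Sum>k<n. \<beta> k x)"
        using eventually_gt_at_top[of k]
      proof eventually_elim
        case (elim n)
        then show ?case
          using \<beta>_nonneg by (intro mult_left_mono member_le_sum) auto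
      qed
    qed
    then have "(\<lambda>n. \<phi> n x) \<longlonglongrightarrow> 1"
      unfolding \<phi>_def by (rule filterlim_compose[OF flat_exp_at_top])
    then show ?thesis using True by simp
  qed (simp add: out)
  show ?thesis by (rule that[OF 1 2 3])
qed

section \<open>The fundamental lemma of the calculus of variations\<close>

lemma sigma_finite_lebesgue: "sigma_finite_measure (lebesgue :: 'a::euclidean_space measure)"
proof
  obtain A :: "'a set set" where "countable A" "A \<subseteq> sets lborel" "\<Union>A = space lborel"
    "\<forall>a\<in>A. emeasure lborel a \<noteq> \<infinity>"
    using lborel.sigma_finite_countable by blast
  then show "\<exists>A::'a set set. countable A \<and> A \<subseteq> sets lebesgue \<and> \<Union>A = space lebesgue \<and>
      (\<forall>a\<in>A. emeasure lebesgue a \<noteq> \<infinity>)"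
    by (intro exI[of _ A]) auto
qed

text \<open>
  The open sets form an intersection-stable generator of the Borel sets, so the integrals over all
  Borel sets vanish, and Lebesgue measurable sets differ from Borel sets by null sets.
\<close>

lemma AE_zero_of_open_set_integrals:
  fixes f :: "'a::euclidean_space \<Rightarrow> 'b::{banach, second_countable_topology}"
  assumes f: "integrable lebesgue f"
    and open0: "\<And>U. open U \<Longrightarrow> (LINT x:U|lebesgue. f x) = 0"
  shows "AE x in lebesgue. f x = 0"
proof (rule sigma_finite_measure.density_zero[OF sigma_finite_lebesgue f])
  have int: "set_integrable lebesgue A f" if "A \<in> sets lebesgue" for A
    using integrable_mult_indicator[OF that f] by (simp add: set_integrable_def)
  have sigma: "A \<in> sets lebesgue" if "A \<in> sigma_sets UNIV {S. open S}" for A :: "'a set"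
  proof -
    have "A \<in> sets borel" using that by (simp add: borel_def)
    then show ?thesis by simp
  qed
  have borel0: "(LINT x:A|lebesgue. f x) = 0" if "A \<in> sets borel" for A
  proof -
    have "Int_stable {S::'a set. open S}" "{S::'a set. open S} \<subseteq> Pow UNIV"
      by (auto simp: Int_stable_def)
    moreover have "A \<in> sigma_sets UNIV {S. open S}" using that by (simp add: borel_def)
    ultimately show ?thesis
    proof (induction rule: sigma_sets_induct_disjoint)
      case (basic A)
      then show ?case using open0 by simp
    next
      case empty
      show ?case by (simp add: set_lebesgue_integral_def)
    next
      case (compl A)
      have A: "A \<in> sets lebesgue" using compl(1) by (rule sigma)
      have "UNIV - A \<in> sets lebesgue" using A by (metis Compl_eq_Diff_UNIV Compl_in_sets_lebesgue)
      then have "(LINT x:UNIV|lebesgue. f x) = (LINT x:A|lebesgue. f x) + (LINT x:UNIV - A|lebesgue. f x)"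
        using set_integral_Un[of A "UNIV - A" lebesgue f] A int by simp
      then show ?case using compl(2) open0[of UNIV] by simp
    next
      case (union A)
      have A: "A i \<in> sets lebesgue" for i
        using union(2) by (auto intro!: sigma)
      have "(LINT x:(\<Union>i. A i)|lebesgue. f x) = (\<Sum>i. (LINT x:(A i)|lebesgue. f x))"
        using A union(1) int by (intro lebesgue_integral_countable_add) (auto simp: disjoint_family_on_def)
      then show ?case using union(3) by simp
    qed
  qed
  fix A :: "'a set" assume A: "A \<in> sets lebesgue"
  then obtain B N where B: "B \<in> sets borel" "negligible N" "B \<union> N = A"
    by (rule sets_lebesgue_almost_borel)
  have "AE x in lebesgue. x \<notin> N" using B(2) by (simp add: negligible_iff_null_sets AE_not_in)
  then have "AE x in lebesgue. x \<in> A \<longleftrightarrow> x \<in> B" by eventually_elim (use B(3) in auto)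
  moreover have "set_borel_measurable lebesgue A f" "set_borel_measurable lebesgue B f"
    using int[OF A] int[of B] B(1) by (auto simp: set_integrable_def set_borel_measurable_def)
  ultimately show "(LINT x:A|lebesgue. f x) = 0"
    using borel0[OF B(1)] set_integral_cong_set[of lebesgue A f B] by simp
qed

text \<open>
  The fundamental lemma of the calculus of variations. Only relatively compact open pieces of
  \<open>\<Omega>\<close> are considered at a time: there \<open>g\<close> is integrable and
  dominates the products with test functions approximating an indicator.
\<close>

lemma AE_zero_of_test_functions:
  fixes g :: "real^2 \<Rightarrow> 'b::euclidean_space"
  assumes \<Omega>: "open \<Omega>" and g: "locally_integrable \<Omega> g"
    and test: "\<And>\<phi> :: real^2 \<Rightarrow> real. \<phi> \<in> test_functions \<Omega> \<Longrightarrow> (LINT x:\<Omega>|lebesgue. \<phi> x *\<^sub>R g x) = 0"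
  shows "AE x\<in>\<Omega> in lebesgue. g x = 0"
proof -
  obtain C where C: "\<And>n. compact (C n)" "\<And>n. C n \<subseteq> \<Omega>" "\<And>n. C n \<subseteq> interior (C (Suc n))"
      "\<Union>(range C) = \<Omega>"
    using open_Union_compact_subsets[OF \<Omega>] by metis
  have "AE x in lebesgue. indicator (interior (C n)) x *\<^sub>R g x = 0" for n
  proof (rule AE_zero_of_open_set_integrals)
    have int: "integrable lebesgue (\<lambda>x. indicator (C n) x *\<^sub>R g x)"
      using g C unfolding locally_integrable_def set_integrable_def by blast
    have sub: "set_integrable lebesgue W g" if "open W" "W \<subseteq> C n" for W
      by (rule set_integrable_subset[of _ "C n"]) (use int that in \<open>auto simp: set_integrable_def\<close>)
    show "integrable lebesgue (\<lambda>x. indicator (interior (C n)) x *\<^sub>R g x)"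
      using sub[OF open_interior interior_subset] by (simp add: set_integrable_def)
    fix U :: "(real^2) set" assume "open U"
    define W where "W = U \<inter> interior (C n)"
    have W: "open W" "W \<subseteq> C n" using \<open>open U\<close> interior_subset by (auto simp: W_def)
    have clW: "closure W \<subseteq> C n" by (simp add: W closure_minimal C compact_imp_closed)
    then obtain \<phi> :: "nat \<Rightarrow> real^2 \<Rightarrow> real" where \<phi>: "\<And>k. \<phi> k \<in> test_functions \<Omega>"
      "\<And>k x. \<bar>\<phi> k x\<bar> \<le> indicator W x" "\<And>x. (\<lambda>k. \<phi> k x) \<longlonglongrightarrow> indicator W x"
      using indicator_of_open_set_limit_of_test_functions[OF W(1), of \<Omega>] C(1,2)[of n]
      by (metis bounded_subset closed_closure compact_eq_bounded_closed order_trans)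
    have \<phi>_eq: "indicator \<Omega> x *\<^sub>R \<phi> k x *\<^sub>R g x = \<phi> k x *\<^sub>R indicator W x *\<^sub>R g x" for k x
      using \<phi>(2)[of k x] W(2) C(2)[of n] by (cases "x \<in> W") auto
    have "(\<lambda>k. integral\<^sup>L lebesgue (\<lambda>x. \<phi> k x *\<^sub>R indicator W x *\<^sub>R g x))
        \<longlonglongrightarrow> integral\<^sup>L lebesgue (\<lambda>x. indicator W x *\<^sub>R g x)"
    proof (rule integral_dominated_convergence)
      have gW: "integrable lebesgue (\<lambda>x. indicator W x *\<^sub>R g x)"
        using sub[OF W] by (simp add: set_integrable_def)
      then show meas: "(\<lambda>x. indicator W x *\<^sub>R g x) \<in> borel_measurable lebesgue" by simp
      show "integrable lebesgue (\<lambda>x. norm (indicator W x *\<^sub>R g x))" using gW by (rule integrable_norm)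
      have "\<phi> k \<in> borel_measurable lebesgue" for k
        using \<phi>(1)[of k] by (auto simp: test_functions_def
            intro!: measurable_completion borel_measurable_continuous_onI smooth_continuous)
      then show "(\<lambda>x. \<phi> k x *\<^sub>R indicator W x *\<^sub>R g x) \<in> borel_measurable lebesgue" for k
        using meas by measurable
      show "AE x in lebesgue. (\<lambda>k. \<phi> k x *\<^sub>R indicator W x *\<^sub>R g x) \<longlonglongrightarrow> indicator W x *\<^sub>R g x"
      proof (rule AE_I2)
        fix x
        have "(\<lambda>k. \<phi> k x *\<^sub>R indicator W x *\<^sub>R g x) \<longlonglongrightarrow> indicator W x *\<^sub>R indicator W x *\<^sub>R g x"
          by (intro tendsto_intros \<phi>)
        then show "(\<lambda>k. \<phi> k x *\<^sub>R indicator W x *\<^sub>R g x) \<longlonglongrightarrow> indicator W x *\<^sub>R g x"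
          by (cases "x \<in> W") auto
      qed
      show "AE x in lebesgue. norm (\<phi> k x *\<^sub>R indicator W x *\<^sub>R g x) \<le> norm (indicator W x *\<^sub>R g x)" for k
      proof (rule AE_I2)
        fix x
        show "norm (\<phi> k x *\<^sub>R indicator W x *\<^sub>R g x) \<le> norm (indicator W x *\<^sub>R g x)"
          using \<phi>(2)[of k x] by (cases "x \<in> W") (auto intro!: mult_left_le_one_le)
      qed
    qed
    moreover have "integral\<^sup>L lebesgue (\<lambda>x. \<phi> k x *\<^sub>R indicator W x *\<^sub>R g x) = 0" for k
      using test[OF \<phi>(1), of k] by (simp only: set_lebesgue_integral_def \<phi>_eq)
    ultimately have "integral\<^sup>L lebesgue (\<lambda>x. indicator W x *\<^sub>R g x) = 0"
      by (simp add: LIMSEQ_const_iff)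
    moreover have "indicator U x *\<^sub>R indicator (interior (C n)) x *\<^sub>R g x = indicator W x *\<^sub>R g x" for x
      by (auto simp: W_def indicator_def)
    ultimately show "(LINT x:U|lebesgue. indicator (interior (C n)) x *\<^sub>R g x) = 0"
      by (simp only: set_lebesgue_integral_def)
  qed
  then have "AE x in lebesgue. \<forall>n. indicator (interior (C n)) x *\<^sub>R g x = 0"
    unfolding AE_all_countable by blast
  then show ?thesis
  proof eventually_elim
    case (elim x)
    show ?case
    proof
      assume "x \<in> \<Omega>"
      then obtain n where "x \<in> C n" using C(4) by blast
      then have "x \<in> interior (C (Suc n))" using C(3) by blast
      then show "g x = 0" using elim[rule_format, of "Suc n"] by simp
    qed
  qed
qed


section \<open>Integration by parts and weak gradients\<close>

lemma integrable_continuous_bounded_support: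
  fixes f :: "'a::euclidean_space \<Rightarrow> 'b::{banach, second_countable_topology}"
  assumes "continuous_on UNIV f" "\<And>x. norm x > R \<Longrightarrow> f x = 0"
  shows "integrable lborel f"
proof -
  have "integrable lborel (\<lambda>x. indicator (cball 0 R) x *\<^sub>R f x)"
    using assms(1) by (intro borel_integrable_compact) (auto intro: continuous_on_subset)
  also have "(\<lambda>x. indicator (cball 0 R) x *\<^sub>R f x) = f"
    using assms(2) by (auto simp: indicator_def not_le)
  finally show ?thesis .
qed

text \<open>
  The integral of the difference quotient in direction \<open>e\<close> vanishes, since Lebesgue
  measure is invariant under translations, and the quotients converge to the derivative, dominated
  by a constant on a fixed ball.
\<close>

lemma integral_directional_derivative_zero:
  fixes g :: "'a::euclidean_space \<Rightarrow> 'b::euclidean_space"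
  assumes g: "\<And>x. (g has_derivative g' x) (at x)"
    and cont: "continuous_on UNIV (\<lambda>x. g' x e)"
    and supp: "\<And>x. norm x > R \<Longrightarrow> g x = 0"
  shows "integral\<^sup>L lebesgue (\<lambda>x. g' x e) = 0"
proof -
  have g_cont: "continuous_on UNIV g"
    using g by (auto intro!: continuous_at_imp_continuous_on has_derivative_continuous)
  \<comment> \<open>All difference quotients with step at most 1 vanish off the ball of radius \<open>R'\<close>.\<close>
  define R' where "R' = R + norm e"
  obtain M where M: "\<And>x. norm x \<le> R' + norm e \<Longrightarrow> norm (g' x e) \<le> M" "0 \<le> M"
  proof -
    have "bounded ((\<lambda>x. g' x e) ` cball 0 (R' + norm e))"
      by (intro compact_imp_bounded compact_continuous_image continuous_on_subset[OF cont]) auto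
    then obtain b where "b > 0" "\<forall>x\<in>cball 0 (R' + norm e). norm (g' x e) \<le> b"
      by (auto simp: bounded_pos)
    then show ?thesis by (intro that[of b]) auto
  qed
  define h where "h n = inverse (real (Suc n))" for n
  have h: "0 < h n" "h n \<le> 1" "h n \<noteq> 0" for n by (auto simp: h_def field_simps)
  define D where "D n x = (1 / h n) *\<^sub>R (g (h n *\<^sub>R e + x) - g x)" for n x
  have int_g: "integrable lborel g"
    using integrable_continuous_bounded_support[OF g_cont supp] by simp
  have [measurable]: "g \<in> borel_measurable borel"
    using g_cont by (rule borel_measurable_continuous_onI)
  have int_shift: "integrable lborel (\<lambda>x. g (c + x))" "integral\<^sup>L lborel (\<lambda>x. g (c + x)) = integral\<^sup>L lborel g" for c
    using int_g integrable_distr_eq[of "(+) c" lborel borel g] integral_distr[of "(+) c" lborel borel g]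
    by (simp_all add: lborel_distr_plus)
  have D0: "integral\<^sup>L lborel (D n) = 0" for n
    using int_g int_shift by (simp add: D_def[abs_def])
  have shift: "((\<lambda>t. g (t *\<^sub>R e + x)) has_derivative (\<lambda>t. g' (s *\<^sub>R e + x) (t *\<^sub>R e))) (at s)" for s x
    by (rule has_derivative_compose[OF _ g, of "\<lambda>t. t *\<^sub>R e + x"]) (auto intro!: derivative_eq_intros)
  have g'_scale: "g' x (t *\<^sub>R e) = t *\<^sub>R g' x e" for x t
    using g[of x] by (simp add: has_derivative_bounded_linear linear_simps)
  have D_lim: "(\<lambda>n. D n x) \<longlonglongrightarrow> g' x e" for x
  proof -
    have quot: "((\<lambda>t. norm (g (t *\<^sub>R e + x) - g x - t *\<^sub>R g' x e) / norm t) \<longlongrightarrow> 0) (at 0)"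
      using shift[of x 0] by (simp add: has_derivative_at g'_scale)
    have quot_eq: "norm (g (t *\<^sub>R e + x) - g x - t *\<^sub>R g' x e) / norm t
        = norm ((1 / t) *\<^sub>R (g (t *\<^sub>R e + x) - g x) - g' x e)" if "t \<noteq> 0" for t
    proof -
      have "(1 / t) *\<^sub>R (g (t *\<^sub>R e + x) - g x) - g' x e
          = (1 / t) *\<^sub>R (g (t *\<^sub>R e + x) - g x - t *\<^sub>R g' x e)"
        using that by (simp add: scaleR_diff_right)
      then show ?thesis by simp
    qed
    have "((\<lambda>t. norm ((1 / t) *\<^sub>R (g (t *\<^sub>R e + x) - g x) - g' x e)) \<longlongrightarrow> 0) (at 0)"
      by (rule Lim_transform_eventually[OF quot])
        (unfold eventually_at_filter, intro always_eventually allI impI quot_eq)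
    then have "((\<lambda>t. (1 / t) *\<^sub>R (g (t *\<^sub>R e + x) - g x)) \<longlongrightarrow> g' x e) (at 0)"
      by (rule LIM_zero_cancel[OF tendsto_norm_zero_cancel])
    moreover have "filterlim h (at 0) sequentially"
      unfolding filterlim_at h_def using LIMSEQ_inverse_real_of_nat by auto
    ultimately show ?thesis unfolding D_def by (rule filterlim_compose)
  qed
  have D_bound: "norm (D n x) \<le> M * indicator (cball 0 R') x" for n x
  proof (cases "norm x \<le> R'")
    case True
    have "continuous_on {0..h n} (\<lambda>t. g (t *\<^sub>R e + x))"
      using shift by (auto intro!: continuous_at_imp_continuous_on has_derivative_continuous)
    from mvt_general[OF h(1) this shift] obtain s where s: "0 < s" "s < h n"
      "norm (g (h n *\<^sub>R e + x) - g (0 *\<^sub>R e + x)) \<le> norm (g' (s *\<^sub>R e + x) ((h n - 0) *\<^sub>R e))" by auto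
    have "norm (s *\<^sub>R e + x) \<le> s * norm e + norm x"
      using norm_triangle_ineq[of "s *\<^sub>R e" x] s by simp
    also have "\<dots> \<le> 1 * norm e + R'"
      using s h(2)[of n] True by (intro add_mono mult_right_mono) auto
    finally have "norm (g' (s *\<^sub>R e + x) e) \<le> M" by (intro M) simp
    then have "norm (g (h n *\<^sub>R e + x) - g x) \<le> h n * M"
      using s(3) h(1)[of n] by (simp add: g'_scale) (meson mult_left_mono order_trans less_imp_le)
    moreover have "norm (D n x) = norm (g (h n *\<^sub>R e + x) - g x) / h n"
      unfolding D_def norm_scaleR using h(1)[of n] by simp
    ultimately show ?thesis using True h(1)[of n] by (simp add: divide_le_eq mult.commute)
  next
    case False
    have "norm x \<le> norm (h n *\<^sub>R e + x) + h n * norm e"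
      using norm_triangle_ineq4[of "h n *\<^sub>R e + x" "h n *\<^sub>R e"] h(1)[of n] by simp
    moreover have "h n * norm e \<le> 1 * norm e" using h[of n] by (intro mult_right_mono) auto
    ultimately have "norm (h n *\<^sub>R e + x) > R" using False unfolding R'_def by linarith
    moreover have "norm x > R" using False norm_ge_zero[of e] unfolding R'_def by linarith
    ultimately show ?thesis using False M(2) by (simp add: D_def supp)
  qed
  have "(\<lambda>n. integral\<^sup>L lborel (D n)) \<longlonglongrightarrow> integral\<^sup>L lborel (\<lambda>x. g' x e)"
  proof (rule integral_dominated_convergence)
    show "integrable lborel (\<lambda>x. M * indicator (cball 0 R') x)"
      by (intro integrable_mult_right integrable_real_indicator) (auto simp: emeasure_lborel_cball_finite[unfolded infinity_ennreal_def])
    show "(\<lambda>x. g' x e) \<in> borel_measurable lborel"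
      using cont borel_measurable_continuous_onI by auto
    show "D n \<in> borel_measurable lborel" for n unfolding D_def by measurable
  qed (use D_lim D_bound in auto)
  then have "integral\<^sup>L lborel (\<lambda>x. g' x e) = 0" by (simp add: D0 LIMSEQ_const_iff)
  moreover have "(\<lambda>x. g' x e) \<in> borel_measurable lborel"
    using cont borel_measurable_continuous_onI by auto
  ultimately show ?thesis by (simp add: integral_completion)
qed

lemma test_functions_smooth: "\<phi> \<in> test_functions \<Omega> \<Longrightarrow> smooth \<phi>"
  by (simp add: test_functions_def)

lemma zero_outside_support: "x \<notin> closure {x. f x \<noteq> 0} \<Longrightarrow> f x = 0"
  using subsetD[OF closure_subset, of x "{x. f x \<noteq> 0}"] by blast

lemma test_functions_zero_outside: "\<phi> \<in> test_functions \<Omega> \<Longrightarrow> x \<notin> \<Omega> \<Longrightarrow> \<phi> x = 0"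
  using zero_outside_support[of x \<phi>] by (auto simp: test_functions_def)

lemma partial_deriv_zero_outside_support:
  assumes "x \<notin> closure {x. \<phi> x \<noteq> 0}"
  shows "partial_deriv i \<phi> x = 0"
proof -
  have "((\<lambda>x. 0) has_derivative (\<lambda>h. 0)) (at x)" by simp
  then have "(\<phi> has_derivative (\<lambda>h. 0)) (at x)"
    by (rule has_derivative_transform_within_open[of _ _ _ _ "- closure {x. \<phi> x \<noteq> 0}"])
      (use assms closure_subset[of "{x. \<phi> x \<noteq> 0}"] in auto)
  then show ?thesis by (rule partial_deriv_eqI)
qed

lemma test_functions_partial_deriv:
  assumes "\<phi> \<in> test_functions \<Omega>"
  shows "partial_deriv i \<phi> \<in> test_functions \<Omega>"
proof -
  have "{x. partial_deriv i \<phi> x \<noteq> 0} \<subseteq> closure {x. \<phi> x \<noteq> 0}"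
    using partial_deriv_zero_outside_support by blast
  then have "closure {x. partial_deriv i \<phi> x \<noteq> 0} \<subseteq> closure {x. \<phi> x \<noteq> 0}"
    by (simp add: closure_minimal)
  moreover have "bounded {x. partial_deriv i \<phi> x \<noteq> 0}"
    using assms by (intro bounded_subset[OF bounded_closure \<open>{x. partial_deriv i \<phi> x \<noteq> 0} \<subseteq> _\<close>])
      (simp add: test_functions_def compact_closure)
  ultimately show ?thesis
    using assms smoothD(2) by (auto simp: test_functions_def compact_closure)
qed

lemma test_functions_add:
  assumes "\<phi> \<in> test_functions \<Omega>" "\<psi> \<in> test_functions \<Omega>"
  shows "(\<lambda>x. \<phi> x + \<psi> x) \<in> test_functions \<Omega>"
proof -
  have sub: "{x. \<phi> x + \<psi> x \<noteq> 0} \<subseteq> {x. \<phi> x \<noteq> 0} \<union> {x. \<psi> x \<noteq> 0}" by auto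
  have "bounded ({x. \<phi> x \<noteq> 0} \<union> {x. \<psi> x \<noteq> 0})"
    using assms by (auto simp: test_functions_def compact_closure)
  then have "bounded {x. \<phi> x + \<psi> x \<noteq> 0}" using sub bounded_subset by blast
  moreover have "closure {x. \<phi> x + \<psi> x \<noteq> 0} \<subseteq> closure {x. \<phi> x \<noteq> 0} \<union> closure {x. \<psi> x \<noteq> 0}"
    using closure_mono[OF sub] by simp
  ultimately show ?thesis
    using assms smooth_add by (auto simp: test_functions_def compact_closure)
qed

lemma test_functions_bounded_linear:
  assumes L: "bounded_linear L" and "\<phi> \<in> test_functions \<Omega>"
  shows "(\<lambda>x. L (\<phi> x)) \<in> test_functions \<Omega>"
proof -
  have sub: "{x. L (\<phi> x) \<noteq> 0} \<subseteq> {x. \<phi> x \<noteq> 0}"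
    using linear_0[OF bounded_linear.linear[OF L]] by auto
  show ?thesis
    using assms smooth_bounded_linear[OF L] closure_mono[OF sub] bounded_subset[OF _ sub]
    by (auto simp: test_functions_def compact_closure)
qed

lemma zero_in_test_functions: "(\<lambda>x. 0) \<in> test_functions \<Omega>"
  using smooth_const[of 0] by (simp add: test_functions_def)

lemma test_functions_integrable_mult:
  fixes u :: "real^2 \<Rightarrow> 'a::euclidean_space" and \<phi> :: "real^2 \<Rightarrow> real"
  assumes \<phi>: "\<phi> \<in> test_functions \<Omega>" and u: "locally_integrable \<Omega> u"
  shows "set_integrable lebesgue \<Omega> (\<lambda>x. \<phi> x *\<^sub>R u x)"
proof -
  define K where "K = closure {x. \<phi> x \<noteq> 0}"
  have K: "compact K" "K \<subseteq> \<Omega>" using \<phi> by (auto simp: K_def test_functions_def)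
  have zero: "\<phi> x = 0" if "x \<notin> K" for x using that unfolding K_def by (rule zero_outside_support)
  have cont: "continuous_on A \<phi>" for A by (rule smooth_continuous[OF test_functions_smooth[OF \<phi>]])
  have "bounded (\<phi> ` K)" by (rule compact_imp_bounded[OF compact_continuous_image[OF cont K(1)]])
  then obtain b where b: "b > 0" "\<And>x. x \<in> K \<Longrightarrow> \<bar>\<phi> x\<bar> \<le> b" by (auto simp: bounded_pos)
  have int: "integrable lebesgue (\<lambda>x. indicator K x *\<^sub>R u x)"
    using u K by (auto simp: locally_integrable_def set_integrable_def)
  have eq: "indicator \<Omega> x *\<^sub>R \<phi> x *\<^sub>R u x = \<phi> x *\<^sub>R indicator K x *\<^sub>R u x" for x
    using zero K(2) by (cases "x \<in> K") auto
  show ?thesis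
    unfolding set_integrable_def eq
  proof (rule Bochner_Integration.integrable_bound[OF integrable_scaleR_right[OF int, of b]])
    have "\<phi> \<in> borel_measurable lebesgue"
      by (auto intro!: measurable_completion borel_measurable_continuous_onI cont)
    then show "(\<lambda>x. \<phi> x *\<^sub>R indicator K x *\<^sub>R u x) \<in> borel_measurable lebesgue"
      using borel_measurable_integrable[OF int] by measurable
    show "AE x in lebesgue. norm (\<phi> x *\<^sub>R indicator K x *\<^sub>R u x) \<le> norm (b *\<^sub>R indicator K x *\<^sub>R u x)"
    proof (rule AE_I2)
      fix x
      show "norm (\<phi> x *\<^sub>R indicator K x *\<^sub>R u x) \<le> norm (b *\<^sub>R indicator K x *\<^sub>R u x)"
        using b by (cases "x \<in> K") (auto intro!: mult_right_mono)
    qed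
  qed
qed

text \<open>
  Whatever is built from a test function and vanishes with it can be integrated over the whole
  plane instead of \<open>\<Omega>\<close>.
\<close>

lemma integral_test_function:
  assumes "\<phi> \<in> test_functions \<Omega>" "\<And>x. f (0::'a::real_normed_vector) x = 0"
  shows "(LINT x:\<Omega>|lebesgue. f (\<phi> x) x) = integral\<^sup>L lebesgue (\<lambda>x. f (\<phi> x) x)"
proof -
  have "indicator \<Omega> x *\<^sub>R f (\<phi> x) x = f (\<phi> x) x" for x
    using test_functions_zero_outside[OF assms(1)] assms(2) by (cases "x \<in> \<Omega>") auto
  then show ?thesis by (simp add: set_lebesgue_integral_def)
qed

lemma test_function_bounded_support:
  assumes "\<phi> \<in> test_functions \<Omega>"
  obtains R where "\<And>x. norm x > R \<Longrightarrow> \<phi> x = 0"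
proof -
  have "bounded {x. \<phi> x \<noteq> 0}" using assms by (simp add: test_functions_def compact_closure)
  then show ?thesis using that unfolding bounded_iff by (meson linorder_not_le mem_Collect_eq)
qed

lemma integrable_test_function_expression:
  fixes f :: "'c::real_normed_vector \<Rightarrow> real^2 \<Rightarrow> 'a::euclidean_space"
  assumes \<phi>: "\<phi> \<in> test_functions \<Omega>" and "\<And>x. f 0 x = 0"
    and cont: "continuous_on UNIV (\<lambda>x. f (\<phi> x) x)"
  shows "integrable lebesgue (\<lambda>x. f (\<phi> x) x)"
proof -
  obtain R where "\<And>x. norm x > R \<Longrightarrow> \<phi> x = 0" using test_function_bounded_support[OF \<phi>] by blast
  then have "integrable lborel (\<lambda>x. f (\<phi> x) x)"
    using assms by (intro integrable_continuous_bounded_support[of _ R]) auto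
  then show ?thesis by (simp add: integrable_completion borel_measurable_integrable)
qed

lemma integration_by_parts:
  fixes u :: "real^2 \<Rightarrow> 'a::euclidean_space" and \<phi> :: "real^2 \<Rightarrow> real"
  assumes \<phi>: "\<phi> \<in> test_functions \<Omega>" and u: "smooth u"
  shows "(LINT x:\<Omega>|lebesgue. partial_deriv i \<phi> x *\<^sub>R u x) = - (LINT x:\<Omega>|lebesgue. \<phi> x *\<^sub>R partial_deriv i u x)"
proof -
  obtain R where R: "\<And>x. norm x > R \<Longrightarrow> \<phi> x = 0" using test_function_bounded_support[OF \<phi>] by blast
  note s\<phi> = test_functions_smooth[OF \<phi>]
  have cont: "continuous_on UNIV (\<lambda>x. \<phi> x *\<^sub>R partial_deriv i u x)" "continuous_on UNIV (\<lambda>x. partial_deriv i \<phi> x *\<^sub>R u x)"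
    by (intro continuous_intros smooth_continuous smoothD(2) s\<phi> u)+
  have int: "integrable lebesgue (\<lambda>x. \<phi> x *\<^sub>R partial_deriv i u x)"
    "integrable lebesgue (\<lambda>x. partial_deriv i \<phi> x *\<^sub>R u x)"
    using integrable_test_function_expression[OF \<phi>, of "\<lambda>y x. y *\<^sub>R partial_deriv i u x"] cont(1)
      integrable_test_function_expression[OF test_functions_partial_deriv[OF \<phi>, of i], of "\<lambda>y x. y *\<^sub>R u x"] cont(2)
    by auto
  have "integral\<^sup>L lebesgue (\<lambda>x. \<phi> x *\<^sub>R frechet_derivative u (at x) (axis i 1)
      + frechet_derivative \<phi> (at x) (axis i 1) *\<^sub>R u x) = 0"
    using continuous_on_add[OF cont] R
    by (intro integral_directional_derivative_zero[where g = "\<lambda>x. \<phi> x *\<^sub>R u x" and R = R and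
          g' = "\<lambda>x h. \<phi> x *\<^sub>R frechet_derivative u (at x) h + frechet_derivative \<phi> (at x) h *\<^sub>R u x"]
        has_derivative_scaleR smooth_has_derivative s\<phi> u) (auto simp: partial_deriv_def)
  then have "integral\<^sup>L lebesgue (\<lambda>x. \<phi> x *\<^sub>R partial_deriv i u x)
      + integral\<^sup>L lebesgue (\<lambda>x. partial_deriv i \<phi> x *\<^sub>R u x) = 0"
    using int by (simp add: partial_deriv_def[symmetric])
  then show ?thesis
    using integral_test_function[OF \<phi>, of "\<lambda>y x. y *\<^sub>R partial_deriv i u x"]
      integral_test_function[OF test_functions_partial_deriv[OF \<phi>], of "\<lambda>y x. y *\<^sub>R u x" i]
    by (simp add: add_eq_0_iff)
qed

lemma locally_integrable_add:
  "locally_integrable \<Omega> u \<Longrightarrow> locally_integrable \<Omega> v \<Longrightarrow> locally_integrable \<Omega> (\<lambda>x. u x + v x)"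
  by (simp add: locally_integrable_def)

lemma set_integrable_bounded_linear:
  assumes "bounded_linear L" "set_integrable M A f"
  shows "set_integrable M A (\<lambda>x. L (f x))"
  using integrable_bounded_linear[OF assms(1) assms(2)[unfolded set_integrable_def]]
    linear_scale[OF bounded_linear.linear[OF assms(1)]]
  by (simp add: set_integrable_def)

lemma set_integral_bounded_linear:
  fixes f :: "'c \<Rightarrow> 'a::{banach, second_countable_topology}"
    and L :: "'a \<Rightarrow> 'b::{banach, second_countable_topology}"
  assumes "bounded_linear L" "set_integrable M A f"
  shows "(LINT x:A|M. L (f x)) = L (LINT x:A|M. f x)"
  using integral_bounded_linear[OF assms(1) assms(2)[unfolded set_integrable_def]]
    linear_scale[OF bounded_linear.linear[OF assms(1)]]
  by (simp add: set_lebesgue_integral_def)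

lemma locally_integrable_bounded_linear:
  assumes L: "bounded_linear L" and u: "locally_integrable \<Omega> u"
  shows "locally_integrable \<Omega> (\<lambda>x. L (u x))"
  unfolding locally_integrable_def
proof (intro allI impI)
  fix K assume "compact K \<and> K \<subseteq> \<Omega>"
  then show "set_integrable lebesgue K (\<lambda>x. L (u x))"
    using u by (intro set_integrable_bounded_linear[OF L]) (simp add: locally_integrable_def)
qed

lemma locally_integrable_continuous:
  fixes u :: "real^2 \<Rightarrow> 'a::euclidean_space"
  assumes "continuous_on UNIV u"
  shows "locally_integrable \<Omega> u"
  unfolding locally_integrable_def set_integrable_def
  using borel_integrable_compact[OF _ continuous_on_subset[OF assms]]
  by (auto simp: integrable_completion borel_measurable_integrable)

lemma has_weak_gradient_component:
  "has_weak_gradient \<Omega> u G \<Longrightarrow> locally_integrable \<Omega> (\<lambda>x. G x $ i)"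
  unfolding has_weak_gradient_def
  by (rule locally_integrable_bounded_linear[OF bounded_linear_vec_nth]) simp

lemma has_weak_gradient_add:
  assumes u: "has_weak_gradient \<Omega> u G" and v: "has_weak_gradient \<Omega> v G'"
  shows "has_weak_gradient \<Omega> (\<lambda>x. u x + v x) (\<lambda>x. G x + G' x)"
  unfolding has_weak_gradient_def
proof (intro conjI ballI allI)
  fix \<phi> :: "real^2 \<Rightarrow> real" and i assume \<phi>: "\<phi> \<in> test_functions \<Omega>"
  show "(LINT x:\<Omega>|lebesgue. partial_deriv i \<phi> x *\<^sub>R (u x + v x))
      = - (LINT x:\<Omega>|lebesgue. \<phi> x *\<^sub>R ((G x + G' x) $ i))"
  proof -
    have lu: "locally_integrable \<Omega> u" "locally_integrable \<Omega> v"
      using u v by (simp_all add: has_weak_gradient_def)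
    have "(LINT x:\<Omega>|lebesgue. partial_deriv i \<phi> x *\<^sub>R (u x + v x))
        = (LINT x:\<Omega>|lebesgue. partial_deriv i \<phi> x *\<^sub>R u x) + (LINT x:\<Omega>|lebesgue. partial_deriv i \<phi> x *\<^sub>R v x)"
      unfolding scaleR_add_right
      by (intro set_integral_add test_functions_integrable_mult[OF test_functions_partial_deriv[OF \<phi>]] lu)
    moreover have "(LINT x:\<Omega>|lebesgue. \<phi> x *\<^sub>R (G x $ i + G' x $ i))
        = (LINT x:\<Omega>|lebesgue. \<phi> x *\<^sub>R G x $ i) + (LINT x:\<Omega>|lebesgue. \<phi> x *\<^sub>R G' x $ i)"
      unfolding scaleR_add_right
      by (intro set_integral_add test_functions_integrable_mult[OF \<phi>] has_weak_gradient_component[OF u]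
          has_weak_gradient_component[OF v])
    ultimately show ?thesis
      using u v \<phi> by (simp add: has_weak_gradient_def)
  qed
qed (use u v in \<open>auto simp: has_weak_gradient_def intro!: locally_integrable_add\<close>)

text \<open>
  The effect on gradients of applying \<open>L\<close> to the functions.
\<close>

lemma bounded_linear_componentwise:
  fixes L :: "'a::euclidean_space \<Rightarrow> 'b::euclidean_space"
  assumes "bounded_linear L"
  shows "bounded_linear (\<lambda>g :: 'a^2. \<chi> i. L (g $ i))"
  using linear_add[OF bounded_linear.linear[OF assms]] linear_scale[OF bounded_linear.linear[OF assms]]
  by (intro linear_conv_bounded_linear[THEN iffD1] linearI) (auto simp: vec_eq_iff)

text \<open>
  The operators \<open>L\<close> of interest are multiplication by a real number and, on complex
  functions, by the imaginary unit.
\<close>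

lemma has_weak_gradient_bounded_linear:
  fixes L :: "'a::{real_normed_field,euclidean_space} \<Rightarrow> 'b::{real_normed_field,euclidean_space}"
  assumes L: "bounded_linear L" and u: "has_weak_gradient \<Omega> u G"
  shows "has_weak_gradient \<Omega> (\<lambda>x. L (u x)) (\<lambda>x. \<chi> i. L (G x $ i))"
  unfolding has_weak_gradient_def
proof (intro conjI ballI allI)
  show "locally_integrable \<Omega> (\<lambda>x. \<chi> i. L (G x $ i))"
    using u by (intro locally_integrable_bounded_linear[OF bounded_linear_componentwise[OF L]])
      (simp add: has_weak_gradient_def)
  fix \<phi> :: "real^2 \<Rightarrow> real" and i assume \<phi>: "\<phi> \<in> test_functions \<Omega>"
  have lu: "locally_integrable \<Omega> u" using u by (simp add: has_weak_gradient_def)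
  show "(LINT x:\<Omega>|lebesgue. partial_deriv i \<phi> x *\<^sub>R L (u x))
      = - (LINT x:\<Omega>|lebesgue. \<phi> x *\<^sub>R ((\<chi> i. L (G x $ i)) $ i))"
    using u \<phi> linear_scale[OF bounded_linear.linear[OF L], symmetric] linear_neg[OF bounded_linear.linear[OF L]]
      set_integral_bounded_linear[OF L test_functions_integrable_mult[OF test_functions_partial_deriv[OF \<phi>] lu]]
      set_integral_bounded_linear[OF L test_functions_integrable_mult[OF \<phi> has_weak_gradient_component[OF u]]]
    by (simp add: has_weak_gradient_def)
next
  show "locally_integrable \<Omega> (\<lambda>x. L (u x))"
    using u by (intro locally_integrable_bounded_linear[OF L]) (simp add: has_weak_gradient_def)
qed

lemma has_weak_gradient_smooth:
  fixes u :: "real^2 \<Rightarrow> 'a::{real_normed_field,euclidean_space}"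
  assumes u: "smooth u"
  shows "has_weak_gradient \<Omega> u (\<lambda>x. \<chi> i. partial_deriv i u x)"
  unfolding has_weak_gradient_def
  using integration_by_parts[OF _ u]
  by (auto intro!: locally_integrable_continuous continuous_on_vec_lambda
      smooth_continuous[OF u] smooth_continuous[OF smoothD(2)[OF u]])

lemma has_weak_gradient_unique:
  assumes \<Omega>: "open \<Omega>" and G: "has_weak_gradient \<Omega> u G" and G': "has_weak_gradient \<Omega> u G'"
  shows "AE x\<in>\<Omega> in lebesgue. G x = G' x"
proof -
  have "AE x\<in>\<Omega> in lebesgue. G x $ i + (-1) *\<^sub>R G' x $ i = 0" for i
  proof (rule AE_zero_of_test_functions[OF \<Omega>])
    have loc: "locally_integrable \<Omega> (\<lambda>x. G x $ i)" "locally_integrable \<Omega> (\<lambda>x. (-1) *\<^sub>R G' x $ i)"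
      using has_weak_gradient_component[OF G] locally_integrable_bounded_linear[OF
          bounded_linear_scaleR_right[of "-1"] has_weak_gradient_component[OF G'], of i] by auto
    then show "locally_integrable \<Omega> (\<lambda>x. G x $ i + (-1) *\<^sub>R G' x $ i)"
      by (rule locally_integrable_add)
    fix \<phi> :: "real^2 \<Rightarrow> real" assume \<phi>: "\<phi> \<in> test_functions \<Omega>"
    then show "(LINT x:\<Omega>|lebesgue. \<phi> x *\<^sub>R (G x $ i + (-1) *\<^sub>R G' x $ i)) = 0"
      using G G' test_functions_integrable_mult[OF \<phi> has_weak_gradient_component[OF G], of i]
        test_functions_integrable_mult[OF \<phi> has_weak_gradient_component[OF G'], of i]
      by (simp add: has_weak_gradient_def scaleR_diff_right set_integral_diff)
  qed
  then have "AE x in lebesgue. \<forall>i. x \<in> \<Omega> \<longrightarrow> G x $ i + (-1) *\<^sub>R G' x $ i = 0"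
    unfolding AE_all_countable by blast
  then show ?thesis by eventually_elim (auto simp: vec_eq_iff)
qed

section \<open>Sobolev spaces and the Poincare inequality\<close>

text \<open>
  An exhaustion by compact sets writes the function as a pointwise limit of integrable ones.
\<close>

lemma locally_integrable_measurable:
  fixes f :: "real^2 \<Rightarrow> 'b::euclidean_space"
  assumes "open \<Omega>" and f: "locally_integrable \<Omega> f"
  shows "set_borel_measurable lebesgue \<Omega> f"
proof -
  obtain C where C: "\<And>n. compact (C n)" "\<And>n. C n \<subseteq> \<Omega>" "\<And>n. C n \<subseteq> interior (C (Suc n))"
      "\<Union>(range C) = \<Omega>"
    using open_Union_compact_subsets[OF assms(1)] by metis
  have mono: "C n \<subseteq> C m" if "n \<le> m" for n m
  proof (rule lift_Suc_mono_le[of C, OF _ that])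
    show "C n \<subseteq> C (Suc n)" for n using C(3) interior_subset by (rule order_trans)
  qed
  show ?thesis
    unfolding set_borel_measurable_def
  proof (rule borel_measurable_LIMSEQ_metric)
    show "(\<lambda>x. indicator (C n) x *\<^sub>R f x) \<in> borel_measurable lebesgue" for n
      by (rule borel_measurable_integrable)
        (use f C(1,2)[of n] in \<open>simp add: locally_integrable_def set_integrable_def\<close>)
    fix x
    show "(\<lambda>n. indicator (C n) x *\<^sub>R f x) \<longlonglongrightarrow> indicator \<Omega> x *\<^sub>R f x"
    proof (cases "x \<in> \<Omega>")
      case True
      then obtain n where "x \<in> C n" using C(4) by blast
      then have "x \<in> C m" if "m \<ge> n" for m using mono[OF that] by blast
      then have "eventually (\<lambda>m. indicator (C m) x *\<^sub>R f x = indicator \<Omega> x *\<^sub>R f x) sequentially"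
        unfolding eventually_sequentially using True by (intro exI[of _ n]) auto
      then show ?thesis by (rule tendsto_eventually)
    next
      case False
      then have "x \<notin> C n" for n using C(2) by blast
      then show ?thesis using False by simp
    qed
  qed
qed

lemma set_borel_measurable_norm_power2:
  fixes f :: "real^2 \<Rightarrow> 'b::euclidean_space"
  assumes "set_borel_measurable lebesgue \<Omega> f"
  shows "set_borel_measurable lebesgue \<Omega> (\<lambda>x. (norm (f x))\<^sup>2)"
proof -
  have "(\<lambda>x. (norm (indicator \<Omega> x *\<^sub>R f x))\<^sup>2) \<in> borel_measurable lebesgue"
    using assms unfolding set_borel_measurable_def by measurable
  moreover have "(norm (indicator \<Omega> x *\<^sub>R f x))\<^sup>2 = indicator \<Omega> x *\<^sub>R (norm (f x))\<^sup>2" for x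
    by (cases "x \<in> \<Omega>") auto
  ultimately show ?thesis by (simp only: set_borel_measurable_def)
qed

abbreviation L2_sq :: "(real^2) set \<Rightarrow> (real^2 \<Rightarrow> 'a::real_normed_vector) \<Rightarrow> real" where
  "L2_sq \<Omega> f \<equiv> (LINT x:\<Omega>|lebesgue. (norm (f x))\<^sup>2)"

text \<open>
  The estimate $|a+b|^2 \le 2|a|^2 + 2|b|^2$ takes the place of the triangle inequality in $L^2$
  throughout.
\<close>

lemma square_integrable_add:
  assumes f: "square_integrable \<Omega> f" and g: "square_integrable \<Omega> g"
  shows "square_integrable \<Omega> (\<lambda>x. f x + g x)"
    and "L2_sq \<Omega> (\<lambda>x. f x + g x)
      \<le> 2 * L2_sq \<Omega> f + 2 * L2_sq \<Omega> g"
proof -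
  have le: "(norm (f x + g x))\<^sup>2 \<le> 2 * (norm (f x))\<^sup>2 + 2 * (norm (g x))\<^sup>2" for x
  proof -
    have "(norm (f x + g x))\<^sup>2 \<le> (norm (f x) + norm (g x))\<^sup>2"
      by (intro power_mono norm_triangle_ineq) auto
    also have "\<dots> \<le> 2 * (norm (f x))\<^sup>2 + 2 * (norm (g x))\<^sup>2"
      using sum_squares_bound[of "norm (f x)" "norm (g x)"] by (simp add: power2_sum)
    finally show ?thesis .
  qed
  have meas: "set_borel_measurable lebesgue \<Omega> (\<lambda>x. f x + g x)"
    using f g unfolding square_integrable_def set_borel_measurable_def scaleR_add_right
    by (intro borel_measurable_add) auto
  have fg: "set_integrable lebesgue \<Omega> (\<lambda>x. (norm (f x))\<^sup>2)" "set_integrable lebesgue \<Omega> (\<lambda>x. (norm (g x))\<^sup>2)"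
    using f g by (auto simp: square_integrable_def)
  then have sum: "set_integrable lebesgue \<Omega> (\<lambda>x. 2 * (norm (f x))\<^sup>2 + 2 * (norm (g x))\<^sup>2)"
    by (intro set_integral_add set_integrable_mult_right)
  have sq: "set_borel_measurable lebesgue \<Omega> (\<lambda>x. (norm (f x + g x))\<^sup>2)"
    by (rule set_borel_measurable_norm_power2[OF meas])
  have int: "set_integrable lebesgue \<Omega> (\<lambda>x. (norm (f x + g x))\<^sup>2)"
    by (rule set_integrable_bound[OF sum sq]) (use le in \<open>auto intro!: AE_I2\<close>)
  then show "square_integrable \<Omega> (\<lambda>x. f x + g x)"
    using meas by (simp add: square_integrable_def)
  have "L2_sq \<Omega> (\<lambda>x. f x + g x)
      \<le> (LINT x:\<Omega>|lebesgue. 2 * (norm (f x))\<^sup>2 + 2 * (norm (g x))\<^sup>2)"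
    by (intro set_integral_mono int sum le)
  also have "\<dots> = 2 * L2_sq \<Omega> f + 2 * L2_sq \<Omega> g"
    using set_integral_add(2)[OF set_integrable_mult_right[OF fg(1), of 2] set_integrable_mult_right[OF fg(2), of 2]]
    by simp
  finally show "L2_sq \<Omega> (\<lambda>x. f x + g x)
      \<le> 2 * L2_sq \<Omega> f + 2 * L2_sq \<Omega> g" .
qed

lemma square_integrable_bounded_linear:
  fixes f :: "real^2 \<Rightarrow> 'a::euclidean_space" and L :: "'a \<Rightarrow> 'b::euclidean_space"
  assumes L: "bounded_linear L" and K: "\<And>y. norm (L y) \<le> K * norm y" and f: "square_integrable \<Omega> f"
  shows "square_integrable \<Omega> (\<lambda>x. L (f x))"
    and "L2_sq \<Omega> (\<lambda>x. L (f x)) \<le> K\<^sup>2 * L2_sq \<Omega> f"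
proof -
  have le: "(norm (L (f x)))\<^sup>2 \<le> K\<^sup>2 * (norm (f x))\<^sup>2" for x
    using power_mono[OF K[of "f x"] norm_ge_zero, of 2] unfolding power_mult_distrib .
  have scale: "indicator \<Omega> x *\<^sub>R L (f x) = L (indicator \<Omega> x *\<^sub>R f x)" for x
    by (simp add: linear_scale[OF bounded_linear.linear[OF L]])
  have meas: "set_borel_measurable lebesgue \<Omega> (\<lambda>x. L (f x))"
    unfolding set_borel_measurable_def scale
    using f bounded_linear.continuous_on[OF L continuous_on_id]
    by (intro measurable_compose[of _ lebesgue borel L] borel_measurable_continuous_onI)
      (simp_all add: square_integrable_def set_borel_measurable_def)
  have f2: "set_integrable lebesgue \<Omega> (\<lambda>x. K\<^sup>2 * (norm (f x))\<^sup>2)"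
    using f by (auto simp: square_integrable_def)
  have sq: "set_borel_measurable lebesgue \<Omega> (\<lambda>x. (norm (L (f x)))\<^sup>2)"
    by (rule set_borel_measurable_norm_power2[OF meas])
  have int: "set_integrable lebesgue \<Omega> (\<lambda>x. (norm (L (f x)))\<^sup>2)"
    by (rule set_integrable_bound[OF f2 sq]) (use le in \<open>auto intro!: AE_I2\<close>)
  then show "square_integrable \<Omega> (\<lambda>x. L (f x))"
    using meas by (simp add: square_integrable_def)
  have "L2_sq \<Omega> (\<lambda>x. L (f x)) \<le> (LINT x:\<Omega>|lebesgue. K\<^sup>2 * (norm (f x))\<^sup>2)"
    by (intro set_integral_mono int f2 le)
  then show "L2_sq \<Omega> (\<lambda>x. L (f x)) \<le> K\<^sup>2 * L2_sq \<Omega> f"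
    by simp
qed

lemma square_integrable_uminus:
  fixes f :: "real^2 \<Rightarrow> 'a::euclidean_space"
  assumes "square_integrable \<Omega> f"
  shows "square_integrable \<Omega> (\<lambda>x. - f x)"
  using square_integrable_bounded_linear(1)[OF bounded_linear_minus[OF bounded_linear_ident], of 1 \<Omega> f] assms by simp

lemma square_integrable_inner:
  fixes f g :: "real^2 \<Rightarrow> 'a::euclidean_space"
  assumes f: "square_integrable \<Omega> f" and g: "square_integrable \<Omega> g"
  shows "set_integrable lebesgue \<Omega> (\<lambda>x. f x \<bullet> g x)"
proof (rule set_integrable_bound)
  show "set_integrable lebesgue \<Omega> (\<lambda>x. (norm (f x))\<^sup>2 + (norm (g x))\<^sup>2)"
    using f g by (intro set_integral_add) (auto simp: square_integrable_def)
  have "(\<lambda>x. (indicator \<Omega> x *\<^sub>R f x) \<bullet> (indicator \<Omega> x *\<^sub>R g x)) \<in> borel_measurable lebesgue"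
    using f g by (intro borel_measurable_inner) (auto simp: square_integrable_def set_borel_measurable_def)
  moreover have "(indicator \<Omega> x *\<^sub>R f x) \<bullet> (indicator \<Omega> x *\<^sub>R g x) = indicator \<Omega> x *\<^sub>R (f x \<bullet> g x)" for x
    by (cases "x \<in> \<Omega>") auto
  ultimately show "set_borel_measurable lebesgue \<Omega> (\<lambda>x. f x \<bullet> g x)"
    by (simp only: set_borel_measurable_def)
  have "\<bar>f x \<bullet> g x\<bar> \<le> (norm (f x))\<^sup>2 + (norm (g x))\<^sup>2" for x
    using Cauchy_Schwarz_ineq2[of "f x" "g x"] sum_squares_bound[of "norm (f x)" "norm (g x)"]
      zero_le_mult_iff[of "norm (f x)" "norm (g x)"] by simp
  then show "AE x\<in>\<Omega> in lebesgue. norm (f x \<bullet> g x) \<le> norm ((norm (f x))\<^sup>2 + (norm (g x))\<^sup>2)"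
    by auto
qed

lemma square_integrable_transfer_AE:
  fixes f g :: "real^2 \<Rightarrow> 'a::euclidean_space"
  assumes f: "square_integrable \<Omega> f" and ae: "AE x\<in>\<Omega> in lebesgue. f x = g x"
    and meas: "set_borel_measurable lebesgue \<Omega> g"
  shows "square_integrable \<Omega> g"
    and "L2_sq \<Omega> f = L2_sq \<Omega> g"
proof -
  have sq: "(\<lambda>x. indicator \<Omega> x *\<^sub>R (norm (g x))\<^sup>2) \<in> borel_measurable lebesgue"
    using set_borel_measurable_norm_power2[OF meas] by (simp only: set_borel_measurable_def)
  have int: "integrable lebesgue (\<lambda>x. indicator \<Omega> x *\<^sub>R (norm (f x))\<^sup>2)"
    using f by (simp add: square_integrable_def set_integrable_def)
  have eq: "AE x in lebesgue. indicator \<Omega> x *\<^sub>R (norm (f x))\<^sup>2 = indicator \<Omega> x *\<^sub>R (norm (g x))\<^sup>2"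
    using ae by eventually_elim (auto simp: indicator_def)
  have "integrable lebesgue (\<lambda>x. indicator \<Omega> x *\<^sub>R (norm (g x))\<^sup>2)"
    by (rule integrable_cong_AE_imp[OF int sq]) (use eq in eventually_elim, simp)
  then show "square_integrable \<Omega> g"
    using meas by (simp add: square_integrable_def set_integrable_def)
  show "L2_sq \<Omega> f = L2_sq \<Omega> g"
    unfolding set_lebesgue_integral_def
    by (rule integral_cong_AE[OF borel_measurable_integrable[OF int] sq eq])
qed

lemma H1I:
  "\<lbrakk>square_integrable \<Omega> u; has_weak_gradient \<Omega> u G; square_integrable \<Omega> G\<rbrakk> \<Longrightarrow> u \<in> H1 \<Omega>"
  by (auto simp: H1_def)

lemma weak_gradient:
  assumes "has_weak_gradient \<Omega> u G"
  shows "has_weak_gradient \<Omega> u (weak_gradient \<Omega> u)"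
  unfolding weak_gradient_def using assms by (rule someI[of "has_weak_gradient \<Omega> u"])

lemma weak_gradient_eq_AE:
  assumes "open \<Omega>" "has_weak_gradient \<Omega> u G"
  shows "AE x\<in>\<Omega> in lebesgue. weak_gradient \<Omega> u x = G x"
  by (rule has_weak_gradient_unique[OF assms(1) weak_gradient[OF assms(2)] assms(2)])

text \<open>
  For the representative \<open>weak_gradient\<close> square integrability is not part of the
  definition; it is inherited, up to a null set, from the gradient that witnesses membership in
  $H^1$.
\<close>

lemma H1D:
  assumes "open \<Omega>" "u \<in> H1 \<Omega>"
  shows "square_integrable \<Omega> u" "has_weak_gradient \<Omega> u (weak_gradient \<Omega> u)"
    "square_integrable \<Omega> (weak_gradient \<Omega> u)"
proof -
  from assms(2) obtain G where G: "square_integrable \<Omega> u" "has_weak_gradient \<Omega> u G" "square_integrable \<Omega> G"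
    by (auto simp: H1_def)
  show "square_integrable \<Omega> u" by fact
  show w: "has_weak_gradient \<Omega> u (weak_gradient \<Omega> u)" by (rule weak_gradient[OF G(2)])
  show "square_integrable \<Omega> (weak_gradient \<Omega> u)"
  proof (rule square_integrable_transfer_AE[OF G(3)])
    show "AE x\<in>\<Omega> in lebesgue. G x = weak_gradient \<Omega> u x"
      using has_weak_gradient_unique[OF assms(1) G(2) w] .
    show "set_borel_measurable lebesgue \<Omega> (weak_gradient \<Omega> u)"
      using w by (intro locally_integrable_measurable[OF assms(1)]) (simp add: has_weak_gradient_def)
  qed
qed

lemma H1_add:
  assumes "open \<Omega>" "u \<in> H1 \<Omega>" "v \<in> H1 \<Omega>"
  shows "(\<lambda>x. u x + v x) \<in> H1 \<Omega>"
  using H1D[OF assms(1,2)] H1D[OF assms(1,3)]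
  by (intro H1I[OF square_integrable_add(1) has_weak_gradient_add square_integrable_add(1)])

lemma norm_componentwise_le:
  fixes L :: "'a::euclidean_space \<Rightarrow> 'b::euclidean_space" and g :: "'a^2"
  assumes "\<And>y. norm (L y) \<le> K * norm y"
  shows "norm (\<chi> i. L (g $ i)) \<le> K * norm g"
proof -
  have K: "0 \<le> K"
  proof -
    obtain b :: 'a where "b \<in> Basis" using nonempty_Basis by blast
    then show ?thesis using order_trans[OF norm_ge_zero assms[of b]] by simp
  qed
  have "norm (\<chi> i. L (g $ i)) \<le> L2_set (\<lambda>i. K * norm (g $ i)) UNIV"
    unfolding norm_vec_def using assms by (intro L2_set_mono) auto
  also have "\<dots> = K * norm g"
    unfolding norm_vec_def by (rule L2_set_right_distrib[OF K, symmetric])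
  finally show ?thesis .
qed

lemma H1_bounded_linear:
  fixes L :: "'a::{real_normed_field,euclidean_space} \<Rightarrow> 'b::{real_normed_field,euclidean_space}"
  assumes "open \<Omega>" "bounded_linear L" "u \<in> H1 \<Omega>"
  shows "(\<lambda>x. L (u x)) \<in> H1 \<Omega>"
proof -
  obtain K where K: "\<And>y. norm (L y) \<le> K * norm y"
    using bounded_linear.bounded[OF assms(2)] by (metis mult.commute)
  note u = H1D[OF assms(1,3)]
  show ?thesis
    by (rule H1I[OF square_integrable_bounded_linear(1)[OF assms(2) K u(1)]
          has_weak_gradient_bounded_linear[OF assms(2) u(2)]
          square_integrable_bounded_linear(1)[OF bounded_linear_componentwise[OF assms(2)]
            norm_componentwise_le[OF K] u(3)]])
qed

abbreviation classical_gradient :: "(real^2 \<Rightarrow> 'a::real_normed_vector) \<Rightarrow> real^2 \<Rightarrow> 'a^2" where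
  "classical_gradient \<phi> x \<equiv> (\<chi> i. partial_deriv i \<phi> x)"

lemma square_integrable_test_function:
  fixes \<phi> :: "real^2 \<Rightarrow> 'a::euclidean_space"
  assumes \<phi>: "\<phi> \<in> test_functions \<Omega>" and \<Omega>: "open \<Omega>"
  shows "square_integrable \<Omega> \<phi>" "square_integrable \<Omega> (classical_gradient \<phi>)"
proof -
  have sq: "square_integrable \<Omega> f" if "continuous_on UNIV f" "integrable lebesgue (\<lambda>x. (norm (f x))\<^sup>2)"
    for f :: "real^2 \<Rightarrow> 'b::euclidean_space"
  proof -
    have "f \<in> borel_measurable lebesgue"
      using that(1) by (auto intro!: measurable_completion borel_measurable_continuous_onI)
    moreover have "\<Omega> \<in> sets lebesgue" using \<Omega> by simp
    ultimately show ?thesis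
      using integrable_mult_indicator[OF \<open>\<Omega> \<in> sets lebesgue\<close> that(2)]
      unfolding square_integrable_def set_borel_measurable_def set_integrable_def by simp
  qed
  have c: "continuous_on UNIV \<phi>" "continuous_on UNIV (partial_deriv i \<phi>)" for i
    using test_functions_smooth[OF \<phi>] smoothD(2) by (auto intro: smooth_continuous)
  then show "square_integrable \<Omega> \<phi>"
    by (intro sq integrable_test_function_expression[OF \<phi>, of "\<lambda>y x. (norm y)\<^sup>2"] continuous_intros) auto
  show "square_integrable \<Omega> (classical_gradient \<phi>)"
  proof (rule sq)
    show "continuous_on UNIV (classical_gradient \<phi>)" by (intro continuous_on_vec_lambda c)
    have "integrable lebesgue (\<lambda>x. (norm (partial_deriv i \<phi> x))\<^sup>2)" for i
      by (intro integrable_test_function_expression[OF test_functions_partial_deriv[OF \<phi>], of "\<lambda>y x. (norm y)\<^sup>2"]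
          continuous_intros c) auto
    then show "integrable lebesgue (\<lambda>x. (norm (classical_gradient \<phi> x))\<^sup>2)"
      by (simp add: norm_vec_def L2_set_def sum_nonneg)
  qed
qed

lemma H1_test_function:
  fixes \<phi> :: "real^2 \<Rightarrow> 'a::{real_normed_field,euclidean_space}"
  assumes "open \<Omega>" "\<phi> \<in> test_functions \<Omega>"
  shows "\<phi> \<in> H1 \<Omega>"
  using square_integrable_test_function[OF assms(2,1)] has_weak_gradient_smooth[OF test_functions_smooth[OF assms(2)]]
  by (intro H1I)

abbreviation gradient_error ::
  "(real^2) set \<Rightarrow> (real^2 \<Rightarrow> 'a::{real_normed_field,euclidean_space}) \<Rightarrow> (real^2 \<Rightarrow> 'a) \<Rightarrow> real^2 \<Rightarrow> 'a^2" where
  "gradient_error \<Omega> u \<phi> x \<equiv> weak_gradient \<Omega> u x - classical_gradient \<phi> x"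

lemma H1_norm_diff_test_function:
  fixes u :: "real^2 \<Rightarrow> 'a::{real_normed_field,euclidean_space}"
  assumes \<Omega>: "open \<Omega>" and u: "u \<in> H1 \<Omega>" and \<phi>: "\<phi> \<in> test_functions \<Omega>"
  shows "H1_norm \<Omega> (\<lambda>x. u x - \<phi> x) = sqrt (L2_sq \<Omega> (\<lambda>x. u x - \<phi> x)
      + L2_sq \<Omega> (gradient_error \<Omega> u \<phi>))"
    "square_integrable \<Omega> (\<lambda>x. u x - \<phi> x)"
    "square_integrable \<Omega> (gradient_error \<Omega> u \<phi>)"
proof -
  note u' = H1D[OF \<Omega> u]
  have m\<phi>: "(\<lambda>x. - \<phi> x) \<in> test_functions \<Omega>"
    using test_functions_bounded_linear[OF bounded_linear_minus[OF bounded_linear_ident] \<phi>] .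
  have "partial_deriv i (\<lambda>x. - \<phi> x) x = - partial_deriv i \<phi> x" for i x
    using partial_deriv_bounded_linear[OF bounded_linear_minus[OF bounded_linear_ident]
        smoothD(1)[OF test_functions_smooth[OF \<phi>]]] .
  then have g: "classical_gradient (\<lambda>x. - \<phi> x) x = - classical_gradient \<phi> x" for x
    by (simp add: vec_eq_iff)
  have w: "has_weak_gradient \<Omega> (\<lambda>x. u x - \<phi> x) (gradient_error \<Omega> u \<phi>)"
    using has_weak_gradient_add[OF u'(2) has_weak_gradient_smooth[OF test_functions_smooth[OF m\<phi>]]]
    by (simp add: g)
  show sq: "square_integrable \<Omega> (\<lambda>x. u x - \<phi> x)"
      "square_integrable \<Omega> (gradient_error \<Omega> u \<phi>)"
    using square_integrable_add(1)[OF u'(1) square_integrable_test_function(1)[OF m\<phi> \<Omega>]]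
      square_integrable_add(1)[OF u'(3) square_integrable_test_function(2)[OF m\<phi> \<Omega>]] by (simp_all add: g)
  have "L2_sq \<Omega> (\<lambda>x. weak_gradient \<Omega> (\<lambda>x. u x - \<phi> x) x)
      = L2_sq \<Omega> (gradient_error \<Omega> u \<phi>)"
  proof (rule square_integrable_transfer_AE(2))
    show "square_integrable \<Omega> (weak_gradient \<Omega> (\<lambda>x. u x - \<phi> x))"
      by (rule H1D(3)[OF \<Omega> H1I[OF sq(1) w sq(2)]])
  qed (use weak_gradient_eq_AE[OF \<Omega> w] sq in \<open>auto simp: square_integrable_def\<close>)
  then show "H1_norm \<Omega> (\<lambda>x. u x - \<phi> x) = sqrt (L2_sq \<Omega> (\<lambda>x. u x - \<phi> x)
      + L2_sq \<Omega> (gradient_error \<Omega> u \<phi>))"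
    by (simp add: H1_norm_def)
qed

text \<open>
  A working form of the definition, with the gradient of the test function made explicit and
  without the square root.
\<close>

lemma H10_iff:
  fixes u :: "real^2 \<Rightarrow> 'a::{real_normed_field,euclidean_space}"
  assumes \<Omega>: "open \<Omega>"
  shows "u \<in> H10 \<Omega> \<longleftrightarrow> u \<in> H1 \<Omega> \<and> (\<forall>\<epsilon>>0. \<exists>\<phi>\<in>test_functions \<Omega>.
      L2_sq \<Omega> (\<lambda>x. u x - \<phi> x)
      + L2_sq \<Omega> (gradient_error \<Omega> u \<phi>) < \<epsilon>)"
proof (cases "u \<in> H1 \<Omega>")
  case True
  define d where "d \<phi> = L2_sq \<Omega> (\<lambda>x. u x - \<phi> x)
      + L2_sq \<Omega> (gradient_error \<Omega> u \<phi>)" for \<phi>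
  have "u \<in> H10 \<Omega> \<longleftrightarrow> (\<forall>\<epsilon>>0. \<exists>\<phi>\<in>test_functions \<Omega>. sqrt (d \<phi>) < \<epsilon>)"
    using True H1_norm_diff_test_function(1)[OF \<Omega> True] by (simp add: H10_def d_def)
  also have "\<dots> \<longleftrightarrow> (\<forall>\<epsilon>>0. \<exists>\<phi>\<in>test_functions \<Omega>. d \<phi> < \<epsilon>)"
  proof safe
    fix \<epsilon> :: real assume "\<forall>\<epsilon>>0. \<exists>\<phi>\<in>test_functions \<Omega>. sqrt (d \<phi>) < \<epsilon>" "\<epsilon> > 0"
    then obtain \<phi> where "\<phi> \<in> test_functions \<Omega>" "sqrt (d \<phi>) < sqrt \<epsilon>" by (meson real_sqrt_gt_zero)
    then show "\<exists>\<phi>\<in>test_functions \<Omega>. d \<phi> < \<epsilon>" by auto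
  next
    fix \<epsilon> :: real assume "\<forall>\<epsilon>>0. \<exists>\<phi>\<in>test_functions \<Omega>. d \<phi> < \<epsilon>" "\<epsilon> > 0"
    then obtain \<phi> where "\<phi> \<in> test_functions \<Omega>" "d \<phi> < \<epsilon>\<^sup>2" by (meson zero_less_power)
    then show "\<exists>\<phi>\<in>test_functions \<Omega>. sqrt (d \<phi>) < \<epsilon>"
      using \<open>\<epsilon> > 0\<close> real_less_lsqrt by (metis less_imp_le)
  qed
  finally show ?thesis using True by (simp add: d_def)
qed (simp add: H10_def)

lemma H10_add:
  fixes u v :: "real^2 \<Rightarrow> 'a::{real_normed_field,euclidean_space}"
  assumes \<Omega>: "open \<Omega>" and u: "u \<in> H10 \<Omega>" and v: "v \<in> H10 \<Omega>"
  shows "(\<lambda>x. u x + v x) \<in> H10 \<Omega>"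
  unfolding H10_iff[OF \<Omega>]
proof (intro conjI allI impI)
  have H1: "u \<in> H1 \<Omega>" "v \<in> H1 \<Omega>" using u v by (auto simp: H10_def)
  then show sum: "(\<lambda>x. u x + v x) \<in> H1 \<Omega>" by (rule H1_add[OF \<Omega>])
  fix \<epsilon> :: real assume "\<epsilon> > 0"
  then have "\<epsilon> / 4 > 0" by simp
  then obtain \<phi> \<psi> where \<phi>: "\<phi> \<in> test_functions \<Omega>" "L2_sq \<Omega> (\<lambda>x. u x - \<phi> x)
      + L2_sq \<Omega> (gradient_error \<Omega> u \<phi>) < \<epsilon> / 4"
    and \<psi>: "\<psi> \<in> test_functions \<Omega>" "L2_sq \<Omega> (\<lambda>x. v x - \<psi> x)
      + L2_sq \<Omega> (gradient_error \<Omega> v \<psi>) < \<epsilon> / 4"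
    using u v unfolding H10_iff[OF \<Omega>] by blast
  note du = H1_norm_diff_test_function(2,3)[OF \<Omega> H1(1) \<phi>(1)]
  note dv = H1_norm_diff_test_function(2,3)[OF \<Omega> H1(2) \<psi>(1)]
  have sum_test: "(\<lambda>x. \<phi> x + \<psi> x) \<in> test_functions \<Omega>" by (rule test_functions_add[OF \<phi>(1) \<psi>(1)])
  have 1: "L2_sq \<Omega> (\<lambda>x. u x + v x - (\<phi> x + \<psi> x))
      \<le> 2 * L2_sq \<Omega> (\<lambda>x. u x - \<phi> x) + 2 * L2_sq \<Omega> (\<lambda>x. v x - \<psi> x)"
    using square_integrable_add(2)[OF du(1) dv(1)] by (simp add: algebra_simps)
  have "L2_sq \<Omega> (gradient_error \<Omega> (\<lambda>x. u x + v x) (\<lambda>x. \<phi> x + \<psi> x))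
      = L2_sq \<Omega> (\<lambda>x. (weak_gradient \<Omega> u x - classical_gradient \<phi> x)
          + (weak_gradient \<Omega> v x - classical_gradient \<psi> x))"
  proof (rule square_integrable_transfer_AE(2))
    show "square_integrable \<Omega> (gradient_error \<Omega> (\<lambda>x. u x + v x) (\<lambda>x. \<phi> x + \<psi> x))"
      by (rule H1_norm_diff_test_function(3)[OF \<Omega> sum sum_test])
    show "set_borel_measurable lebesgue \<Omega> (\<lambda>x. (weak_gradient \<Omega> u x - classical_gradient \<phi> x)
          + (weak_gradient \<Omega> v x - classical_gradient \<psi> x))"
      using square_integrable_add(1)[OF du(2) dv(2)] by (simp add: square_integrable_def)
    have g: "classical_gradient (\<lambda>x. \<phi> x + \<psi> x) x = classical_gradient \<phi> x + classical_gradient \<psi> x" for x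
      using partial_deriv_add[OF smoothD(1)[OF test_functions_smooth[OF \<phi>(1)]]
          smoothD(1)[OF test_functions_smooth[OF \<psi>(1)]]] by (simp add: vec_eq_iff)
    show "AE x\<in>\<Omega> in lebesgue. weak_gradient \<Omega> (\<lambda>x. u x + v x) x - classical_gradient (\<lambda>x. \<phi> x + \<psi> x) x
        = (weak_gradient \<Omega> u x - classical_gradient \<phi> x) + (weak_gradient \<Omega> v x - classical_gradient \<psi> x)"
      using weak_gradient_eq_AE[OF \<Omega> has_weak_gradient_add[OF H1D(2)[OF \<Omega> H1(1)] H1D(2)[OF \<Omega> H1(2)]]]
      by eventually_elim (simp add: g)
  qed
  with square_integrable_add(2)[OF du(2) dv(2)]
  have 2: "L2_sq \<Omega> (gradient_error \<Omega> (\<lambda>x. u x + v x) (\<lambda>x. \<phi> x + \<psi> x))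
      \<le> 2 * L2_sq \<Omega> (gradient_error \<Omega> u \<phi>)
        + 2 * L2_sq \<Omega> (gradient_error \<Omega> v \<psi>)" by simp
  show "\<exists>\<phi>\<in>test_functions \<Omega>. L2_sq \<Omega> (\<lambda>x. u x + v x - \<phi> x)
      + L2_sq \<Omega> (gradient_error \<Omega> (\<lambda>x. u x + v x) \<phi>) < \<epsilon>"
    using 1 2 \<phi>(2) \<psi>(2) by (intro bexI[OF _ sum_test]) linarith
qed

lemma H10_bounded_linear:
  fixes L :: "'a::{real_normed_field,euclidean_space} \<Rightarrow> 'b::{real_normed_field,euclidean_space}"
  assumes \<Omega>: "open \<Omega>" and L: "bounded_linear L" and u: "u \<in> H10 \<Omega>"
  shows "(\<lambda>x. L (u x)) \<in> H10 \<Omega>"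
  unfolding H10_iff[OF \<Omega>]
proof (intro conjI allI impI)
  have H1: "u \<in> H1 \<Omega>" using u by (simp add: H10_def)
  then show Lu: "(\<lambda>x. L (u x)) \<in> H1 \<Omega>" by (rule H1_bounded_linear[OF \<Omega> L])
  obtain K where K: "\<And>y. norm (L y) \<le> K * norm y" "K > 0"
    using bounded_linear.pos_bounded[OF L] by (metis mult.commute)
  fix \<epsilon> :: real assume "\<epsilon> > 0"
  then have "\<epsilon> / K\<^sup>2 > 0" using K(2) by simp
  then obtain \<phi> where \<phi>: "\<phi> \<in> test_functions \<Omega>" "L2_sq \<Omega> (\<lambda>x. u x - \<phi> x)
      + L2_sq \<Omega> (gradient_error \<Omega> u \<phi>) < \<epsilon> / K\<^sup>2"
    using u unfolding H10_iff[OF \<Omega>] by blast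
  note du = H1_norm_diff_test_function(2,3)[OF \<Omega> H1 \<phi>(1)]
  note lin = linear_diff[OF bounded_linear.linear[OF L]]
  have test: "(\<lambda>x. L (\<phi> x)) \<in> test_functions \<Omega>" by (rule test_functions_bounded_linear[OF L \<phi>(1)])
  have 1: "L2_sq \<Omega> (\<lambda>x. L (u x) - L (\<phi> x)) \<le> K\<^sup>2 * L2_sq \<Omega> (\<lambda>x. u x - \<phi> x)"
    using square_integrable_bounded_linear(2)[OF L K(1) du(1)] by (simp add: lin)
  note sq2 = square_integrable_bounded_linear[OF bounded_linear_componentwise[OF L] norm_componentwise_le[OF K(1)] du(2)]
  have "L2_sq \<Omega> (gradient_error \<Omega> (\<lambda>x. L (u x)) (\<lambda>x. L (\<phi> x)))
      = L2_sq \<Omega> (\<lambda>x. \<chi> i. L ((weak_gradient \<Omega> u x - classical_gradient \<phi> x) $ i))"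
  proof (rule square_integrable_transfer_AE(2))
    show "square_integrable \<Omega> (gradient_error \<Omega> (\<lambda>x. L (u x)) (\<lambda>x. L (\<phi> x)))"
      by (rule H1_norm_diff_test_function(3)[OF \<Omega> Lu test])
    show "set_borel_measurable lebesgue \<Omega> (\<lambda>x. \<chi> i. L ((weak_gradient \<Omega> u x - classical_gradient \<phi> x) $ i))"
      using sq2(1) by (simp add: square_integrable_def)
    show "AE x\<in>\<Omega> in lebesgue. weak_gradient \<Omega> (\<lambda>x. L (u x)) x - classical_gradient (\<lambda>x. L (\<phi> x)) x
        = (\<chi> i. L ((weak_gradient \<Omega> u x - classical_gradient \<phi> x) $ i))"
      using weak_gradient_eq_AE[OF \<Omega> has_weak_gradient_bounded_linear[OF L H1D(2)[OF \<Omega> H1]]]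
      by eventually_elim
        (simp add: vec_eq_iff lin partial_deriv_bounded_linear[OF L smoothD(1)[OF test_functions_smooth[OF \<phi>(1)]]])
  qed
  with sq2(2)
  have 2: "L2_sq \<Omega> (gradient_error \<Omega> (\<lambda>x. L (u x)) (\<lambda>x. L (\<phi> x)))
      \<le> K\<^sup>2 * L2_sq \<Omega> (gradient_error \<Omega> u \<phi>)" by simp
  have "K\<^sup>2 * (L2_sq \<Omega> (\<lambda>x. u x - \<phi> x)
      + L2_sq \<Omega> (gradient_error \<Omega> u \<phi>)) < \<epsilon>"
    using \<phi>(2) K(2) by (simp add: pos_less_divide_eq mult.commute)
  then show "\<exists>\<psi>\<in>test_functions \<Omega>. L2_sq \<Omega> (\<lambda>x. L (u x) - \<psi> x)
      + L2_sq \<Omega> (gradient_error \<Omega> (\<lambda>x. L (u x)) \<psi>) < \<epsilon>"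
    using 1 2 by (intro bexI[OF _ test]) (simp add: distrib_left)
qed

lemma zero_in_H10:
  assumes "open \<Omega>"
  shows "(\<lambda>x. 0 :: 'a::{real_normed_field,euclidean_space}) \<in> H10 \<Omega>"
proof -
  note z = zero_in_test_functions[where 'a = 'a, of \<Omega>]
  have "H1_norm \<Omega> (\<lambda>x. 0 - 0 :: 'a) = 0"
  proof -
    have "has_weak_gradient \<Omega> (\<lambda>x. 0 :: 'a) (\<lambda>x. 0)"
      by (simp add: has_weak_gradient_def locally_integrable_def set_integrable_def)
    then have ae: "AE x\<in>\<Omega> in lebesgue. weak_gradient \<Omega> (\<lambda>x. 0 :: 'a) x = 0"
      by (rule weak_gradient_eq_AE[OF assms])
    have "L2_sq \<Omega> (\<lambda>x. weak_gradient \<Omega> (\<lambda>x. 0 :: 'a) x) = 0"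
      unfolding set_lebesgue_integral_def
      by (rule integral_eq_zero_AE) (use ae in \<open>eventually_elim, auto simp: indicator_def\<close>)
    then show ?thesis by (simp add: H1_norm_def)
  qed
  then show ?thesis
    using H1_test_function[OF assms z] by (auto simp: H10_def intro!: bexI[OF _ z])
qed

text \<open>
  Integrating the derivative of $x_1 |\varphi|^2$ in the first coordinate gives $\int |\varphi|^2
  = - \int 2 x_1\, \varphi \cdot \partial_1 \varphi$. As $|x_1| \le R$ on the support, Young's
  inequality absorbs half of the left-hand side.
\<close>

lemma Poincare_inequality:
  fixes \<phi> :: "real^2 \<Rightarrow> 'a::euclidean_space"
  assumes \<phi>: "\<phi> \<in> test_functions \<Omega>" and \<Omega>: "open \<Omega>" and R: "\<And>x. x \<in> \<Omega> \<Longrightarrow> norm x \<le> R"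
  shows "L2_sq \<Omega> \<phi> \<le> 4 * R\<^sup>2 * L2_sq \<Omega> (classical_gradient \<phi>)"
proof -
  let ?d = "\<lambda>x. partial_deriv 1 \<phi> x"
  have d_test: "?d \<in> test_functions \<Omega>" by (rule test_functions_partial_deriv[OF \<phi>])
  note s\<phi> = test_functions_smooth[OF \<phi>]
  have c: "continuous_on UNIV \<phi>" "continuous_on UNIV ?d"
    using s\<phi> smoothD(2) by (auto intro: smooth_continuous)
  have zero: "\<phi> x = 0" if "norm x > R" for x
    using test_functions_zero_outside[OF \<phi>] R that by (meson linorder_not_le)
  have int1: "integrable lebesgue (\<lambda>x. (norm (\<phi> x))\<^sup>2)"
    by (intro integrable_test_function_expression[OF \<phi>, of "\<lambda>y x. (norm y)\<^sup>2"] continuous_intros c) auto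
  have int2: "integrable lebesgue (\<lambda>x. (norm (?d x))\<^sup>2)"
    by (intro integrable_test_function_expression[OF d_test, of "\<lambda>y x. (norm y)\<^sup>2"] continuous_intros c) auto
  have int3: "integrable lebesgue (\<lambda>x. x $ 1 * (2 * (\<phi> x \<bullet> ?d x)))"
    by (intro integrable_test_function_expression[OF \<phi>, of "\<lambda>y x. x $ 1 * (2 * (y \<bullet> ?d x))"] continuous_intros c) auto
  have young: "- (x $ 1 * (2 * (\<phi> x \<bullet> ?d x))) \<le> (norm (\<phi> x))\<^sup>2 / 2 + 2 * R\<^sup>2 * (norm (?d x))\<^sup>2" for x
  proof (cases "norm x \<le> R")
    case True
    have "- (x $ 1 * (2 * (\<phi> x \<bullet> ?d x))) \<le> \<bar>x $ 1\<bar> * (2 * \<bar>\<phi> x \<bullet> ?d x\<bar>)"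
      by (rule order_trans[OF abs_ge_minus_self]) (simp only: abs_mult abs_numeral)
    also have "\<dots> \<le> R * (2 * (norm (\<phi> x) * norm (?d x)))"
      using order_trans[OF component_le_norm_cart[of x 1] True] Cauchy_Schwarz_ineq2[of "\<phi> x" "?d x"]
      by (intro mult_mono mult_left_mono) auto
    also have "\<dots> \<le> (norm (\<phi> x))\<^sup>2 / 2 + 2 * R\<^sup>2 * (norm (?d x))\<^sup>2"
      using zero_le_power2[of "norm (\<phi> x) - 2 * R * norm (?d x)"]
      by (simp add: power2_eq_square algebra_simps)
    finally show ?thesis .
  next
    case False
    then show ?thesis by (simp add: zero)
  qed
  have "integral\<^sup>L lebesgue (\<lambda>x. x $ 1 * (\<phi> x \<bullet> frechet_derivative \<phi> (at x) (axis 1 1) + frechet_derivative \<phi> (at x) (axis 1 1) \<bullet> \<phi> x)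
      + (axis 1 1 :: real^2) $ 1 * (\<phi> x \<bullet> \<phi> x)) = 0"
  proof (rule integral_directional_derivative_zero[where g = "\<lambda>x. x $ 1 * (\<phi> x \<bullet> \<phi> x)" and R = R and
          g' = "\<lambda>x h. x $ 1 * (\<phi> x \<bullet> frechet_derivative \<phi> (at x) h + frechet_derivative \<phi> (at x) h \<bullet> \<phi> x) + h $ 1 * (\<phi> x \<bullet> \<phi> x)"])
    show "((\<lambda>x. x $ 1 * (\<phi> x \<bullet> \<phi> x)) has_derivative (\<lambda>h. x $ 1 * (\<phi> x \<bullet> frechet_derivative \<phi> (at x) h
        + frechet_derivative \<phi> (at x) h \<bullet> \<phi> x) + h $ 1 * (\<phi> x \<bullet> \<phi> x))) (at x)" for x
      by (intro has_derivative_mult has_derivative_inner smooth_has_derivative[OF s\<phi>]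
          bounded_linear.has_derivative[OF bounded_linear_vec_nth has_derivative_ident])
    show "continuous_on UNIV (\<lambda>x. x $ 1 * (\<phi> x \<bullet> frechet_derivative \<phi> (at x) (axis 1 1)
        + frechet_derivative \<phi> (at x) (axis 1 1) \<bullet> \<phi> x) + (axis 1 1 :: real^2) $ 1 * (\<phi> x \<bullet> \<phi> x))"
      using c(2) unfolding partial_deriv_def by (intro continuous_intros c)
  qed (simp add: zero)
  then have "integral\<^sup>L lebesgue (\<lambda>x. x $ 1 * (2 * (\<phi> x \<bullet> ?d x)) + (norm (\<phi> x))\<^sup>2) = 0"
    by (simp add: partial_deriv_def inner_commute power2_norm_eq_inner axis_def)
  then have "integral\<^sup>L lebesgue (\<lambda>x. (norm (\<phi> x))\<^sup>2) = integral\<^sup>L lebesgue (\<lambda>x. - (x $ 1 * (2 * (\<phi> x \<bullet> ?d x))))"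
    using int1 int3 by simp
  also have "\<dots> \<le> integral\<^sup>L lebesgue (\<lambda>x. (norm (\<phi> x))\<^sup>2 / 2 + 2 * R\<^sup>2 * (norm (?d x))\<^sup>2)"
    using int1 int2 int3 young by (intro Bochner_Integration.integral_mono) auto
  also have "\<dots> = integral\<^sup>L lebesgue (\<lambda>x. (norm (\<phi> x))\<^sup>2) / 2 + 2 * R\<^sup>2 * integral\<^sup>L lebesgue (\<lambda>x. (norm (?d x))\<^sup>2)"
    using int1 int2 by simp
  finally have "integral\<^sup>L lebesgue (\<lambda>x. (norm (\<phi> x))\<^sup>2) \<le> 4 * R\<^sup>2 * integral\<^sup>L lebesgue (\<lambda>x. (norm (?d x))\<^sup>2)"
    by simp
  then have "L2_sq \<Omega> \<phi> \<le> 4 * R\<^sup>2 * L2_sq \<Omega> ?d"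
    using integral_test_function[OF \<phi>, of "\<lambda>y x. (norm y)\<^sup>2"] integral_test_function[OF d_test, of "\<lambda>y x. (norm y)\<^sup>2"]
    by simp
  also have "\<dots> \<le> 4 * R\<^sup>2 * L2_sq \<Omega> (classical_gradient \<phi>)"
  proof (intro mult_left_mono set_integral_mono)
    show "set_integrable lebesgue \<Omega> (\<lambda>x. (norm (?d x))\<^sup>2)"
      using square_integrable_test_function(1)[OF d_test \<Omega>] by (simp add: square_integrable_def)
    show "set_integrable lebesgue \<Omega> (\<lambda>x. (norm (classical_gradient \<phi> x))\<^sup>2)"
      using square_integrable_test_function(2)[OF \<phi> \<Omega>] by (simp add: square_integrable_def)
    show "(norm (?d x))\<^sup>2 \<le> (norm (classical_gradient \<phi> x))\<^sup>2" for x
      using Finite_Cartesian_Product.norm_nth_le[of "classical_gradient \<phi> x" 1] by (intro power_mono) auto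
  qed auto
  finally show ?thesis .
qed

text \<open>
  The Poincare inequality for test functions that approximate \<open>u\<close>: their gradients
  tend to 0 in $L^2$, hence so do they.
\<close>

lemma H10_eq_zero_if_gradient_zero:
  fixes u :: "real^2 \<Rightarrow> 'a::{real_normed_field,euclidean_space}"
  assumes \<Omega>: "open \<Omega>" "bounded \<Omega>" and u: "u \<in> H10 \<Omega>"
    and zero: "L2_sq \<Omega> (weak_gradient \<Omega> u) = 0"
  shows "AE x\<in>\<Omega> in lebesgue. u x = 0"
proof -
  obtain R where R: "\<And>x. x \<in> \<Omega> \<Longrightarrow> norm x \<le> R" using \<Omega>(2) by (auto simp: bounded_iff)
  have H1: "u \<in> H1 \<Omega>" using u by (simp add: H10_def)
  note u' = H1D[OF \<Omega>(1) H1]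
  define I where "I = L2_sq \<Omega> u"
  have "I \<le> 0"
  proof (rule field_le_epsilon)
    fix \<epsilon> :: real assume "\<epsilon> > 0"
    \<comment> \<open>$\int |u|^2 \le 2 \int |u - \varphi|^2 + 2 \int |\varphi|^2 \le 2\delta + 2 \cdot 4R^2 \cdot 2\delta$.\<close>
    define \<delta> where "\<delta> = \<epsilon> / (2 + 16 * R\<^sup>2)"
    have pos: "2 + 16 * R\<^sup>2 > 0" by (simp add: add_pos_nonneg)
    then have "\<delta> > 0" using \<open>\<epsilon> > 0\<close> by (simp add: \<delta>_def)
    then obtain \<phi> where \<phi>: "\<phi> \<in> test_functions \<Omega>" "L2_sq \<Omega> (\<lambda>x. u x - \<phi> x)
        + L2_sq \<Omega> (gradient_error \<Omega> u \<phi>) < \<delta>"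
      using u unfolding H10_iff[OF \<Omega>(1)] by blast
    note du = H1_norm_diff_test_function(2,3)[OF \<Omega>(1) H1 \<phi>(1)]
    note s\<phi> = square_integrable_test_function[OF \<phi>(1) \<Omega>(1)]
    have nonneg: "0 \<le> L2_sq \<Omega> f" for f :: "real^2 \<Rightarrow> 'b::real_normed_vector"
      unfolding set_lebesgue_integral_def by (intro Bochner_Integration.integral_nonneg) auto
    have "L2_sq \<Omega> (classical_gradient \<phi>)
        \<le> 2 * L2_sq \<Omega> (gradient_error \<Omega> u \<phi>)"
      using square_integrable_add(2)[OF u'(3) square_integrable_uminus[OF du(2)]] zero
      by (simp add: norm_minus_commute)
    then have "L2_sq \<Omega> (classical_gradient \<phi>) \<le> 2 * \<delta>"
      using \<phi>(2) nonneg[of "\<lambda>x. u x - \<phi> x"] by linarith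
    then have "4 * R\<^sup>2 * L2_sq \<Omega> (classical_gradient \<phi>) \<le> 4 * R\<^sup>2 * (2 * \<delta>)"
      by (intro mult_left_mono) auto
    then have "L2_sq \<Omega> \<phi> \<le> 8 * R\<^sup>2 * \<delta>"
      using order_trans[OF Poincare_inequality[OF \<phi>(1) \<Omega>(1) R]] by (simp add: mult_ac)
    moreover have "L2_sq \<Omega> (\<lambda>x. u x - \<phi> x) \<le> \<delta>"
      using \<phi>(2) nonneg[of "\<lambda>x. weak_gradient \<Omega> u x - classical_gradient \<phi> x"] by linarith
    moreover have "I \<le> 2 * L2_sq \<Omega> (\<lambda>x. u x - \<phi> x) + 2 * L2_sq \<Omega> \<phi>"
      using square_integrable_add(2)[OF du(1) s\<phi>(1)] by (simp add: I_def)
    ultimately have "I \<le> (2 + 16 * R\<^sup>2) * \<delta>" by (simp add: distrib_right)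
    then show "I \<le> 0 + \<epsilon>" using pos by (simp add: \<delta>_def)
  qed
  moreover have int: "integrable lebesgue (\<lambda>x. indicator \<Omega> x *\<^sub>R (norm (u x))\<^sup>2)"
    using u'(1) by (simp add: square_integrable_def set_integrable_def)
  moreover have "0 \<le> I" unfolding I_def set_lebesgue_integral_def by (intro Bochner_Integration.integral_nonneg) auto
  ultimately have "integral\<^sup>L lebesgue (\<lambda>x. indicator \<Omega> x *\<^sub>R (norm (u x))\<^sup>2) = 0"
    unfolding I_def set_lebesgue_integral_def by linarith
  then have "AE x in lebesgue. indicator \<Omega> x *\<^sub>R (norm (u x))\<^sup>2 = 0"
    by (subst integral_nonneg_eq_0_iff_AE[OF int, symmetric]) auto
  then show ?thesis by eventually_elim auto
qed

section \<open>Piecewise affine spaces\<close>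

lemma set_integrable_cong_on: "(\<And>x. x \<in> A \<Longrightarrow> f x = g x) \<Longrightarrow> set_integrable M A f = set_integrable M A g"
  unfolding set_integrable_def by (intro arg_cong[of _ _ "integrable M"] ext) (auto simp: indicator_def)

lemma set_integral_cong_on: "(\<And>x. x \<in> A \<Longrightarrow> f x = g x) \<Longrightarrow> (LINT x:A|M. f x) = (LINT x:A|M. g x)"
  unfolding set_lebesgue_integral_def by (intro arg_cong[of _ _ "integral\<^sup>L M"] ext) (auto simp: indicator_def)

lemma set_integral_sum:
  fixes f :: "nat \<Rightarrow> 'c \<Rightarrow> 'b::{banach, second_countable_topology}"
  assumes "\<And>i. i < n \<Longrightarrow> set_integrable M A (f i)"
  shows "set_integrable M A (\<lambda>x. \<Sum>i<n. f i x)"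
    and "(LINT x:A|M. \<Sum>i<n. f i x) = (\<Sum>i<n. (LINT x:A|M. f i x))"
proof -
  have "set_integrable M A (\<lambda>x. \<Sum>i<n. f i x) \<and>
      (LINT x:A|M. \<Sum>i<n. f i x) = (\<Sum>i<n. (LINT x:A|M. f i x))"
    using assms
  proof (induction n)
    case 0
    show ?case by (simp add: set_integrable_def)
  next
    case (Suc n)
    then have "set_integrable M A (\<lambda>x. \<Sum>i<n. f i x)" "set_integrable M A (f n)" by simp_all
    from set_integral_add[OF this] Suc show ?case by simp
  qed
  then show "set_integrable M A (\<lambda>x. \<Sum>i<n. f i x)"
    and "(LINT x:A|M. \<Sum>i<n. f i x) = (\<Sum>i<n. (LINT x:A|M. f i x))" by auto
qed

text \<open>
  The notions of weak gradient and of $H^1_0$ see a function only through its values on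
  \<open>\<Omega>\<close>. This permits normalising finite element functions to vanish off the
  closure.
\<close>

lemma has_weak_gradient_cong:
  assumes "\<And>x. x \<in> \<Omega> \<Longrightarrow> u x = v x"
  shows "has_weak_gradient \<Omega> u = has_weak_gradient \<Omega> v"
proof -
  have 1: "locally_integrable \<Omega> u = locally_integrable \<Omega> v"
    unfolding locally_integrable_def
    using assms by (intro all_cong imp_cong refl set_integrable_cong_on) auto
  have "(LINT x:\<Omega>|lebesgue. partial_deriv i \<phi> x *\<^sub>R u x) = (LINT x:\<Omega>|lebesgue. partial_deriv i \<phi> x *\<^sub>R v x)"
    for i and \<phi> :: "real^2 \<Rightarrow> real"
    using assms by (intro set_integral_cong_on) simp
  then show ?thesis unfolding has_weak_gradient_def fun_eq_iff 1 by simp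
qed

lemma weak_gradient_cong:
  "(\<And>x. x \<in> \<Omega> \<Longrightarrow> u x = v x) \<Longrightarrow> weak_gradient \<Omega> u = weak_gradient \<Omega> v"
  unfolding weak_gradient_def using has_weak_gradient_cong[of \<Omega> u v] by simp

lemma square_integrable_cong:
  assumes "\<And>x. x \<in> \<Omega> \<Longrightarrow> u x = v x"
  shows "square_integrable \<Omega> u = square_integrable \<Omega> v"
proof -
  have "(\<lambda>x. indicator \<Omega> x *\<^sub>R u x) = (\<lambda>x. indicator \<Omega> x *\<^sub>R v x)"
    by (rule ext) (use assms in \<open>auto simp: indicator_def\<close>)
  moreover have "set_integrable lebesgue \<Omega> (\<lambda>x. (norm (u x))\<^sup>2) = set_integrable lebesgue \<Omega> (\<lambda>x. (norm (v x))\<^sup>2)"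
    using assms by (intro set_integrable_cong_on) simp
  ultimately show ?thesis unfolding square_integrable_def set_borel_measurable_def by simp
qed

lemma H10_cong:
  assumes eq: "\<And>x. x \<in> \<Omega> \<Longrightarrow> u x = v x" and u: "u \<in> H10 \<Omega>"
  shows "v \<in> H10 \<Omega>"
proof -
  have "H1_norm \<Omega> (\<lambda>x. u x - \<phi> x) = H1_norm \<Omega> (\<lambda>x. v x - \<phi> x)" for \<phi>
    using eq weak_gradient_cong[of \<Omega> "\<lambda>x. u x - \<phi> x" "\<lambda>x. v x - \<phi> x"]
      set_integral_cong_on[of \<Omega> "\<lambda>x. (norm (u x - \<phi> x))\<^sup>2" "\<lambda>x. (norm (v x - \<phi> x))\<^sup>2"]
    by (simp add: H1_norm_def)
  then show ?thesis
    using u has_weak_gradient_cong[OF eq] square_integrable_cong[OF eq] by (simp add: H10_def H1_def)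
qed

lemma P1_space0_affine:
  assumes "u \<in> P1_space0 \<Omega> \<T>" "K \<in> \<T>"
  obtains c0 c1 c2 where "\<And>x. x \<in> K \<Longrightarrow> u x = c0 + c1 * of_real (x $ 1) + c2 * of_real (x $ 2)"
proof -
  have "\<exists>c0 c1 c2. \<forall>x\<in>K. u x = c0 + c1 * of_real (x $ 1) + c2 * of_real (x $ 2)"
    using assms by (simp add: P1_space0_def P1_space_def)
  then show thesis using that by (elim exE) (simp add: Ball_def)
qed

lemma P1_space0_cong:
  assumes eq: "\<And>x. x \<in> closure \<Omega> \<Longrightarrow> u x = v x" and \<T>: "\<Union>\<T> = closure \<Omega>" and u: "u \<in> P1_space0 \<Omega> \<T>"
  shows "v \<in> P1_space0 \<Omega> \<T>"
proof -
  have "v \<in> H10 \<Omega>"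
    using u by (intro H10_cong[of \<Omega> u v] eq) (auto simp: P1_space0_def intro: closure_subset[THEN subsetD])
  moreover have "continuous_on (closure \<Omega>) v"
    using u eq continuous_on_cong[OF refl, of "closure \<Omega>" u v] by (simp add: P1_space0_def P1_space_def)
  moreover have "\<exists>c0 c1 c2. \<forall>x\<in>K. v x = c0 + c1 * of_real (x $ 1) + c2 * of_real (x $ 2)" if "K \<in> \<T>" for K
  proof -
    obtain c0 c1 c2 where uK: "\<And>x. x \<in> K \<Longrightarrow> u x = c0 + c1 * of_real (x $ 1) + c2 * of_real (x $ 2)"
      by (rule P1_space0_affine[OF u \<open>K \<in> \<T>\<close>]) blast
    have "v x = c0 + c1 * of_real (x $ 1) + c2 * of_real (x $ 2)" if "x \<in> K" for x
      using eq[of x] uK[OF that] UnionI[OF \<open>K \<in> \<T>\<close> that] \<T> by simp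
    then show ?thesis by blast
  qed
  ultimately show ?thesis by (simp add: P1_space0_def P1_space_def)
qed

lemma P1_space0_add:
  assumes \<Omega>: "open \<Omega>" and u: "u \<in> P1_space0 \<Omega> \<T>" and v: "v \<in> P1_space0 \<Omega> \<T>"
  shows "(\<lambda>x. u x + v x) \<in> P1_space0 \<Omega> \<T>"
proof -
  have "\<exists>c0 c1 c2. \<forall>x\<in>K. u x + v x = c0 + c1 * of_real (x $ 1) + c2 * of_real (x $ 2)" if "K \<in> \<T>" for K
  proof -
    obtain c0 c1 c2 where uK: "\<And>x. x \<in> K \<Longrightarrow> u x = c0 + c1 * of_real (x $ 1) + c2 * of_real (x $ 2)"
      by (rule P1_space0_affine[OF u \<open>K \<in> \<T>\<close>]) blast
    obtain d0 d1 d2 where vK: "\<And>x. x \<in> K \<Longrightarrow> v x = d0 + d1 * of_real (x $ 1) + d2 * of_real (x $ 2)"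
      by (rule P1_space0_affine[OF v \<open>K \<in> \<T>\<close>]) blast
    have "\<forall>x\<in>K. u x + v x = (c0 + d0) + (c1 + d1) * of_real (x $ 1) + (c2 + d2) * of_real (x $ 2)"
      by (simp add: uK vK algebra_simps)
    then show ?thesis by blast
  qed
  then show ?thesis
    using u v H10_add[OF \<Omega>] by (auto simp: P1_space0_def P1_space_def intro: continuous_on_add)
qed

text \<open>
  Besides scalar multiples this covers multiplication by the imaginary unit.
\<close>

lemma P1_space0_bounded_linear:
  fixes L :: "'a::{real_normed_field,euclidean_space} \<Rightarrow> 'a"
  assumes \<Omega>: "open \<Omega>" and L: "bounded_linear L" and u: "u \<in> P1_space0 \<Omega> \<T>"
  shows "(\<lambda>x. L (u x)) \<in> P1_space0 \<Omega> \<T>"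
proof -
  note lin = bounded_linear.linear[OF L]
  have L_of_real: "L (c * of_real r) = L c * of_real r" for c r
    using linear_scale[OF lin, of r c] by (simp add: scaleR_conv_of_real mult.commute)
  have "\<exists>c0 c1 c2. \<forall>x\<in>K. L (u x) = c0 + c1 * of_real (x $ 1) + c2 * of_real (x $ 2)" if "K \<in> \<T>" for K
  proof -
    obtain c0 c1 c2 where uK: "\<And>x. x \<in> K \<Longrightarrow> u x = c0 + c1 * of_real (x $ 1) + c2 * of_real (x $ 2)"
      by (rule P1_space0_affine[OF u \<open>K \<in> \<T>\<close>]) blast
    have "\<forall>x\<in>K. L (u x) = L c0 + L c1 * of_real (x $ 1) + L c2 * of_real (x $ 2)"
      by (simp add: uK linear_add[OF lin] L_of_real)
    then show ?thesis by blast
  qed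
  then show ?thesis
    using u H10_bounded_linear[OF \<Omega> L]
    by (auto simp: P1_space0_def P1_space_def intro: bounded_linear.continuous_on[OF L])
qed

lemma zero_in_P1_space0: "open \<Omega> \<Longrightarrow> (\<lambda>x. 0) \<in> P1_space0 \<Omega> \<T>"
  using zero_in_H10 by (auto simp: P1_space0_def P1_space_def intro!: exI[of _ 0])

lemma P1_space0_H1: "u \<in> P1_space0 \<Omega> \<T> \<Longrightarrow> u \<in> H1 \<Omega>"
  by (simp add: P1_space0_def H10_def)

lemma P1_space0_continuous: "u \<in> P1_space0 \<Omega> \<T> \<Longrightarrow> continuous_on (closure \<Omega>) u"
  by (simp add: P1_space0_def P1_space_def)

lemma P1_space0_sum:
  assumes \<Omega>: "open \<Omega>" and b: "\<And>i. i < n \<Longrightarrow> b i \<in> P1_space0 \<Omega> \<T>"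
  shows "(\<lambda>x. \<Sum>i<(n::nat). c i *\<^sub>R b i x) \<in> P1_space0 \<Omega> \<T>"
    and "AE x\<in>\<Omega> in lebesgue.
      weak_gradient \<Omega> (\<lambda>x. \<Sum>i<n. c i *\<^sub>R b i x) x = (\<Sum>i<n. c i *\<^sub>R weak_gradient \<Omega> (b i) x)"
proof -
  have "(\<lambda>x. \<Sum>i<n. c i *\<^sub>R b i x) \<in> P1_space0 \<Omega> \<T> \<and>
      has_weak_gradient \<Omega> (\<lambda>x. \<Sum>i<n. c i *\<^sub>R b i x) (\<lambda>x. \<Sum>i<n. c i *\<^sub>R weak_gradient \<Omega> (b i) x)"
    using b
  proof (induction n)
    case 0
    show ?case
      using zero_in_P1_space0[OF \<Omega>]
      by (simp add: has_weak_gradient_def locally_integrable_def set_integrable_def)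
  next
    case (Suc n)
    note s = bounded_linear_scaleR_right[of "c n"]
    have "has_weak_gradient \<Omega> (\<lambda>x. c n *\<^sub>R b n x) (\<lambda>x. c n *\<^sub>R weak_gradient \<Omega> (b n) x)"
      using has_weak_gradient_bounded_linear[OF s H1D(2)[OF \<Omega> P1_space0_H1[OF Suc.prems[of n]]]]
      by (simp add: scaleR_vec_def)
    moreover have IH: "(\<lambda>x. \<Sum>i<n. c i *\<^sub>R b i x) \<in> P1_space0 \<Omega> \<T>"
      "has_weak_gradient \<Omega> (\<lambda>x. \<Sum>i<n. c i *\<^sub>R b i x) (\<lambda>x. \<Sum>i<n. c i *\<^sub>R weak_gradient \<Omega> (b i) x)"
      using Suc by simp_all
    ultimately show ?case
      using P1_space0_add[OF \<Omega> IH(1) P1_space0_bounded_linear[OF \<Omega> s Suc.prems[of n]]]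
        has_weak_gradient_add[OF IH(2)] by simp
  qed
  then show "(\<lambda>x. \<Sum>i<n. c i *\<^sub>R b i x) \<in> P1_space0 \<Omega> \<T>"
    and "AE x\<in>\<Omega> in lebesgue.
      weak_gradient \<Omega> (\<lambda>x. \<Sum>i<n. c i *\<^sub>R b i x) x = (\<Sum>i<n. c i *\<^sub>R weak_gradient \<Omega> (b i) x)"
    using weak_gradient_eq_AE[OF \<Omega>] by auto
qed

text \<open>
  For complex functions this is the real part of the Hermitian Dirichlet form.
\<close>

definition dirichlet_form ::
  "(real^2) set \<Rightarrow> (real^2 \<Rightarrow> 'a::{real_normed_field,euclidean_space}) \<Rightarrow> (real^2 \<Rightarrow> 'a) \<Rightarrow> real" where
  "dirichlet_form \<Omega> u v = (LINT x:\<Omega>|lebesgue. weak_gradient \<Omega> u x \<bullet> weak_gradient \<Omega> v x)"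

lemma set_integral_transfer_AE:
  fixes f g :: "'c::euclidean_space \<Rightarrow> 'b::{banach, second_countable_topology}"
  assumes "set_integrable lebesgue \<Omega> f" "set_integrable lebesgue \<Omega> g" "AE x\<in>\<Omega> in lebesgue. f x = g x"
  shows "(LINT x:\<Omega>|lebesgue. f x) = (LINT x:\<Omega>|lebesgue. g x)"
  unfolding set_lebesgue_integral_def
proof (rule integral_cong_AE)
  show "AE x in lebesgue. indicator \<Omega> x *\<^sub>R f x = indicator \<Omega> x *\<^sub>R g x"
    using assms(3) by eventually_elim (auto simp: indicator_def)
qed (use assms(1,2) in \<open>auto simp: set_integrable_def\<close>)

lemma dirichlet_form_commute: "dirichlet_form \<Omega> u v = dirichlet_form \<Omega> v u"
  by (simp add: dirichlet_form_def inner_commute)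

lemma dirichlet_form_integrable:
  "\<lbrakk>open \<Omega>; u \<in> H1 \<Omega>; v \<in> H1 \<Omega>\<rbrakk> \<Longrightarrow> set_integrable lebesgue \<Omega> (\<lambda>x. weak_gradient \<Omega> u x \<bullet> weak_gradient \<Omega> v x)"
  by (intro square_integrable_inner H1D(3))

lemma dirichlet_form_sum_left:
  assumes \<Omega>: "open \<Omega>" and b: "\<And>i. i < n \<Longrightarrow> b i \<in> P1_space0 \<Omega> \<T>" and w: "w \<in> H1 \<Omega>"
  shows "dirichlet_form \<Omega> (\<lambda>x. \<Sum>i<(n::nat). c i *\<^sub>R b i x) w = (\<Sum>i<n. c i * dirichlet_form \<Omega> (b i) w)"
proof -
  have int: "set_integrable lebesgue \<Omega> (\<lambda>x. c i * (weak_gradient \<Omega> (b i) x \<bullet> weak_gradient \<Omega> w x))"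
    if "i < n" for i
    using dirichlet_form_integrable[OF \<Omega> P1_space0_H1[OF b[OF that]] w] by simp
  have "dirichlet_form \<Omega> (\<lambda>x. \<Sum>i<n. c i *\<^sub>R b i x) w
      = (LINT x:\<Omega>|lebesgue. \<Sum>i<n. c i * (weak_gradient \<Omega> (b i) x \<bullet> weak_gradient \<Omega> w x))"
    unfolding dirichlet_form_def
  proof (rule set_integral_transfer_AE)
    show "set_integrable lebesgue \<Omega> (\<lambda>x. weak_gradient \<Omega> (\<lambda>x. \<Sum>i<n. c i *\<^sub>R b i x) x \<bullet> weak_gradient \<Omega> w x)"
      by (rule dirichlet_form_integrable[OF \<Omega> P1_space0_H1[OF P1_space0_sum(1)[OF \<Omega> b]] w])
    show "set_integrable lebesgue \<Omega> (\<lambda>x. \<Sum>i<n. c i * (weak_gradient \<Omega> (b i) x \<bullet> weak_gradient \<Omega> w x))"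
      using int by (rule set_integral_sum(1))
    show "AE x\<in>\<Omega> in lebesgue. weak_gradient \<Omega> (\<lambda>x. \<Sum>i<n. c i *\<^sub>R b i x) x \<bullet> weak_gradient \<Omega> w x
        = (\<Sum>i<n. c i * (weak_gradient \<Omega> (b i) x \<bullet> weak_gradient \<Omega> w x))"
    proof -
      have "AE x\<in>\<Omega> in lebesgue.
          weak_gradient \<Omega> (\<lambda>x. \<Sum>i<n. c i *\<^sub>R b i x) x = (\<Sum>i<n. c i *\<^sub>R weak_gradient \<Omega> (b i) x)"
        by (rule P1_space0_sum(2)[OF \<Omega> b])
      then show ?thesis by eventually_elim (simp add: inner_sum_left)
    qed
  qed
  also have "\<dots> = (\<Sum>i<n. c i * dirichlet_form \<Omega> (b i) w)"
    by (subst set_integral_sum(2)) (use int in \<open>simp_all add: dirichlet_form_def\<close>)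
  finally show ?thesis .
qed

lemma dirichlet_form_orthonormal:
  assumes \<Omega>: "open \<Omega>" and b: "\<And>i. i < n \<Longrightarrow> b i \<in> P1_space0 \<Omega> \<T>"
    and orth: "\<And>i j. \<lbrakk>i < n; j < n\<rbrakk> \<Longrightarrow> dirichlet_form \<Omega> (b i) (b j) = (if i = j then 1 else 0)"
    and v: "\<And>x. x \<in> \<Omega> \<Longrightarrow> v x = (\<Sum>i<(n::nat). c i *\<^sub>R b i x)"
  shows "dirichlet_form \<Omega> (\<lambda>x. \<Sum>i<n. z i *\<^sub>R b i x) v = (\<Sum>i<n. c i * z i)" (is "dirichlet_form \<Omega> ?u v = _")
proof -
  have u: "?u \<in> H1 \<Omega>" by (rule P1_space0_H1[OF P1_space0_sum(1)[OF \<Omega> b]])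
  have "dirichlet_form \<Omega> ?u v = dirichlet_form \<Omega> (\<lambda>x. \<Sum>i<n. c i *\<^sub>R b i x) ?u"
    unfolding dirichlet_form_def using weak_gradient_cong[of \<Omega> v, OF v] by (simp add: inner_commute)
  also have "\<dots> = (\<Sum>i<n. c i * dirichlet_form \<Omega> (b i) ?u)"
    by (rule dirichlet_form_sum_left[OF \<Omega> b u])
  also have "\<dots> = (\<Sum>i<n. c i * z i)"
  proof (rule sum.cong[OF refl])
    fix i assume "i \<in> {..<n}"
    then have i: "i < n" by simp
    have "dirichlet_form \<Omega> (b i) ?u = (\<Sum>j<n. z j * dirichlet_form \<Omega> (b j) (b i))"
      unfolding dirichlet_form_commute[of \<Omega> "b i"]
      by (rule dirichlet_form_sum_left[OF \<Omega> b P1_space0_H1[OF b[OF i]]])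
    also have "\<dots> = (\<Sum>j<n. if j = i then z j else 0)"
      by (intro sum.cong) (auto simp: orth i)
    finally show "c i * dirichlet_form \<Omega> (b i) ?u = c i * z i" using i by simp
  qed
  finally show ?thesis .
qed

text \<open>
  The spanning functions are the affine monomials on single triangles. A point on a common edge of
  several triangles is assigned to one of them by choice, so that the decomposition is an exact
  identity of functions; the spanning functions may be discontinuous.
\<close>

lemma P1_spanning_set:
  assumes "finite \<T>" and \<T>: "\<Union>\<T> = closure \<Omega>"
  shows "\<exists>(S :: ((real^2) set \<times> nat \<times> 'a) set)
      (e :: (real^2) set \<times> nat \<times> 'a \<Rightarrow> real^2 \<Rightarrow> 'a::{real_normed_field,euclidean_space}). finite S \<and>
    (\<forall>v \<in> P1_space0 \<Omega> \<T>. (\<forall>x. x \<notin> closure \<Omega> \<longrightarrow> v x = 0) \<longrightarrow> (\<exists>c. \<forall>x. v x = (\<Sum>s\<in>S. c s *\<^sub>R e s x)))"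
proof -
  define \<kappa> where "\<kappa> x = (SOME K. K \<in> \<T> \<and> x \<in> K)" for x
  have \<kappa>: "\<kappa> x \<in> \<T>" "x \<in> \<kappa> x" if "x \<in> closure \<Omega>" for x
  proof -
    have "\<exists>K. K \<in> \<T> \<and> x \<in> K" using that \<T> by blast
    from someI_ex[OF this] show "\<kappa> x \<in> \<T>" "x \<in> \<kappa> x" by (simp_all add: \<kappa>_def)
  qed
  define m where "m k x = (if k = 0 then 1 else if k = 1 then x $ 1 else x $ 2)" for k :: nat and x :: "real^2"
  define e where "e = (\<lambda>(K, k, b :: 'a) x. if x \<in> closure \<Omega> \<and> \<kappa> x = K then m k x *\<^sub>R b else 0)"
  define S where "S = \<T> \<times> {..<3::nat} \<times> (Basis :: 'a set)"
  have "\<exists>c. \<forall>x. v x = (\<Sum>s\<in>S. c s *\<^sub>R e s x)"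
    if v: "v \<in> P1_space0 \<Omega> \<T>" and out: "\<forall>x. x \<notin> closure \<Omega> \<longrightarrow> v x = 0" for v :: "real^2 \<Rightarrow> 'a"
  proof -
    have "\<forall>K\<in>\<T>. \<exists>C. \<forall>x\<in>K. v x = (\<Sum>k<3. m k x *\<^sub>R C k)"
    proof
      fix K assume "K \<in> \<T>"
      with v obtain c0 c1 c2
        where vK: "\<And>x. x \<in> K \<Longrightarrow> v x = c0 + c1 * of_real (x $ 1) + c2 * of_real (x $ 2)"
        by (rule P1_space0_affine) blast
      have "\<forall>x\<in>K. v x = (\<Sum>k<3. m k x *\<^sub>R (if k = 0 then c0 else if k = 1 then c1 else c2))"
        by (simp add: vK m_def eval_nat_numeral scaleR_conv_of_real mult.commute)
      then show "\<exists>C. \<forall>x\<in>K. v x = (\<Sum>k<3. m k x *\<^sub>R C k)"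
        by (intro exI[of _ "\<lambda>k. if k = 0 then c0 else if k = 1 then c1 else c2"])
    qed
    then obtain C where C: "\<And>K x. K \<in> \<T> \<Longrightarrow> x \<in> K \<Longrightarrow> v x = (\<Sum>k<3. m k x *\<^sub>R C K k)"
      by metis
    have "v x = (\<Sum>s\<in>S. (case s of (K, k, b) \<Rightarrow> C K k \<bullet> b) *\<^sub>R e s x)" for x
    proof (cases "x \<in> closure \<Omega>")
      case True
      have "(\<Sum>s\<in>S. (case s of (K, k, b) \<Rightarrow> C K k \<bullet> b) *\<^sub>R e s x)
          = (\<Sum>K\<in>\<T>. \<Sum>k<3. \<Sum>b\<in>Basis. (C K k \<bullet> b) *\<^sub>R e (K, k, b) x)"
        unfolding S_def sum.cartesian_product[symmetric] by (simp add: sum.cartesian_product case_prod_beta)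
      also have "\<dots> = (\<Sum>K\<in>\<T>. if \<kappa> x = K then v x else 0)"
      proof (rule sum.cong[OF refl])
        fix K assume K: "K \<in> \<T>"
        show "(\<Sum>k<3. \<Sum>b\<in>Basis. (C K k \<bullet> b) *\<^sub>R e (K, k, b) x) = (if \<kappa> x = K then v x else 0)"
        proof (cases "\<kappa> x = K")
          case 1: True
          have "(\<Sum>b\<in>Basis. (C K k \<bullet> b) *\<^sub>R e (K, k, b) x) = m k x *\<^sub>R C K k" for k
          proof -
            have "(\<Sum>b\<in>Basis. (C K k \<bullet> b) *\<^sub>R e (K, k, b) x) = (\<Sum>b\<in>Basis. m k x *\<^sub>R (C K k \<bullet> b) *\<^sub>R b)"
              using 1 True by (simp add: e_def mult.commute)
            also have "\<dots> = m k x *\<^sub>R C K k"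
              by (simp only: scaleR_sum_right[symmetric] euclidean_representation)
            finally show ?thesis .
          qed
          then show ?thesis using 1 C[OF K, of x] \<kappa>(2)[OF True] by simp
        qed (simp add: e_def)
      qed
      also have "\<dots> = v x" using \<open>finite \<T>\<close> \<kappa>(1)[OF True] by simp
      finally show ?thesis by simp
    next
      case False
      then show ?thesis using out by (simp add: e_def case_prod_beta)
    qed
    then show ?thesis by blast
  qed
  moreover have "finite S" using \<open>finite \<T>\<close> by (simp add: S_def)
  ultimately show ?thesis by (intro exI[of _ S] exI[of _ e] conjI ballI impI)
qed

text \<open>
  Positive definiteness of the Dirichlet form is the point: a piecewise affine function in $H^1_0$
  with zero gradient vanishes almost everywhere, hence everywhere on the closure by continuity.
\<close>

lemma P1_space0_orthonormal_basis:
  fixes \<Omega> :: "(real^2) set"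
  assumes \<Omega>: "open \<Omega>" "bounded \<Omega>" and fin: "finite \<T>" and \<T>: "\<Union>\<T> = closure \<Omega>"
  obtains n :: nat and b :: "nat \<Rightarrow> real^2 \<Rightarrow> 'a::{real_normed_field,euclidean_space}"
  where "\<And>i. i < n \<Longrightarrow> b i \<in> P1_space0 \<Omega> \<T>"
    "\<And>i j. \<lbrakk>i < n; j < n\<rbrakk> \<Longrightarrow> dirichlet_form \<Omega> (b i) (b j) = (if i = j then 1 else 0)"
    "\<And>v. v \<in> P1_space0 \<Omega> \<T> \<Longrightarrow> \<exists>c. \<forall>x\<in>closure \<Omega>. v x = (\<Sum>i<n. c i *\<^sub>R b i x)"
proof -
  define V :: "(real^2 \<Rightarrow> 'a) set" where "V = {v \<in> P1_space0 \<Omega> \<T>. \<forall>x. x \<notin> closure \<Omega> \<longrightarrow> v x = 0}"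
  obtain S :: "((real^2) set \<times> nat \<times> 'a) set" and e :: "(real^2) set \<times> nat \<times> 'a \<Rightarrow> real^2 \<Rightarrow> 'a"
    where S: "finite S"
    "\<And>v. v \<in> V \<Longrightarrow> \<exists>c. \<forall>x. v x = (\<Sum>s\<in>S. c s *\<^sub>R e s x)"
  proof -
    obtain S :: "((real^2) set \<times> nat \<times> 'a) set" and e :: "(real^2) set \<times> nat \<times> 'a \<Rightarrow> real^2 \<Rightarrow> 'a" where Se: "finite S \<and>
      (\<forall>v \<in> P1_space0 \<Omega> \<T>. (\<forall>x. x \<notin> closure \<Omega> \<longrightarrow> v x = 0) \<longrightarrow> (\<exists>c. \<forall>x. v x = (\<Sum>s\<in>S. c s *\<^sub>R e s x)))"
      using P1_spanning_set[OF fin \<T>, where 'a = 'a] by (elim exE) (rule that)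
    show ?thesis by (rule that[of S e]) (use Se in \<open>simp_all add: V_def\<close>)
  qed
  have comb: "dirichlet_form \<Omega> (\<lambda>x. \<Sum>i<k. c i *\<^sub>R f i x) w = (\<Sum>i<k. c i * dirichlet_form \<Omega> (f i) w)"
    if "\<And>i. i < k \<Longrightarrow> f i \<in> V" "w \<in> V" for k :: nat and c f w
    by (rule dirichlet_form_sum_left[OF \<Omega>(1)]) (use that P1_space0_H1 in \<open>auto simp: V_def\<close>)
  have "\<exists>n b. (\<forall>i<n. b i \<in> V) \<and> (\<forall>i<n. \<forall>j<n. dirichlet_form \<Omega> (b i) (b j) = (if i = j then 1 else 0)) \<and>
      (\<forall>v\<in>V. \<exists>c. v = (\<lambda>x. \<Sum>i<(n::nat). c i *\<^sub>R b i x))"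
  proof (rule orthonormal_basis_of_function_space[OF S])
    show "(\<lambda>x. 0) \<in> V" using zero_in_P1_space0[OF \<Omega>(1)] by (simp add: V_def)
    show "(\<lambda>x. u x + v x) \<in> V" if "u \<in> V" "v \<in> V" for u v
      using that P1_space0_add[OF \<Omega>(1), of u \<T> v] by (simp add: V_def)
    show "(\<lambda>x. c *\<^sub>R v x) \<in> V" if "v \<in> V" for c v
      using that P1_space0_bounded_linear[OF \<Omega>(1) bounded_linear_scaleR_right[of c], of v \<T>] by (simp add: V_def)
    show "dirichlet_form \<Omega> u v = dirichlet_form \<Omega> v u" for u v :: "real^2 \<Rightarrow> 'a" by (rule dirichlet_form_commute)
    show "dirichlet_form \<Omega> (\<lambda>x. u x + v x) w = dirichlet_form \<Omega> u w + dirichlet_form \<Omega> v w"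
      if "u \<in> V" "v \<in> V" "w \<in> V" for u v w
      using comb[of 2 "\<lambda>i. if i = 0 then u else v" w "\<lambda>i. 1"] that by (simp add: eval_nat_numeral)
    show "dirichlet_form \<Omega> (\<lambda>x. c *\<^sub>R u x) w = c * dirichlet_form \<Omega> u w" if "u \<in> V" "w \<in> V" for c u w
      using comb[of 1 "\<lambda>i. u" w "\<lambda>i. c"] that by simp
    show "0 < dirichlet_form \<Omega> v v" if v: "v \<in> V" and "v \<noteq> (\<lambda>x. 0)" for v
    proof (rule ccontr)
      assume neg: "\<not> 0 < dirichlet_form \<Omega> v v"
      have vP: "v \<in> P1_space0 \<Omega> \<T>" using v by (simp add: V_def)
      have sq: "dirichlet_form \<Omega> v v = (LINT x:\<Omega>|lebesgue. (norm (weak_gradient \<Omega> v x))\<^sup>2)"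
        by (simp add: dirichlet_form_def power2_norm_eq_inner)
      have "0 \<le> dirichlet_form \<Omega> v v"
        unfolding sq set_lebesgue_integral_def by (intro Bochner_Integration.integral_nonneg) auto
      then have "(LINT x:\<Omega>|lebesgue. (norm (weak_gradient \<Omega> v x))\<^sup>2) = 0" using neg sq by linarith
      then have ae: "AE x\<in>\<Omega> in lebesgue. v x = 0"
        using vP by (intro H10_eq_zero_if_gradient_zero[OF \<Omega>]) (simp_all add: P1_space0_def)
      have cont: "continuous_on (closure \<Omega>) v" by (rule P1_space0_continuous[OF vP])
      have "v x = 0" if "x \<in> \<Omega>" for x
      proof (rule ccontr)
        assume "v x \<noteq> 0"
        define W where "W = {y \<in> \<Omega>. v y \<noteq> 0}"
        have "open W"
          using continuous_open_preimage[OF continuous_on_subset[OF cont closure_subset] \<Omega>(1), of "- {0}"]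
          by (simp add: W_def vimage_def Int_def open_Compl)
        have "AE y in lebesgue. y \<in> - W" using ae by eventually_elim (auto simp: W_def)
        then have "x \<in> - W" using mem_closed_if_AE_lebesgue[of "- W" x] \<open>open W\<close> by (simp add: closed_Compl)
        then show False using \<open>v x \<noteq> 0\<close> that by (simp add: W_def)
      qed
      then have "v x = 0" if "x \<in> closure \<Omega>" for x
        using continuous_constant_on_closure[OF cont] that by blast
      then have "v = (\<lambda>x. 0)" using v by (auto simp: V_def)
      then show False using \<open>v \<noteq> (\<lambda>x. 0)\<close> by simp
    qed
  qed
  then obtain n b where nb: "(\<forall>i<n. b i \<in> V) \<and> (\<forall>i<n. \<forall>j<n. dirichlet_form \<Omega> (b i) (b j) = (if i = j then 1 else 0)) \<and>
      (\<forall>v\<in>V. \<exists>c. v = (\<lambda>x. \<Sum>i<(n::nat). c i *\<^sub>R b i x))"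
    by (elim exE) (rule that)
  show thesis
  proof (rule that[of n b])
    fix v :: "real^2 \<Rightarrow> 'a" assume v: "v \<in> P1_space0 \<Omega> \<T>"
    define v' where "v' = (\<lambda>x. if x \<in> closure \<Omega> then v x else 0)"
    have "v' \<in> P1_space0 \<Omega> \<T>" by (rule P1_space0_cong[OF _ \<T> v]) (simp add: v'_def)
    then have "v' \<in> V" by (simp add: V_def v'_def)
    then obtain c where "v' = (\<lambda>x. \<Sum>i<n. c i *\<^sub>R b i x)" using nb by blast
    then have "v' x = (\<Sum>i<n. c i *\<^sub>R b i x)" for x by (rule fun_cong)
    then show "\<exists>c. \<forall>x\<in>closure \<Omega>. v x = (\<Sum>i<n. c i *\<^sub>R b i x)"
      unfolding v'_def by (metis (full_types))
  qed (use nb in \<open>auto simp: V_def\<close>)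
qed

section \<open>The discrete problem\<close>

lemma set_integrable_continuous_closure:
  fixes f :: "'c::euclidean_space \<Rightarrow> 'b::euclidean_space"
  assumes "open \<Omega>" "bounded \<Omega>" "continuous_on (closure \<Omega>) f"
  shows "set_integrable lebesgue \<Omega> f"
proof (rule set_integrable_subset[of _ "closure \<Omega>"])
  show "set_integrable lebesgue (closure \<Omega>) f"
    using borel_integrable_compact[of "closure \<Omega>" f] assms
    by (simp add: set_integrable_def integrable_completion borel_measurable_integrable compact_closure)
qed (use assms(1) closure_subset in auto)

lemma set_integrable_mult_continuous_closure:
  fixes f \<phi> :: "'c::euclidean_space \<Rightarrow> real"
  assumes \<Omega>: "open \<Omega>" "bounded \<Omega>" and f: "set_integrable lebesgue \<Omega> f" and \<phi>: "continuous_on (closure \<Omega>) \<phi>"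
  shows "set_integrable lebesgue \<Omega> (\<lambda>x. f x * \<phi> x)"
proof -
  have "bounded (\<phi> ` closure \<Omega>)"
    by (rule compact_imp_bounded[OF compact_continuous_image[OF \<phi>]]) (simp add: compact_closure \<Omega>)
  then obtain b where b: "b > 0" "\<forall>x\<in>closure \<Omega>. \<bar>\<phi> x\<bar> \<le> b" by (auto simp: bounded_pos)
  show ?thesis
  proof (rule set_integrable_bound)
    show "set_integrable lebesgue \<Omega> (\<lambda>x. f x * b)" using f by simp
    have "(\<lambda>x. (indicator \<Omega> x *\<^sub>R f x) * (indicator \<Omega> x *\<^sub>R \<phi> x)) \<in> borel_measurable lebesgue"
      using f set_integrable_continuous_closure[OF \<Omega> \<phi>]
      by (intro borel_measurable_times) (simp_all add: set_integrable_def borel_measurable_integrable)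
    moreover have "(indicator \<Omega> x *\<^sub>R f x) * (indicator \<Omega> x *\<^sub>R \<phi> x) = indicator \<Omega> x *\<^sub>R (f x * \<phi> x)" for x
      by (cases "x \<in> \<Omega>") auto
    ultimately show "set_borel_measurable lebesgue \<Omega> (\<lambda>x. f x * \<phi> x)"
      by (simp only: set_borel_measurable_def)
    have "\<bar>f x * \<phi> x\<bar> \<le> \<bar>f x * b\<bar>" if "x \<in> \<Omega>" for x
    proof -
      have "\<bar>\<phi> x\<bar> \<le> b" using b(2) closure_subset that by blast
      then show ?thesis using b(1) by (simp add: abs_mult mult_left_mono)
    qed
    then show "AE x\<in>\<Omega> in lebesgue. norm (f x * \<phi> x) \<le> norm (f x * b)" by simp
  qed
qed

lemma H1_add_const:
  fixes u :: "real^2 \<Rightarrow> 'a::{real_normed_field,euclidean_space}"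
  assumes \<Omega>: "open \<Omega>" "bounded \<Omega>" and u: "u \<in> H1 \<Omega>"
  shows "(\<lambda>x. u x + c) \<in> H1 \<Omega>"
    and "AE x\<in>\<Omega> in lebesgue. weak_gradient \<Omega> (\<lambda>x. u x + c) x = weak_gradient \<Omega> u x"
proof -
  note u' = H1D[OF \<Omega>(1) u]
  have "partial_deriv i (\<lambda>x. c) = (\<lambda>x. 0)" for i
    by (rule ext) (subst partial_deriv_eqI, auto)
  then have "has_weak_gradient \<Omega> (\<lambda>x. c) (\<lambda>x. 0)"
    using has_weak_gradient_smooth[OF smooth_const, of \<Omega> c] by (simp add: zero_vec_def)
  from has_weak_gradient_add[OF u'(2) this]
  have w: "has_weak_gradient \<Omega> (\<lambda>x. u x + c) (weak_gradient \<Omega> u)" by simp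
  then show "AE x\<in>\<Omega> in lebesgue. weak_gradient \<Omega> (\<lambda>x. u x + c) x = weak_gradient \<Omega> u x"
    by (rule weak_gradient_eq_AE[OF \<Omega>(1)])
  have "square_integrable \<Omega> (\<lambda>x. c)"
    using set_integrable_continuous_closure[OF \<Omega>, of "\<lambda>x. c"]
      set_integrable_continuous_closure[OF \<Omega>, of "\<lambda>x. (norm c)\<^sup>2"]
    by (simp add: square_integrable_def set_borel_measurable_def set_integrable_def borel_measurable_integrable)
  then show "(\<lambda>x. u x + c) \<in> H1 \<Omega>"
    by (intro H1I[OF square_integrable_add(1)[OF u'(1)] w u'(3)])
qed

lemma set_integral_Complex:
  assumes a: "set_integrable M A a" and b: "set_integrable M A b"
  shows "(LINT x:A|M. Complex (a x) (b x)) = Complex (LINT x:A|M. a x) (LINT x:A|M. b x)"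
proof -
  have "set_integrable M A (\<lambda>x. complex_of_real (a x))" "set_integrable M A (\<lambda>x. \<i> * complex_of_real (b x))"
    using set_integrable_bounded_linear[OF bounded_linear_of_real a] set_integrable_bounded_linear[OF bounded_linear_of_real b]
    by simp_all
  then show ?thesis
    unfolding Complex_eq by (simp add: set_integral_complex_of_real)
qed

text \<open>
  The Hermitian product consists of two real inner products, the second against
  \<open>\<i>\<close> times the second factor. Thus an equation with Hermitian products follows
  from its real part, tested with \<open>Q\<close> and with \<open>\<i> * Q\<close>.
\<close>

lemma mult_cnj_eq_Complex: "a * cnj b = Complex (a \<bullet> b) (a \<bullet> (\<i> * b))"
  by (simp add: complex_eq_iff inner_complex_def)

lemma ip_complex_eq:
  assumes "open \<Omega>" "bounded \<Omega>" "continuous_on (closure \<Omega>) f" "continuous_on (closure \<Omega>) g"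
  shows "ip_complex \<Omega> f g = Complex (LINT x:\<Omega>|lebesgue. f x \<bullet> g x) (LINT x:\<Omega>|lebesgue. f x \<bullet> (\<i> * g x))"
  unfolding ip_complex_def mult_cnj_eq_Complex
  by (intro set_integral_Complex set_integrable_continuous_closure continuous_intros assms)

lemma square_integrable_imaginary_multiple:
  fixes g :: "real^2 \<Rightarrow> complex^2"
  assumes "square_integrable \<Omega> g"
  shows "square_integrable \<Omega> (\<lambda>x. \<chi> i. \<i> * g x $ i)"
  by (rule square_integrable_bounded_linear(1)[OF
        bounded_linear_componentwise[OF bounded_linear_mult_right] norm_componentwise_le[of _ 1] assms])
    (simp add: norm_mult)

lemma ip_complex_vec_eq:
  assumes f: "square_integrable \<Omega> f" and g: "square_integrable \<Omega> g"
  shows "ip_complex_vec \<Omega> f g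
    = Complex (LINT x:\<Omega>|lebesgue. f x \<bullet> g x) (LINT x:\<Omega>|lebesgue. f x \<bullet> (\<chi> i. \<i> * g x $ i))"
proof -
  have "(\<Sum>i\<in>UNIV. f x $ i * cnj (g x $ i)) = Complex (f x \<bullet> g x) (f x \<bullet> (\<chi> i. \<i> * g x $ i))" for x
    by (simp add: inner_vec_def sum_2 mult_cnj_eq_Complex complex_add)
  then show ?thesis
    unfolding ip_complex_vec_def
    using set_integral_Complex[OF square_integrable_inner[OF f g] square_integrable_inner[OF f square_integrable_imaginary_multiple[OF g]]] by simp
qed

text \<open>
  The discrete problem on one mesh, with the complex equation replaced by its real part. It is
  written in coordinates with respect to orthonormal bases \<open>d\<close> of the complex space
  (as a real vector space) and \<open>b\<close> of the real one, and solved by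
  \<open>coupled_system_solvable\<close>.
\<close>

lemma discrete_problem_solvable:
  fixes \<Omega> :: "(real^2) set" and \<T> :: "(real^2) set set" and H0 :: complex
  assumes \<Omega>: "open \<Omega>" "bounded \<Omega>" and fin: "finite \<T>" and \<T>: "\<Union>\<T> = closure \<Omega>"
    and \<omega>: "\<omega> \<ge> 0" and \<mu>_cont: "continuous_on UNIV \<mu>" and \<mu>: "\<And>s. \<bar>\<mu> s\<bar> \<le> \<mu>_hi"
  shows "\<exists>(Ht :: real^2 \<Rightarrow> complex) \<in> P1_space0 \<Omega> \<T>. \<exists>(u :: real^2 \<Rightarrow> real) \<in> P1_space0 \<Omega> \<T>.
     (\<forall>Q \<in> P1_space0 \<Omega> \<T>. dirichlet_form \<Omega> Ht Q
        + (LINT x:\<Omega>|lebesgue. (\<i> * of_real \<omega> * of_real (\<mu> (u x)) * (Ht x - H0)) \<bullet> Q x) = 0) \<and>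
     (\<forall>v \<in> P1_space0 \<Omega> \<T>. dirichlet_form \<Omega> u v
        = (LINT x:\<Omega>|lebesgue. (norm (weak_gradient \<Omega> Ht x))\<^sup>2 * v x))"
proof -
  obtain m :: nat and d :: "nat \<Rightarrow> real^2 \<Rightarrow> complex"
    where d: "\<And>i. i < m \<Longrightarrow> d i \<in> P1_space0 \<Omega> \<T>"
      and d_orth: "\<And>i j. \<lbrakk>i < m; j < m\<rbrakk> \<Longrightarrow> dirichlet_form \<Omega> (d i) (d j) = (if i = j then 1 else 0)"
      and d_span: "\<And>v. v \<in> P1_space0 \<Omega> \<T> \<Longrightarrow> \<exists>c. \<forall>x\<in>closure \<Omega>. v x = (\<Sum>i<m. c i *\<^sub>R d i x)"
    using P1_space0_orthonormal_basis[OF \<Omega> fin \<T>, where 'a = complex] by blast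
  obtain n :: nat and b :: "nat \<Rightarrow> real^2 \<Rightarrow> real"
    where b: "\<And>i. i < n \<Longrightarrow> b i \<in> P1_space0 \<Omega> \<T>"
      and b_orth: "\<And>i j. \<lbrakk>i < n; j < n\<rbrakk> \<Longrightarrow> dirichlet_form \<Omega> (b i) (b j) = (if i = j then 1 else 0)"
      and b_span: "\<And>v. v \<in> P1_space0 \<Omega> \<T> \<Longrightarrow> \<exists>c. \<forall>x\<in>closure \<Omega>. v x = (\<Sum>i<n. c i *\<^sub>R b i x)"
    using P1_space0_orthonormal_basis[OF \<Omega> fin \<T>, where 'a = real] by blast
  define U where "U z x = (\<Sum>k<n. z (m + k) *\<^sub>R b k x)" for z :: "nat \<Rightarrow> real" and x
  define Ht where "Ht z x = (\<Sum>j<m. z j *\<^sub>R d j x)" for z :: "nat \<Rightarrow> real" and x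
  define a where "a z x = \<i> * of_real \<omega> * of_real (\<mu> (U z x))" for z x
  define T where "T j l k = (LINT x:\<Omega>|lebesgue. (weak_gradient \<Omega> (d j) x \<bullet> weak_gradient \<Omega> (d l) x) * b k x)" for j l k
  define g where "g z i = - (LINT x:\<Omega>|lebesgue. (a z x * (Ht z x - H0)) \<bullet> d i x)" for z i
  define q where "q z k = (\<Sum>j<m. \<Sum>l<m. z j * z l * T j l k)" for z :: "nat \<Rightarrow> real" and k
  define F where "F i = (LINT x:\<Omega>|lebesgue. \<omega> * \<mu>_hi * norm H0 * norm (d i x))" for i
  define M where "M k = (\<Sum>j<m. \<Sum>l<m. \<bar>T j l k\<bar>)" for k
  have \<mu>_hi: "0 \<le> \<mu>_hi" using \<mu>[of 0] by linarith
  have cont: "continuous_on (closure \<Omega>) (d i)" if "i < m" for i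
    by (rule P1_space0_continuous[OF d[OF that]])
  have contb: "continuous_on (closure \<Omega>) (b k)" if "k < n" for k
    by (rule P1_space0_continuous[OF b[OF that]])
  have U_space: "U z \<in> P1_space0 \<Omega> \<T>" for z
    unfolding U_def[abs_def] by (rule P1_space0_sum(1)[OF \<Omega>(1) b])
  have Ht_space: "Ht z \<in> P1_space0 \<Omega> \<T>" for z
    unfolding Ht_def[abs_def] by (rule P1_space0_sum(1)[OF \<Omega>(1) d])
  have contHt: "continuous_on (closure \<Omega>) (Ht z)" and contU: "continuous_on (closure \<Omega>) (U z)" for z
    by (rule P1_space0_continuous[OF Ht_space], rule P1_space0_continuous[OF U_space])
  have conta: "continuous_on (closure \<Omega>) (a z)" for z
    unfolding a_def[abs_def]
    by (intro continuous_intros continuous_on_compose2[OF \<mu>_cont contU]) auto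
  have norm_a: "norm (a z x) \<le> \<omega> * \<mu>_hi" for z x
    unfolding a_def using \<mu>[of "U z x"] \<omega> by (simp add: norm_mult mult_left_mono)
  note intc = set_integrable_continuous_closure[OF \<Omega>]
  have int_g: "set_integrable lebesgue \<Omega> (\<lambda>x. (a z x * (Ht z x - H0)) \<bullet> Q x)"
    if "continuous_on (closure \<Omega>) Q" for z Q
    by (intro intc continuous_intros conta contHt that)
  have "\<exists>z. (\<forall>i<m. z i = g z i) \<and> (\<forall>i<n. z (m + i) = q z i)"
  proof (rule coupled_system_solvable)
    fix X :: "nat \<Rightarrow> nat \<Rightarrow> real" and z i
    assume i: "i < m" and X: "\<And>j. j < m + n \<Longrightarrow> (\<lambda>k. X k j) \<longlonglongrightarrow> z j"
    have "\<forall>j<m. \<exists>B. \<forall>k. \<bar>X k j\<bar> \<le> B"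
    proof (intro allI impI)
      fix j assume "j < m"
      then have "Bseq (\<lambda>k. X k j)" using X[of j] by (intro convergent_imp_Bseq convergentI) auto
      then show "\<exists>B. \<forall>k. \<bar>X k j\<bar> \<le> B" by (auto simp: Bseq_def)
    qed
    then obtain B where B: "\<And>j k. j < m \<Longrightarrow> \<bar>X k j\<bar> \<le> B j" by metis
    \<comment> \<open>The coordinates stay bounded along the convergent sequence, which yields an integrable majorant.\<close>
    define w where "w x = \<omega> * \<mu>_hi * ((\<Sum>j<m. B j * norm (d j x)) + norm H0) * norm (d i x)" for x
    have contw: "continuous_on (closure \<Omega>) w"
      unfolding w_def[abs_def] using cont i by (intro continuous_intros) auto
    have le: "norm ((a (X k) x * (Ht (X k) x - H0)) \<bullet> d i x) \<le> w x" for k x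
    proof -
      have "norm (Ht (X k) x) \<le> (\<Sum>j<m. B j * norm (d j x))"
        unfolding Ht_def using B by (intro sum_norm_le) (auto intro!: mult_right_mono)
      then have "norm (Ht (X k) x - H0) \<le> (\<Sum>j<m. B j * norm (d j x)) + norm H0"
        using norm_triangle_ineq4[of "Ht (X k) x" H0] by linarith
      then have "norm (a (X k) x * (Ht (X k) x - H0)) \<le> \<omega> * \<mu>_hi * ((\<Sum>j<m. B j * norm (d j x)) + norm H0)"
        unfolding norm_mult using norm_a[of "X k" x] \<omega> \<mu>_hi by (intro mult_mono) auto
      then have "norm (a (X k) x * (Ht (X k) x - H0)) * norm (d i x) \<le> w x"
        unfolding w_def by (intro mult_right_mono) auto
      then show ?thesis using Cauchy_Schwarz_ineq2[of "a (X k) x * (Ht (X k) x - H0)" "d i x"] by simp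
    qed
    have lim: "(\<lambda>k. (a (X k) x * (Ht (X k) x - H0)) \<bullet> d i x) \<longlonglongrightarrow> (a z x * (Ht z x - H0)) \<bullet> d i x" for x
    proof -
      have "(\<lambda>k. U (X k) x) \<longlonglongrightarrow> U z x" unfolding U_def by (intro tendsto_intros X) auto
      then have "(\<lambda>k. \<mu> (U (X k) x)) \<longlonglongrightarrow> \<mu> (U z x)"
        using \<mu>_cont by (intro isCont_tendsto_compose[of _ \<mu>]) (auto simp: continuous_on_eq_continuous_at)
      moreover have "(\<lambda>k. Ht (X k) x) \<longlonglongrightarrow> Ht z x" unfolding Ht_def by (intro tendsto_intros X) auto
      ultimately show ?thesis unfolding a_def by (intro tendsto_intros)
    qed
    have "(\<lambda>k. integral\<^sup>L lebesgue (\<lambda>x. indicator \<Omega> x *\<^sub>R ((a (X k) x * (Ht (X k) x - H0)) \<bullet> d i x)))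
        \<longlonglongrightarrow> integral\<^sup>L lebesgue (\<lambda>x. indicator \<Omega> x *\<^sub>R ((a z x * (Ht z x - H0)) \<bullet> d i x))"
    proof (rule integral_dominated_convergence)
      show "integrable lebesgue (\<lambda>x. indicator \<Omega> x *\<^sub>R w x)"
        using intc[OF contw] by (simp add: set_integrable_def)
      show "AE x in lebesgue. (\<lambda>k. indicator \<Omega> x *\<^sub>R ((a (X k) x * (Ht (X k) x - H0)) \<bullet> d i x))
          \<longlonglongrightarrow> indicator \<Omega> x *\<^sub>R ((a z x * (Ht z x - H0)) \<bullet> d i x)"
        by (intro AE_I2 tendsto_scaleR tendsto_const lim)
      show "AE x in lebesgue. norm (indicator \<Omega> x *\<^sub>R ((a (X k) x * (Ht (X k) x - H0)) \<bullet> d i x)) \<le> indicator \<Omega> x *\<^sub>R w x" for k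
      proof (rule AE_I2)
        fix x
        show "norm (indicator \<Omega> x *\<^sub>R ((a (X k) x * (Ht (X k) x - H0)) \<bullet> d i x)) \<le> indicator \<Omega> x *\<^sub>R w x"
          using le[of k x] by (cases "x \<in> \<Omega>") auto
      qed
    qed (use int_g[OF cont[OF i]] in \<open>simp_all add: set_integrable_def borel_measurable_integrable\<close>)
    then show "(\<lambda>k. g (X k) i) \<longlonglongrightarrow> g z i"
      unfolding g_def set_lebesgue_integral_def by (rule tendsto_minus)
  next
    fix X :: "nat \<Rightarrow> nat \<Rightarrow> real" and z i
    assume "i < n" and X: "\<And>j. j < m + n \<Longrightarrow> (\<lambda>k. X k j) \<longlonglongrightarrow> z j"
    show "(\<lambda>k. q (X k) i) \<longlonglongrightarrow> q z i"
      unfolding q_def by (intro tendsto_intros X) auto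
  next
    fix z
    have int: "set_integrable lebesgue \<Omega> (\<lambda>x. z i * ((a z x * H0) \<bullet> d i x))" if "i < m" for i
      by (intro intc continuous_intros conta cont that)
    have int': "set_integrable lebesgue \<Omega> (\<lambda>x. z i * ((a z x * (Ht z x - H0)) \<bullet> d i x))" if "i < m" for i
      using int_g[OF cont[OF that]] by simp
    have pt: "(\<Sum>i<m. z i * ((a z x * (Ht z x - H0)) \<bullet> d i x)) = - (\<Sum>i<m. z i * ((a z x * H0) \<bullet> d i x))" for x
    proof -
      \<comment> \<open>Multiplication by the imaginary number \<open>a z x\<close> is a skew map of the plane.\<close>
      have skew: "(a z x * Ht z x) \<bullet> Ht z x = 0"
        by (simp add: a_def inner_complex_def algebra_simps)
      have comb: "(\<Sum>i<m. z i * (y \<bullet> d i x)) = y \<bullet> Ht z x" for y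
        by (simp add: Ht_def inner_sum_right)
      show ?thesis unfolding comb using skew by (simp add: right_diff_distrib inner_diff_left)
    qed
    have "(\<Sum>i<m. z i * g z i) = - (\<Sum>i<m. (LINT x:\<Omega>|lebesgue. z i * ((a z x * (Ht z x - H0)) \<bullet> d i x)))"
      by (simp add: g_def sum_negf)
    also have "\<dots> = - (LINT x:\<Omega>|lebesgue. (\<Sum>i<m. z i * ((a z x * (Ht z x - H0)) \<bullet> d i x)))"
      using set_integral_sum(2)[OF int'] by simp
    also have "\<dots> = (LINT x:\<Omega>|lebesgue. (\<Sum>i<m. z i * ((a z x * H0) \<bullet> d i x)))"
      unfolding pt using set_integral_uminus[OF set_integral_sum(1)[OF int]] by simp
    also have "\<dots> = (\<Sum>i<m. (LINT x:\<Omega>|lebesgue. z i * ((a z x * H0) \<bullet> d i x)))"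
      by (rule set_integral_sum(2)[OF int])
    also have "\<dots> \<le> (\<Sum>i<m. \<bar>z i\<bar> * F i)"
    proof (rule sum_mono)
      fix i assume "i \<in> {..<m}"
      then have i: "i < m" by simp
      have "(LINT x:\<Omega>|lebesgue. z i * ((a z x * H0) \<bullet> d i x))
          \<le> (LINT x:\<Omega>|lebesgue. \<bar>z i\<bar> * (\<omega> * \<mu>_hi * norm H0 * norm (d i x)))"
      proof (rule set_integral_mono[OF int[OF i]])
        show "set_integrable lebesgue \<Omega> (\<lambda>x. \<bar>z i\<bar> * (\<omega> * \<mu>_hi * norm H0 * norm (d i x)))"
          by (intro intc continuous_intros cont i)
        fix x
        have "\<bar>(a z x * H0) \<bullet> d i x\<bar> \<le> norm (a z x * H0) * norm (d i x)" by (rule Cauchy_Schwarz_ineq2)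
        also have "\<dots> \<le> \<omega> * \<mu>_hi * norm H0 * norm (d i x)"
          unfolding norm_mult using norm_a by (intro mult_right_mono) auto
        finally have "\<bar>z i\<bar> * \<bar>(a z x * H0) \<bullet> d i x\<bar> \<le> \<bar>z i\<bar> * (\<omega> * \<mu>_hi * norm H0 * norm (d i x))"
          by (rule mult_left_mono) simp
        then show "z i * ((a z x * H0) \<bullet> d i x) \<le> \<bar>z i\<bar> * (\<omega> * \<mu>_hi * norm H0 * norm (d i x))"
          using abs_ge_self[of "z i * ((a z x * H0) \<bullet> d i x)"] unfolding abs_mult by linarith
      qed
      then show "(LINT x:\<Omega>|lebesgue. z i * ((a z x * H0) \<bullet> d i x)) \<le> \<bar>z i\<bar> * F i"
        unfolding F_def set_integral_mult_right .
    qed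
    finally show "(\<Sum>i<m. z i * g z i) \<le> (\<Sum>i<m. \<bar>z i\<bar> * F i)" .
  next
    fix z :: "nat \<Rightarrow> real" and k
    define S where "S = (\<Sum>j<m. (z j)\<^sup>2)"
    have prod: "\<bar>z j * z l\<bar> \<le> S" if "j < m" "l < m" for j l
    proof -
      have "2 * \<bar>z j * z l\<bar> \<le> (z j)\<^sup>2 + (z l)\<^sup>2"
        using sum_squares_bound[of "\<bar>z j\<bar>" "\<bar>z l\<bar>"] by (simp add: abs_mult)
      moreover have "(z j)\<^sup>2 \<le> (\<Sum>j<m. (z j)\<^sup>2)" "(z l)\<^sup>2 \<le> (\<Sum>j<m. (z j)\<^sup>2)"
        using that by (auto intro!: member_le_sum[of _ "{..<m}" "\<lambda>j. (z j)\<^sup>2"])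
      ultimately show ?thesis unfolding S_def by linarith
    qed
    have "\<bar>q z k\<bar> \<le> (\<Sum>j<m. \<Sum>l<m. \<bar>z j * z l * T j l k\<bar>)"
      unfolding q_def by (intro order_trans[OF sum_abs] sum_mono order_refl)
    also have "\<dots> \<le> (\<Sum>j<m. \<Sum>l<m. S * \<bar>T j l k\<bar>)"
    proof (intro sum_mono)
      fix j l assume "j \<in> {..<m}" "l \<in> {..<m}"
      then show "\<bar>z j * z l * T j l k\<bar> \<le> S * \<bar>T j l k\<bar>"
        using prod by (subst abs_mult[of "z j * z l"]) (intro mult_right_mono, auto)
    qed
    also have "\<dots> = M k * S" by (simp only: M_def sum_distrib_right) (simp only: mult.commute)
    finally show "\<bar>q z k\<bar> \<le> M k * (\<Sum>j<m. (z j)\<^sup>2)" by (simp only: S_def)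
  next
    show "0 \<le> F i" for i
      unfolding F_def set_lebesgue_integral_def using \<omega> \<mu>_hi
      by (intro Bochner_Integration.integral_nonneg) auto
    show "0 \<le> M i" for i by (simp add: M_def sum_nonneg)
  qed
  then obtain z where zg: "\<And>i. i < m \<Longrightarrow> z i = g z i" and zq: "\<And>i. i < n \<Longrightarrow> z (m + i) = q z i"
    by blast
  have "dirichlet_form \<Omega> (Ht z) Q
      + (LINT x:\<Omega>|lebesgue. (a z x * (Ht z x - H0)) \<bullet> Q x) = 0" if Q: "Q \<in> P1_space0 \<Omega> \<T>" for Q
  proof -
    obtain c where c: "\<forall>x\<in>closure \<Omega>. Q x = (\<Sum>i<m. c i *\<^sub>R d i x)" using d_span[OF Q] by blast
    then have eq: "Q x = (\<Sum>i<m. c i *\<^sub>R d i x)" if "x \<in> \<Omega>" for x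
      using that closure_subset by blast
    have 1: "dirichlet_form \<Omega> (Ht z) Q = (\<Sum>i<m. c i * z i)"
      unfolding Ht_def[abs_def] by (rule dirichlet_form_orthonormal[OF \<Omega>(1) d d_orth eq])
    have int: "set_integrable lebesgue \<Omega> (\<lambda>x. c i * ((a z x * (Ht z x - H0)) \<bullet> d i x))" if "i < m" for i
      using int_g[OF cont[OF that]] by simp
    have "(LINT x:\<Omega>|lebesgue. (a z x * (Ht z x - H0)) \<bullet> Q x)
        = (LINT x:\<Omega>|lebesgue. (\<Sum>i<m. c i * ((a z x * (Ht z x - H0)) \<bullet> d i x)))"
      by (rule set_integral_cong_on) (simp add: eq inner_sum_right)
    also have "\<dots> = (\<Sum>i<m. (LINT x:\<Omega>|lebesgue. c i * ((a z x * (Ht z x - H0)) \<bullet> d i x)))"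
      by (rule set_integral_sum(2)[OF int])
    also have "\<dots> = - (\<Sum>i<m. c i * g z i)"
      by (simp add: g_def sum_negf)
    finally show ?thesis using 1 zg by simp
  qed
  moreover have "dirichlet_form \<Omega> (U z) v
      = (LINT x:\<Omega>|lebesgue. (norm (weak_gradient \<Omega> (Ht z) x))\<^sup>2 * v x)" if v: "v \<in> P1_space0 \<Omega> \<T>" for v
  proof -
    let ?G = "weak_gradient \<Omega> (Ht z)"
    obtain c where c: "\<forall>x\<in>closure \<Omega>. v x = (\<Sum>i<n. c i *\<^sub>R b i x)" using b_span[OF v] by blast
    then have eq: "v x = (\<Sum>i<n. c i *\<^sub>R b i x)" if "x \<in> \<Omega>" for x
      using that closure_subset by blast
    have int: "set_integrable lebesgue \<Omega> (\<lambda>x. (norm (?G x))\<^sup>2 * b k x)" if "k < n" for k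
      using H1D(3)[OF \<Omega>(1) P1_space0_H1[OF Ht_space]]
      by (intro set_integrable_mult_continuous_closure[OF \<Omega>] contb that) (simp add: square_integrable_def)
    have q_eq: "q z k = (LINT x:\<Omega>|lebesgue. (norm (?G x))\<^sup>2 * b k x)" if k: "k < n" for k
    proof -
      let ?D = "\<lambda>j l x. (z j * z l) * ((weak_gradient \<Omega> (d j) x \<bullet> weak_gradient \<Omega> (d l) x) * b k x)"
      have intD: "set_integrable lebesgue \<Omega> (?D j l)" if "j < m" "l < m" for j l
        by (intro set_integrable_mult_right set_integrable_mult_continuous_closure[OF \<Omega>] contb k
            dirichlet_form_integrable[OF \<Omega>(1)] P1_space0_H1[OF d] that)
      have intD': "set_integrable lebesgue \<Omega> (\<lambda>x. \<Sum>l<m. ?D j l x)" if "j < m" for j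
        by (rule set_integral_sum(1)) (rule intD[OF that])
      have "q z k = (\<Sum>j<m. \<Sum>l<m. (LINT x:\<Omega>|lebesgue. ?D j l x))"
        by (simp add: q_def T_def)
      also have "\<dots> = (\<Sum>j<m. (LINT x:\<Omega>|lebesgue. \<Sum>l<m. ?D j l x))"
        by (intro sum.cong refl set_integral_sum(2)[symmetric] intD) auto
      also have "\<dots> = (LINT x:\<Omega>|lebesgue. \<Sum>j<m. \<Sum>l<m. ?D j l x)"
        by (rule set_integral_sum(2)[OF intD', symmetric])
      also have "\<dots> = (LINT x:\<Omega>|lebesgue. (norm (?G x))\<^sup>2 * b k x)"
      proof (rule set_integral_transfer_AE[OF set_integral_sum(1)[OF intD'] int[OF k]])
        have "AE x\<in>\<Omega> in lebesgue. ?G x = (\<Sum>j<m. z j *\<^sub>R weak_gradient \<Omega> (d j) x)"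
          unfolding Ht_def[abs_def] by (rule P1_space0_sum(2)[OF \<Omega>(1) d])
        then show "AE x\<in>\<Omega> in lebesgue. (\<Sum>j<m. \<Sum>l<m. ?D j l x) = (norm (?G x))\<^sup>2 * b k x"
          by eventually_elim
            (simp add: power2_norm_eq_inner inner_sum_left inner_sum_right sum_distrib_right sum_distrib_left mult_ac inner_commute)
      qed
      finally show ?thesis .
    qed
    have "dirichlet_form \<Omega> (U z) v = (\<Sum>i<n. c i * z (m + i))"
      unfolding U_def[abs_def] by (rule dirichlet_form_orthonormal[OF \<Omega>(1) b b_orth eq])
    also have "\<dots> = (\<Sum>i<n. (LINT x:\<Omega>|lebesgue. c i * ((norm (?G x))\<^sup>2 * b i x)))"
      by (simp add: zq q_eq)
    also have "\<dots> = (LINT x:\<Omega>|lebesgue. \<Sum>i<n. c i * ((norm (?G x))\<^sup>2 * b i x))"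
      by (rule set_integral_sum(2)[symmetric]) (use int in simp)
    also have "\<dots> = (LINT x:\<Omega>|lebesgue. (norm (?G x))\<^sup>2 * v x)"
      by (rule set_integral_cong_on) (simp add: eq sum_distrib_left sum_distrib_right mult_ac)
    finally show ?thesis .
  qed
  ultimately show ?thesis
    unfolding a_def
    by (intro bexI[OF _ Ht_space[of z]] bexI[OF _ U_space[of z]] conjI ballI)
qed

theorem theorem4p4:
  fixes \<Omega> :: "(real^2) set"
    and I :: "real set"
    and \<T> :: "real \<Rightarrow> (real^2) set set"
    and \<mu> :: "real \<Rightarrow> real"
    and \<mu>_lo \<mu>_hi \<omega> :: real
    and H0 :: complex
  assumes "polygonal_lipschitz_domain \<Omega>"
    and "convex \<Omega>"
    and "\<omega> > 0"
    and "\<exists>L. L-lipschitz_on UNIV \<mu>"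
    and "0 < \<mu>_lo"
    and "\<And>s. \<mu>_lo \<le> \<mu> s \<and> \<mu> s \<le> \<mu>_hi"
    and "mesh_family \<Omega> I \<T>"
    and "shape_regular I \<T>"
    and "quasi_uniform I \<T>"
  shows "\<exists>h0>0. \<forall>h\<in>I. h \<le> h0 \<longrightarrow>
     (\<exists>(H :: real^2 \<Rightarrow> complex) \<in> P1_space \<Omega> (\<T> h). \<exists>(u :: real^2 \<Rightarrow> real) \<in> P1_space0 \<Omega> (\<T> h).
        (\<lambda>x. H x - H0) \<in> P1_space0 \<Omega> (\<T> h) \<and>
        (\<forall>Q \<in> P1_space0 \<Omega> (\<T> h). \<forall>v \<in> P1_space0 \<Omega> (\<T> h).
           ip_complex_vec \<Omega> (weak_gradient \<Omega> (\<lambda>x. H x - H0)) (weak_gradient \<Omega> Q)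
             + ip_complex \<Omega> (\<lambda>x. \<i> * of_real \<omega> * of_real (\<mu> (u x)) * (H x - H0)) Q
             = ip_complex \<Omega> (\<lambda>x. \<i> * of_real \<omega> * of_real (\<mu> (u x)) * H0) Q \<and>
           ip_real \<Omega> (weak_gradient \<Omega> u) (weak_gradient \<Omega> v)
             = ip_real \<Omega> (\<lambda>x. (norm (weak_gradient \<Omega> H x))\<^sup>2) v))"
proof (intro exI[of _ 1] conjI ballI impI)
  \<comment> \<open>Every mesh is treated on its own, with constants depending on it; any threshold serves, for instance 1.\<close>
  show "(0::real) < 1" by simp
  fix h assume h: "h \<in> I"
  have \<Omega>: "open \<Omega>" "bounded \<Omega>"
    using assms(1) by (auto simp: polygonal_lipschitz_domain_def)
  have fin: "finite (\<T> h)" and \<T>: "\<Union>(\<T> h) = closure \<Omega>"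
    using assms(7) h by (auto simp: mesh_family_def mesh_def triangulation_def)
  have \<mu>_cont: "continuous_on UNIV \<mu>"
    using assms(4) lipschitz_on_continuous_on by blast
  have "\<bar>\<mu> s\<bar> \<le> \<mu>_hi" for s using assms(5) assms(6)[of s] by linarith
  from discrete_problem_solvable[OF \<Omega> fin \<T> _ \<mu>_cont this, of \<omega> H0] assms(3)
  obtain Ht :: "real^2 \<Rightarrow> complex" and u :: "real^2 \<Rightarrow> real"
    where Ht: "Ht \<in> P1_space0 \<Omega> (\<T> h)" and u: "u \<in> P1_space0 \<Omega> (\<T> h)"
      and eqQ: "\<And>Q. Q \<in> P1_space0 \<Omega> (\<T> h) \<Longrightarrow> dirichlet_form \<Omega> Ht Q
        + (LINT x:\<Omega>|lebesgue. (\<i> * of_real \<omega> * of_real (\<mu> (u x)) * (Ht x - H0)) \<bullet> Q x) = 0"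
      and eqv: "\<And>v. v \<in> P1_space0 \<Omega> (\<T> h) \<Longrightarrow> dirichlet_form \<Omega> u v
        = (LINT x:\<Omega>|lebesgue. (norm (weak_gradient \<Omega> Ht x))\<^sup>2 * v x)"
    by (auto simp: less_imp_le)
  define H where "H = (\<lambda>x. Ht x + H0)"
  have HHt: "(\<lambda>x. H x - H0) = Ht" by (simp add: H_def)
  note Ht1 = H1D[OF \<Omega>(1) P1_space0_H1[OF Ht]]
  have H_space: "H \<in> P1_space \<Omega> (\<T> h)"
  proof -
    have "\<exists>c0 c1 c2. \<forall>x\<in>K. H x = c0 + c1 * of_real (x $ 1) + c2 * of_real (x $ 2)" if "K \<in> \<T> h" for K
    proof -
      obtain c0 c1 c2 where "\<And>x. x \<in> K \<Longrightarrow> Ht x = c0 + c1 * of_real (x $ 1) + c2 * of_real (x $ 2)"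
        by (rule P1_space0_affine[OF Ht \<open>K \<in> \<T> h\<close>]) blast
      then have "\<forall>x\<in>K. H x = (c0 + H0) + c1 * of_real (x $ 1) + c2 * of_real (x $ 2)"
        by (simp add: H_def)
      then show ?thesis by blast
    qed
    then show ?thesis
      using P1_space0_continuous[OF Ht] by (auto simp: P1_space_def H_def intro!: continuous_intros)
  qed
  have H1: "H \<in> H1 \<Omega>"
    and gradH: "AE x\<in>\<Omega> in lebesgue. weak_gradient \<Omega> H x = weak_gradient \<Omega> Ht x"
    unfolding H_def by (rule H1_add_const[OF \<Omega> P1_space0_H1[OF Ht]])+
  define a where "a x = \<i> * of_real \<omega> * of_real (\<mu> (u x))" for x
  have conta: "continuous_on (closure \<Omega>) a"
    unfolding a_def[abs_def]
    by (intro continuous_intros continuous_on_compose2[OF \<mu>_cont P1_space0_continuous[OF u]]) auto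
  note contHt = P1_space0_continuous[OF Ht]
  have first: "ip_complex_vec \<Omega> (weak_gradient \<Omega> Ht) (weak_gradient \<Omega> Q)
      + ip_complex \<Omega> (\<lambda>x. a x * Ht x) Q = ip_complex \<Omega> (\<lambda>x. a x * H0) Q"
    if Q: "Q \<in> P1_space0 \<Omega> (\<T> h)" for Q
  proof -
    have iQ: "(\<lambda>x. \<i> * Q x) \<in> P1_space0 \<Omega> (\<T> h)"
      by (rule P1_space0_bounded_linear[OF \<Omega>(1) bounded_linear_mult_right Q])
    note Q1 = H1D[OF \<Omega>(1) P1_space0_H1[OF Q]]
    note contQ = P1_space0_continuous[OF Q]
    have diff: "(LINT x:\<Omega>|lebesgue. (a x * (Ht x - H0)) \<bullet> R x)
        = (LINT x:\<Omega>|lebesgue. (a x * Ht x) \<bullet> R x) - (LINT x:\<Omega>|lebesgue. (a x * H0) \<bullet> R x)"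
      if "continuous_on (closure \<Omega>) R" for R
      unfolding right_diff_distrib inner_diff_left
      by (intro set_integral_diff set_integrable_continuous_closure[OF \<Omega>] continuous_intros conta contHt that)
    have "dirichlet_form \<Omega> Ht (\<lambda>x. \<i> * Q x)
        = (LINT x:\<Omega>|lebesgue. weak_gradient \<Omega> Ht x \<bullet> (\<chi> i. \<i> * weak_gradient \<Omega> Q x $ i))"
    proof -
      have w: "has_weak_gradient \<Omega> (\<lambda>x. \<i> * Q x) (\<lambda>x. \<chi> i. \<i> * weak_gradient \<Omega> Q x $ i)"
        by (rule has_weak_gradient_bounded_linear[OF bounded_linear_mult_right Q1(2)])
      have ae: "AE x\<in>\<Omega> in lebesgue. weak_gradient \<Omega> (\<lambda>x. \<i> * Q x) x = (\<chi> i. \<i> * weak_gradient \<Omega> Q x $ i)"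
        by (rule weak_gradient_eq_AE[OF \<Omega>(1) w])
      show ?thesis
        unfolding dirichlet_form_def
        by (intro set_integral_transfer_AE square_integrable_inner Ht1(3)
            square_integrable_imaginary_multiple Q1(3) H1D(3)[OF \<Omega>(1) P1_space0_H1[OF iQ]])
          (use ae in \<open>eventually_elim, simp\<close>)
    qed
    then have im: "(LINT x:\<Omega>|lebesgue. weak_gradient \<Omega> Ht x \<bullet> (\<chi> i. \<i> * weak_gradient \<Omega> Q x $ i))
        + (LINT x:\<Omega>|lebesgue. (a x * Ht x) \<bullet> (\<i> * Q x)) = (LINT x:\<Omega>|lebesgue. (a x * H0) \<bullet> (\<i> * Q x))"
      using eqQ[OF iQ] diff[OF P1_space0_continuous[OF iQ]] by (simp add: a_def)
    have re: "(LINT x:\<Omega>|lebesgue. weak_gradient \<Omega> Ht x \<bullet> weak_gradient \<Omega> Q x)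
        + (LINT x:\<Omega>|lebesgue. (a x * Ht x) \<bullet> Q x) = (LINT x:\<Omega>|lebesgue. (a x * H0) \<bullet> Q x)"
      using eqQ[OF Q] diff[OF contQ] by (simp add: a_def dirichlet_form_def)
    have "ip_complex \<Omega> (\<lambda>x. a x * Ht x) Q
        = Complex (LINT x:\<Omega>|lebesgue. (a x * Ht x) \<bullet> Q x) (LINT x:\<Omega>|lebesgue. (a x * Ht x) \<bullet> (\<i> * Q x))"
      "ip_complex \<Omega> (\<lambda>x. a x * H0) Q
        = Complex (LINT x:\<Omega>|lebesgue. (a x * H0) \<bullet> Q x) (LINT x:\<Omega>|lebesgue. (a x * H0) \<bullet> (\<i> * Q x))"
      by (intro ip_complex_eq[OF \<Omega>] continuous_intros conta contHt contQ)+
    then show ?thesis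
      using re im by (simp only: ip_complex_vec_eq[OF Ht1(3) Q1(3)] complex_add)
  qed
  have second: "ip_real \<Omega> (weak_gradient \<Omega> u) (weak_gradient \<Omega> v)
      = ip_real \<Omega> (\<lambda>x. (norm (weak_gradient \<Omega> H x))\<^sup>2) v" if v: "v \<in> P1_space0 \<Omega> (\<T> h)" for v
  proof -
    note contv = P1_space0_continuous[OF v]
    have "(LINT x:\<Omega>|lebesgue. (norm (weak_gradient \<Omega> Ht x))\<^sup>2 * v x)
        = (LINT x:\<Omega>|lebesgue. (norm (weak_gradient \<Omega> H x))\<^sup>2 * v x)"
    proof (rule set_integral_transfer_AE)
      show "set_integrable lebesgue \<Omega> (\<lambda>x. (norm (weak_gradient \<Omega> Ht x))\<^sup>2 * v x)"
        using Ht1(3) by (intro set_integrable_mult_continuous_closure[OF \<Omega> _ contv]) (simp add: square_integrable_def)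
      show "set_integrable lebesgue \<Omega> (\<lambda>x. (norm (weak_gradient \<Omega> H x))\<^sup>2 * v x)"
        using H1D(3)[OF \<Omega>(1) H1]
        by (intro set_integrable_mult_continuous_closure[OF \<Omega> _ contv]) (simp add: square_integrable_def)
      show "AE x\<in>\<Omega> in lebesgue. (norm (weak_gradient \<Omega> Ht x))\<^sup>2 * v x = (norm (weak_gradient \<Omega> H x))\<^sup>2 * v x"
        using gradH by eventually_elim simp
    qed
    then show ?thesis
      using eqv[OF v] by (simp add: ip_real_def dirichlet_form_def)
  qed
  show "\<exists>H\<in>P1_space \<Omega> (\<T> h). \<exists>u\<in>P1_space0 \<Omega> (\<T> h).
        (\<lambda>x. H x - H0) \<in> P1_space0 \<Omega> (\<T> h) \<and>
        (\<forall>Q \<in> P1_space0 \<Omega> (\<T> h). \<forall>v \<in> P1_space0 \<Omega> (\<T> h).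
           ip_complex_vec \<Omega> (weak_gradient \<Omega> (\<lambda>x. H x - H0)) (weak_gradient \<Omega> Q)
             + ip_complex \<Omega> (\<lambda>x. \<i> * of_real \<omega> * of_real (\<mu> (u x)) * (H x - H0)) Q
             = ip_complex \<Omega> (\<lambda>x. \<i> * of_real \<omega> * of_real (\<mu> (u x)) * H0) Q \<and>
           ip_real \<Omega> (weak_gradient \<Omega> u) (weak_gradient \<Omega> v)
             = ip_real \<Omega> (\<lambda>x. (norm (weak_gradient \<Omega> H x))\<^sup>2) v)"
  proof (intro bexI[OF _ H_space] bexI[OF _ u] conjI ballI)
    show "(\<lambda>x. H x - H0) \<in> P1_space0 \<Omega> (\<T> h)" using Ht by (simp only: HHt)
    fix Q :: "real^2 \<Rightarrow> complex" and v :: "real^2 \<Rightarrow> real"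
    assume Q: "Q \<in> P1_space0 \<Omega> (\<T> h)" and v: "v \<in> P1_space0 \<Omega> (\<T> h)"
    have "ip_complex_vec \<Omega> (weak_gradient \<Omega> (\<lambda>x. H x - H0)) (weak_gradient \<Omega> Q)
        + ip_complex \<Omega> (\<lambda>x. a x * (H x - H0)) Q = ip_complex \<Omega> (\<lambda>x. a x * H0) Q"
      using first[OF Q] by (simp only: HHt) (simp add: H_def)
    then show "ip_complex_vec \<Omega> (weak_gradient \<Omega> (\<lambda>x. H x - H0)) (weak_gradient \<Omega> Q)
             + ip_complex \<Omega> (\<lambda>x. \<i> * of_real \<omega> * of_real (\<mu> (u x)) * (H x - H0)) Q
             = ip_complex \<Omega> (\<lambda>x. \<i> * of_real \<omega> * of_real (\<mu> (u x)) * H0) Q"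
      unfolding a_def .
    show "ip_real \<Omega> (weak_gradient \<Omega> u) (weak_gradient \<Omega> v)
             = ip_real \<Omega> (\<lambda>x. (norm (weak_gradient \<Omega> H x))\<^sup>2) v"
      by (rule second[OF v])
  qed
qed

end
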